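(* Let $K\subset\mathbb Z^d$ be a nonempty finite set. Conditioned on $\mathcal S_x$ visiting $K$, the intersection between $K$ and the range of $\mathcal S_x$ (a random subset of $K$) converges in distribution as $x\to\infty$.
   Context: Setting. $d\ge5$; $\mu$ is a probability distribution on $\mathbb N=\{0,1,2,\dots\}$ with mean $1$ and finite variance $\sigma^2>0$; $\theta$ is a probability distribution on $\mathbb Z^d$ with mean zero, not supported on a strict subgroup of $\mathbb Z^d$, such that for some $C>0$, $\theta(\{x:|x|>r\})<Cr^{-d}$ for all $r\ge1$ ($|\cdot|$ is the Euclidean norm). The snake $\mathcal S_x$ is the branching random walk on $\mathbb Z^d$ started from one particle at $x$: $T$ is a Galton–Watson tree with offspring law $\mu$; conditionally on $T$, its edges carry i.i.d. variables with law $\theta$; and $\mathcal S_T(v)-x$ is the sum of the variables on the simple path from the root to the vertex $v$. Its range is $\{\mathcal S_T(v):v\in T\}$; it visits $K$ if its range intersects $K$. *)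

theory Defs
  imports "HOL-Probability.Probability"
begin

definition real_vec :: "int^'d \<Rightarrow> real^'d" where
  "real_vec z = (\<chi> i. real_of_int (z $ i))"

definition znorm :: "int^'d \<Rightarrow> real" where
  "znorm z = norm (real_vec z)"

definition at_znorm_infinity :: "(int^'d) filter" where
  "at_znorm_infinity = filtercomap znorm at_top"

definition add_subgroup :: "'a::group_add set \<Rightarrow> bool" where
  "add_subgroup H \<longleftrightarrow> 0 \<in> H \<and> (\<forall>a\<in>H. \<forall>b\<in>H. a + b \<in> H) \<and> (\<forall>a\<in>H. - a \<in> H)"

text \<open>
  Trees are in Ulam--Harris coding: a vertex is the list of child indices (counted from 0) leading
  to it from the root \<open>[]\<close>. Given offspring numbers \<open>\<xi> v\<close> for all words \<open>v\<close>, only those attached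
  to words in the tree matter.
\<close>

inductive_set tree_vertices :: "(nat list \<Rightarrow> nat) \<Rightarrow> nat list set" for \<xi> where
  root: "[] \<in> tree_vertices \<xi>"
| child: "v \<in> tree_vertices \<xi> \<Longrightarrow> i < \<xi> v \<Longrightarrow> v @ [i] \<in> tree_vertices \<xi>"

text \<open>
  The edge from \<open>u\<close> to its child \<open>u @ [i]\<close> is identified with the child, so \<open>\<eta> (u @ [i])\<close> is the
  displacement along that edge; \<open>\<eta> []\<close> is never used.
\<close>

definition snake_pos :: "int^'d \<Rightarrow> (nat list \<Rightarrow> int^'d) \<Rightarrow> nat list \<Rightarrow> int^'d" where
  "snake_pos x \<eta> v = x + (\<Sum>k<length v. \<eta> (take (Suc k) v))"

definition snake_range :: "int^'d \<Rightarrow> (nat list \<Rightarrow> nat) \<times> (nat list \<Rightarrow> int^'d) \<Rightarrow> (int^'d) set" where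
  "snake_range x = (\<lambda>(\<xi>, \<eta>). snake_pos x \<eta> ` tree_vertices \<xi>)"

text \<open>
  Offspring numbers are i.i.d. with law \<open>\<mu>\<close>, displacements are i.i.d. with law \<open>\<theta>\<close>, and the two
  families are independent. Hence \<open>tree_vertices \<xi>\<close> is a Galton--Watson tree with offspring law
  \<open>\<mu>\<close> and, conditionally on it, its edges carry i.i.d. variables with law \<open>\<theta>\<close>.
\<close>

definition snake_space ::
  "nat pmf \<Rightarrow> (int^'d) pmf \<Rightarrow> ((nat list \<Rightarrow> nat) \<times> (nat list \<Rightarrow> int^'d)) measure" where
  "snake_space \<mu> \<theta> = (\<Pi>\<^sub>M v\<in>UNIV. measure_pmf \<mu>) \<Otimes>\<^sub>M (\<Pi>\<^sub>M v\<in>UNIV. measure_pmf \<theta>)"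

definition visit_event ::
  "nat pmf \<Rightarrow> (int^'d) pmf \<Rightarrow> (int^'d) set \<Rightarrow> int^'d
    \<Rightarrow> ((nat list \<Rightarrow> nat) \<times> (nat list \<Rightarrow> int^'d)) set" where
  "visit_event \<mu> \<theta> K x = {\<omega> \<in> space (snake_space \<mu> \<theta>). snake_range x \<omega> \<inter> K \<noteq> {}}"

definition cond_intersection_law ::
  "nat pmf \<Rightarrow> (int^'d) pmf \<Rightarrow> (int^'d) set \<Rightarrow> int^'d \<Rightarrow> (int^'d) set measure" where
  "cond_intersection_law \<mu> \<theta> K x =
     distr (uniform_measure (snake_space \<mu> \<theta>) (visit_event \<mu> \<theta> K x))
       (count_space (Pow K)) (\<lambda>\<omega>. K \<inter> snake_range x \<omega>)"

definition borel_prob :: "'a topology \<Rightarrow> 'a measure \<Rightarrow> bool" where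
  "borel_prob X N \<longleftrightarrow>
     prob_space N \<and> space N = topspace X \<and> sets N = sigma_sets (topspace X) {U. openin X U}"

text \<open>
  Weak convergence of laws on an arbitrary topological space, along a filter. The library's
  \<open>weak_conv_m\<close> is restricted to sequences of measures on the real line.
\<close>

definition converges_in_distribution ::
  "'a topology \<Rightarrow> ('i \<Rightarrow> 'a measure) \<Rightarrow> 'a measure \<Rightarrow> 'i filter \<Rightarrow> bool" where
  "converges_in_distribution X N L F \<longleftrightarrow>
     borel_prob X L \<and> (\<forall>\<^sub>F i in F. borel_prob X (N i)) \<and>
     (\<forall>f::'a \<Rightarrow> real. continuous_map X euclideanreal f \<and> bounded (f ` topspace X)
        \<longrightarrow> ((\<lambda>i. \<integral>y. f y \<partial>N i) \<longlongrightarrow> (\<integral>y. f y \<partial>L)) F)"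

end

theory Submission
  imports Defs
begin

text \<open>
  Write \<open>p\<^sub>A(x)\<close> for the probability that the snake started at \<open>x\<close> visits \<open>A\<close>. Each event
  \<open>K \<inter> range = B\<close> is obtained from visiting events of subsets of \<open>K\<close> by taking differences, so it
  suffices that \<open>p\<^sub>A(x) / p\<^sub>K(x)\<close> converges for every \<open>A \<subseteq> K\<close>. This follows from
  \<open>p\<^sub>A(x) = cap(A) g(-x) + o(|x|\<^sup>2\<^sup>-\<^sup>d)\<close> with \<open>cap(A) > 0\<close> for nonempty \<open>A\<close>, where \<open>g\<close> is the Green
  function of the random walk with step law \<open>\<theta>\<close>: the factor \<open>g(-x)\<close> cancels in the ratio, and of \<open>g\<close>
  only its order of magnitude and its regularity at infinity matter, not its precise asymptotics.

  The expansion of \<open>p = p\<^sub>A\<close> comes from a semilinear equation. Let \<open>P\<close> be the transition operator of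
  the walk and \<open>\<Phi>\<close> the generating function of \<open>\<mu>\<close>. Decomposing the tree at its root gives \<open>p = 1\<close> on
  \<open>A\<close> and \<open>p = 1 - \<Phi>(1 - P p)\<close> off \<open>A\<close>. As \<open>\<mu>\<close> has mean one and a second moment,
  \<open>1 - \<Phi>(1 - u) = u - O(u\<^sup>2)\<close>. Thus \<open>p - P p = f\<close>, where the charge \<open>f\<close> is bounded and is \<open>O((P p)\<^sup>2)\<close>
  off \<open>A\<close>. Comparison with the linear equation gives \<open>p = O(|x|\<^sup>2\<^sup>-\<^sup>d)\<close>, so
  \<open>f = O(|x|\<^sup>4\<^sup>-\<^sup>2\<^sup>d)\<close>, which is summable precisely because \<open>d > 4\<close>. A function that tends to zero and
  is harmonic vanishes, so \<open>p\<close> is the potential \<open>\<Sum>\<^sub>y g(y - x) f(y)\<close> of its charge; since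
  \<open>g(y - x) - g(-x) = o(|x|\<^sup>2\<^sup>-\<^sup>d)\<close> for fixed \<open>y\<close> and distant charges contribute little, the expansion
  holds with \<open>cap = \<Sum> f\<close> (\<open>hitting_asymptotic\<close>). Positivity of \<open>cap\<close> follows from a lower bound
  \<open>p \<ge> c |x|\<^sup>2\<^sup>-\<^sup>d\<close>, proved with a subsolution of the form \<open>c g - c' G(g\<^sup>2)\<close>.

  Potential theory is done for the lazy walk \<open>Q = (1 + P) / 2\<close>. Since \<open>1 - Q = (1 - P) / 2\<close>, this only
  changes the Green function by a factor two, and it removes periodicity. Three estimates on its \<open>n\<close>-step
  probabilities \<open>q\<^sub>n\<close> are needed: \<open>q\<^sub>n(x) \<le> C n\<^sup>-\<^sup>d\<^sup>/\<^sup>2\<close> together with a gradient bound better by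
  \<open>n\<^sup>-\<^sup>1\<^sup>/\<^sup>2\<close> (\<open>hk_upper\<close>, \<open>hk_gradient\<close>); a matching lower bound for \<open>|x| \<le> c n\<^sup>1\<^sup>/\<^sup>2\<close> (\<open>hk_lower\<close>);
  and \<open>q\<^sub>n(x) \<le> C |x|\<^sup>-\<^sup>d\<close> uniformly in \<open>n\<close> (\<open>hk_off_diagonal\<close>). The first two come from Fourier inversion on the
  torus; the third, which uses the tail hypothesis on \<open>\<theta>\<close> at full strength, from an exponential bound
  for truncated steps. Summing over \<open>n\<close> gives \<open>green_upper\<close>, \<open>green_lower\<close> and \<open>green_difference\<close>.
\<close>

section \<open>The norm on the lattice\<close>


lemma znorm_nonneg [simp]: "0 \<le> znorm x"
  by (simp add: znorm_def)

lemma real_vec_add: "real_vec (x + y) = real_vec x + real_vec y"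
  by (simp add: real_vec_def vec_eq_iff)

lemma real_vec_uminus: "real_vec (- x) = - real_vec x"
  by (simp add: real_vec_def vec_eq_iff)

lemma znorm_zero [simp]: "znorm 0 = 0"
  by (simp add: znorm_def real_vec_def zero_vec_def[symmetric])

lemma znorm_uminus [simp]: "znorm (- x) = znorm x"
  by (simp add: znorm_def real_vec_uminus)

lemma znorm_triangle: "znorm (x + y) \<le> znorm x + znorm y"
  by (simp add: znorm_def real_vec_add norm_triangle_ineq)

lemma znorm_minus_commute: "znorm (x - y) = znorm (y - x)"
  using znorm_uminus[of "x - y"] by simp

lemma znorm_triangle_diff: "znorm x \<le> znorm (y - x) + znorm y"
  using znorm_triangle[of "x - y" y] by (simp add: znorm_minus_commute)

lemma component_le_znorm: "\<bar>real_of_int (x $ i)\<bar> \<le> znorm x"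
  using component_le_norm_cart[of "real_vec x" i] by (simp add: znorm_def real_vec_def)

lemma znorm_le_sum: "znorm (x :: int^'d) \<le> (\<Sum>i\<in>UNIV. \<bar>real_of_int (x $ i)\<bar>)"
  using norm_le_l1_cart[of "real_vec x"] by (simp add: znorm_def real_vec_def)

lemma exists_large_component:
  "\<exists>i. znorm (x :: int^'d) \<le> real CARD('d) * \<bar>real_of_int (x $ i)\<bar>"
proof (rule ccontr)
  assume "\<not> ?thesis"
  then have *: "\<bar>real_of_int (x $ i)\<bar> < znorm x / real CARD('d)" for i
    by (simp add: not_le field_simps)
  have "(\<Sum>i\<in>UNIV. \<bar>real_of_int (x $ i)\<bar>) < (\<Sum>i\<in>(UNIV::'d set). znorm x / real CARD('d))"
    by (intro sum_strict_mono) (use * in auto)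
  with znorm_le_sum[of x] show False by simp
qed

lemma finite_znorm_ball: "finite {x :: int^'d. znorm x \<le> R}"
proof (rule finite_subset)
  let ?S = "{x. \<forall>i. x $ i \<in> {- \<lfloor>R\<rfloor>..\<lfloor>R\<rfloor>}} :: (int^'d) set"
  show "{x :: int^'d. znorm x \<le> R} \<subseteq> ?S"
  proof clarify
    fix x :: "int^'d" and i assume "znorm x \<le> R"
    with component_le_znorm[of x i] have "\<bar>real_of_int (x $ i)\<bar> \<le> R" by simp
    then have "real_of_int \<bar>x $ i\<bar> \<le> R" by simp
    then have "\<bar>x $ i\<bar> \<le> \<lfloor>R\<rfloor>" by (simp only: le_floor_iff)
    then show "x $ i \<in> {- \<lfloor>R\<rfloor>..\<lfloor>R\<rfloor>}" by auto
  qed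
  have "?S \<subseteq> (\<lambda>f. \<chi> i. f i) ` (PiE UNIV (\<lambda>_. {- \<lfloor>R\<rfloor>..\<lfloor>R\<rfloor>}))"
  proof
    fix x assume "x \<in> ?S"
    then show "x \<in> (\<lambda>f. \<chi> i. f i) ` (PiE UNIV (\<lambda>_. {- \<lfloor>R\<rfloor>..\<lfloor>R\<rfloor>}))"
      by (intro image_eqI[where x="\<lambda>i. x $ i"]) (auto simp: PiE_UNIV_domain)
  qed
  then show "finite ?S"
    by (rule finite_subset) (intro finite_imageI finite_PiE, auto)
qed

lemma at_znorm_infinity_iff:
  "eventually Q at_znorm_infinity \<longleftrightarrow> (\<exists>R. \<forall>x. znorm x \<ge> R \<longrightarrow> Q x)"
  by (auto simp: at_znorm_infinity_def eventually_filtercomap eventually_at_top_linorder)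

lemma at_znorm_infinity_neq_bot: "(at_znorm_infinity :: (int^'d) filter) \<noteq> bot"
proof -
  have "\<not> (\<exists>R. \<forall>x::int^'d. znorm x \<ge> R \<longrightarrow> False)"
  proof clarsimp
    fix R :: real
    have "\<bar>real_of_int (((\<chi> i. \<lceil>R\<rceil>) :: int^'d) $ undefined)\<bar> \<le> znorm ((\<chi> i. \<lceil>R\<rceil>) :: int^'d)"
      by (rule component_le_znorm)
    then show "\<exists>x::int^'d. R \<le> znorm x"
      by (intro exI[of _ "\<chi> i. \<lceil>R\<rceil>"]) (simp, linarith)
  qed
  then show ?thesis
    unfolding trivial_limit_def at_znorm_infinity_iff by simp
qed

section \<open>Random walks\<close>

text \<open>
  The transition operator of the walk with step law \<open>q\<close>.
\<close>

definition avg :: "'a::ab_group_add pmf \<Rightarrow> ('a \<Rightarrow> real) \<Rightarrow> 'a \<Rightarrow> real" where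
  "avg q u x = measure_pmf.expectation q (\<lambda>y. u (x + y))"

primrec walk :: "'a::ab_group_add pmf \<Rightarrow> nat \<Rightarrow> 'a pmf" where
  "walk q 0 = return_pmf 0"
| "walk q (Suc n) = bind_pmf q (\<lambda>y. map_pmf ((+) y) (walk q n))"

lemma integrable_pmf_bounded:
  fixes f :: "'a \<Rightarrow> 'b::{banach, second_countable_topology}"
  assumes "\<And>x. norm (f x) \<le> B"
  shows "integrable (measure_pmf p) f"
  by (rule measure_pmf.integrable_const_bound[where B=B]) (use assms in auto)

lemma integral_bind_pmf_real:
  fixes f :: "'a \<Rightarrow> real"
  assumes B: "\<And>x. \<bar>f x\<bar> \<le> B"
  shows "measure_pmf.expectation (bind_pmf p N) f
    = measure_pmf.expectation p (\<lambda>x. measure_pmf.expectation (N x) f)"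
  unfolding measure_pmf_bind
  by (rule integral_bind[where K="count_space UNIV" and B=B and B'=1])
     (use B measurable_measure_pmf[of N] in
       \<open>auto intro!: AE_I2 measure_pmf.subprob_emeasure_le_1 simp: measure_pmf.finite_measure_axioms\<close>)

text \<open>
  The complex version, needed for characteristic functions, follows by taking real and imaginary parts.
\<close>

lemma integral_bind_pmf_complex:
  fixes f :: "'a \<Rightarrow> complex"
  assumes B: "\<And>x. norm (f x) \<le> B"
  shows "measure_pmf.expectation (bind_pmf p N) f
    = measure_pmf.expectation p (\<lambda>x. measure_pmf.expectation (N x) f)"
proof -
  have I: "integrable (measure_pmf r) f" for r
    by (rule integrable_pmf_bounded[OF B])
  have nE: "norm (measure_pmf.expectation r f) \<le> B" for r
    by (rule order_trans[OF integral_norm_bound measure_pmf.integral_le_const])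
       (auto simp: B I)
  have I2: "integrable (measure_pmf p) (\<lambda>x. measure_pmf.expectation (N x) f)"
    by (rule integrable_pmf_bounded[OF nE])
  have b: "\<bar>Re (f x)\<bar> \<le> B" "\<bar>Im (f x)\<bar> \<le> B" for x
    using B[of x] abs_Re_le_cmod[of "f x"] abs_Im_le_cmod[of "f x"] by auto
  show ?thesis
    by (rule complex_eqI)
       (simp_all add: integral_Re[OF I, symmetric] integral_Re[OF I2, symmetric]
          integral_Im[OF I, symmetric] integral_Im[OF I2, symmetric]
          integral_bind_pmf_real[OF b(1)] integral_bind_pmf_real[OF b(2)])
qed

lemma avg_bound:
  assumes "\<And>x. \<bar>u x\<bar> \<le> B"
  shows "\<bar>avg q u x\<bar> \<le> B"
proof -
  have I: "integrable (measure_pmf q) (\<lambda>y. u (x + y))"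
    by (rule integrable_pmf_bounded[where B=B]) (use assms in auto)
  show ?thesis
    unfolding avg_def
    by (rule order_trans[OF integral_abs_bound measure_pmf.integral_le_const])
       (use I assms in auto)
qed

lemma integrable_shift_bounded:
  fixes u :: "'a::ab_group_add \<Rightarrow> real"
  assumes "\<And>x. \<bar>u x\<bar> \<le> B"
  shows "integrable (measure_pmf q) (\<lambda>y. u (x + y))"
  by (rule integrable_pmf_bounded[where B=B]) (use assms in auto)

lemma avg_mono:
  assumes "\<And>x. \<bar>u x\<bar> \<le> B" "\<And>x. \<bar>v x\<bar> \<le> B'" "\<And>x. u x \<le> v x"
  shows "avg q u x \<le> avg q v x"
  unfolding avg_def
  by (intro integral_mono integrable_shift_bounded[where B=B] integrable_shift_bounded[where B=B'] assms)

lemma avg_add: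
  assumes "\<And>x. \<bar>u x\<bar> \<le> B" "\<And>x. \<bar>v x\<bar> \<le> B'"
  shows "avg q (\<lambda>x. u x + v x) x = avg q u x + avg q v x"
  unfolding avg_def
  by (intro Bochner_Integration.integral_add integrable_shift_bounded[where B=B] integrable_shift_bounded[where B=B'] assms)

lemma avg_cmult: "avg q (\<lambda>x. c * u x) x = c * avg q u x"
  unfolding avg_def by simp

lemma avg_walk_Suc:
  assumes B: "\<And>x. \<bar>u x\<bar> \<le> B"
  shows "avg (walk q (Suc n)) u x = avg q (avg (walk q n) u) x"
  unfolding avg_def walk.simps
  by (subst integral_bind_pmf_real[where B=B]) (auto simp: B add.assoc)

lemma pmf_map_translate: "pmf (map_pmf ((+) y) p) x = pmf p (x - y)"
  for y :: "'a::ab_group_add"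
proof -
  have "inj ((+) y)" by (auto simp: inj_def)
  from pmf_map_inj'[OF this, of p "x - y"] show ?thesis by simp
qed

lemma pmf_walk_Suc:
  "pmf (walk q (Suc n)) z = measure_pmf.expectation q (\<lambda>y. pmf (walk q n) (z - y))"
  by (simp add: pmf_bind pmf_map_translate)

lemma walk_add: "walk q (m + n) = bind_pmf (walk q m) (\<lambda>y. map_pmf ((+) y) (walk q n))"
proof (induction m)
  case 0
  have "(+) (0::'a) = id" by auto
  then show ?case by (simp add: bind_return_pmf)
next
  case (Suc m)
  have "(+) (x + y) = (\<lambda>z. x + (y + z))" for x y :: 'a
    by (auto simp: add.assoc)
  with Suc show ?case
    by (simp add: bind_assoc_pmf map_bind_pmf bind_map_pmf pmf.map_comp o_def add.assoc)
qed

lemma pmf_walk_add: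
  "pmf (walk q (m + n)) z = measure_pmf.expectation (walk q m) (\<lambda>y. pmf (walk q n) (z - y))"
  by (simp add: walk_add pmf_bind pmf_map_translate)

text \<open>
  Passing to the lazy law halves \<open>u - avg p u\<close> (see \<open>avg_lazy\<close>), so harmonic functions are the same
  and potentials change only by a constant factor, while its characteristic function has modulus
  below one away from the origin of the torus, whatever the period of \<open>p\<close>.
\<close>

definition lazy :: "'a::ab_group_add pmf \<Rightarrow> 'a pmf" where
  "lazy p = bind_pmf (bernoulli_pmf (1/2)) (\<lambda>b. if b then p else return_pmf 0)"

lemma expectation_lazy_real:
  fixes f :: "'a::ab_group_add \<Rightarrow> real"
  assumes "\<And>x. \<bar>f x\<bar> \<le> B"
  shows "measure_pmf.expectation (lazy p) f = (measure_pmf.expectation p f + f 0) / 2"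
  unfolding lazy_def by (subst integral_bind_pmf_real[OF assms]) simp

lemma expectation_lazy_complex:
  fixes f :: "'a::ab_group_add \<Rightarrow> complex"
  assumes "\<And>x. norm (f x) \<le> B"
  shows "measure_pmf.expectation (lazy p) f = (measure_pmf.expectation p f + f 0) / 2"
  unfolding lazy_def by (subst integral_bind_pmf_complex[OF assms]) (simp add: integral_measure_pmf[of UNIV] UNIV_bool scaleR_conv_of_real add_divide_distrib)

lemma avg_lazy:
  assumes "\<And>x. \<bar>u x\<bar> \<le> B"
  shows "avg (lazy p) u x = (avg p u x + u x) / 2"
  unfolding avg_def by (subst expectation_lazy_real[where B=B]) (auto simp: assms)

section \<open>Fourier inversion on the torus\<close>

definition dotp :: "('d::finite \<Rightarrow> real) \<Rightarrow> int^'d \<Rightarrow> real" where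
  "dotp \<xi> x = (\<Sum>i\<in>UNIV. \<xi> i * real_of_int (x $ i))"

definition sq_norm :: "('d::finite \<Rightarrow> real) \<Rightarrow> real" where
  "sq_norm \<xi> = (\<Sum>i\<in>UNIV. (\<xi> i)\<^sup>2)"

definition unif :: "real measure" where
  "unif = density lborel (\<lambda>t. ennreal (indicator {-pi..pi} t / (2 * pi)))"

text \<open>
  The torus carries the uniform probability measure, written as a product over coordinates so that
  characters and Gaussian functions integrate coordinate by coordinate.
\<close>

definition torus :: "('d::finite \<Rightarrow> real) measure" where
  "torus = (\<Pi>\<^sub>M i\<in>UNIV. unif)"

definition chi :: "(int^'d::finite) pmf \<Rightarrow> ('d \<Rightarrow> real) \<Rightarrow> complex" where
  "chi p \<xi> = measure_pmf.expectation p (\<lambda>x. cis (dotp \<xi> x))"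

lemma sets_unif [measurable_cong, simp]: "sets unif = sets borel"
  by (simp add: unif_def)

lemma space_unif [simp]: "space unif = UNIV"
  by (simp add: unif_def)

lemma space_torus [simp]: "space torus = UNIV"
  by (simp add: torus_def space_PiM PiE_UNIV_domain)

lemma sets_torus [measurable_cong]: "sets torus = sets (\<Pi>\<^sub>M i\<in>UNIV. borel)"
  unfolding torus_def by (rule sets_PiM_cong) auto

interpretation unif: prob_space unif
proof
  have "emeasure unif (space unif) = (\<integral>\<^sup>+ t. ennreal (1 / (2 * pi)) * indicator {-pi..pi} t \<partial>lborel)"
    by (simp add: unif_def emeasure_density) (auto intro!: nn_integral_cong split: split_indicator)
  also have "\<dots> = ennreal (1 / (2 * pi)) * ennreal (2 * pi)"
    by (subst nn_integral_cmult_indicator) auto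
  also have "\<dots> = 1"
    by (simp add: ennreal_mult[symmetric] del: ennreal_mult)
  finally show "emeasure unif (space unif) = 1" .
qed

interpretation torus_factors: product_prob_space "\<lambda>_. unif" UNIV
  by standard

interpretation torus: prob_space torus
  unfolding torus_def by (rule prob_space_PiM) (rule unif.prob_space_axioms)

lemma integral_unif:
  fixes f :: "real \<Rightarrow> 'b::{banach, second_countable_topology}"
  assumes [measurable]: "f \<in> borel_measurable borel"
  shows "integral\<^sup>L unif f = (1 / (2 * pi)) *\<^sub>R (LINT t:{-pi..pi}|lborel. f t)"
  unfolding unif_def
  by (subst integral_density)
     (auto simp: set_lebesgue_integral_def integral_scaleR_right[symmetric] simp del: integral_scaleR_right
           intro!: Bochner_Integration.integral_cong)

lemma AE_unif: "AE t in unif. \<bar>t\<bar> \<le> pi"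
  unfolding unif_def by (subst AE_density) (auto intro!: AE_I2 split: split_indicator)

lemma AE_torus: "AE \<xi> in (torus :: ('d::finite \<Rightarrow> real) measure). \<forall>i. \<bar>\<xi> i\<bar> \<le> pi"
proof -
  have "AE \<xi> in (torus :: ('d \<Rightarrow> real) measure). \<forall>i\<in>UNIV. \<bar>\<xi> i\<bar> \<le> pi"
    unfolding torus_def
  proof (rule AE_finite_allI)
    fix i :: 'd
    show "AE \<xi> in (\<Pi>\<^sub>M i\<in>UNIV. unif). \<bar>\<xi> i\<bar> \<le> pi"
      by (rule AE_PiM_component[where M="\<lambda>_. unif" and P="\<lambda>t. \<bar>t\<bar> \<le> pi", OF _ _ AE_unif]) (auto intro: unif.prob_space_axioms)
  qed simp
  then show ?thesis by simp
qed

lemma measurable_coordinate [measurable]: "(\<lambda>\<xi>. \<xi> i) \<in> borel_measurable torus"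
  by measurable

lemma measurable_dotp [measurable]: "(\<lambda>\<xi>. dotp \<xi> x) \<in> borel_measurable torus"
  unfolding dotp_def by measurable

lemma measurable_sqn [measurable]: "sq_norm \<in> borel_measurable torus"
  unfolding sq_norm_def by measurable

lemma measurable_cis [measurable]: "cis \<in> borel_measurable borel"
  by (intro borel_measurable_continuous_onI continuous_intros)

lemma dotp_add: "dotp \<xi> (x + y) = dotp \<xi> x + dotp \<xi> y"
  by (simp add: dotp_def algebra_simps sum.distrib)

lemma dotp_uminus: "dotp \<xi> (- x) = - dotp \<xi> x"
  by (simp add: dotp_def sum_negf)

lemma dotp_diff: "dotp \<xi> (x - y) = dotp \<xi> x - dotp \<xi> y"
  using dotp_add[of \<xi> x "-y"] by (simp add: dotp_uminus)

lemma dotp_zero [simp]: "dotp \<xi> 0 = 0"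
  by (simp add: dotp_def)

lemma integral_cis_unif:
  "integral\<^sup>L unif (\<lambda>t. cis (t * real_of_int k)) = (if k = 0 then 1 else 0)"
proof (cases "k = 0")
  case True
  then show ?thesis using unif.prob_space by (simp add: unif.prob_space)
next
  case False
  let ?F = "\<lambda>t. cis (t * real_of_int k) / (\<i> * of_int k)"
  have "integral\<^sup>L unif (\<lambda>t. cis (t * real_of_int k)) =
    (1 / (2 * pi)) *\<^sub>R (LINT t:{-pi..pi}|lborel. cis (t * real_of_int k))"
    by (rule integral_unif) measurable
  also have "(LINT t:{-pi..pi}|lborel. cis (t * real_of_int k)) = ?F pi - ?F (- pi)"
    unfolding set_lebesgue_integral_def
  proof (rule integral_FTC_atLeastAtMost)
    show "- pi \<le> pi" by simp
    show "continuous_on {-pi..pi} (\<lambda>t. cis (t * real_of_int k))"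
      by (intro continuous_intros)
    fix x :: real
    have *: "((\<lambda>t. exp (\<i> * of_int k * of_real t)) has_vector_derivative
            (\<i> * of_int k) * exp (\<i> * of_int k * of_real x)) (at x within {-pi..pi})"
      by (rule has_vector_derivative_real_field) (auto intro!: derivative_eq_intros)
    have cis: "cis (t * real_of_int k) = exp (\<i> * of_int k * of_real t)" for t
      by (simp add: cis_conv_exp mult_ac)
    show "(?F has_vector_derivative cis (x * real_of_int k)) (at x within {-pi..pi})"
      unfolding cis using has_vector_derivative_divide[OF *, of "\<i> * of_int k"] False
      by simp
  qed
  also have "\<dots> = 0"
  proof -
    have "cis (- (pi * real_of_int k)) = cis (pi * real_of_int k)"
      by (intro complex_eqI) (auto simp: sin_int_times_real mult.commute)
    then show ?thesis by simp
  qed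
  finally show ?thesis using False by simp
qed

lemma cis_dotp: "cis (dotp \<xi> x) = (\<Prod>i\<in>UNIV. cis (\<xi> i * real_of_int (x $ i)))"
  by (simp add: dotp_def cis_conv_exp exp_sum sum_distrib_left)

lemma measurable_cis_unif [measurable]: "(\<lambda>t. cis (t * c)) \<in> borel_measurable unif"
  unfolding measurable_cong_sets[OF sets_unif refl]
  by (intro borel_measurable_continuous_onI continuous_intros)

lemma integral_cis_torus:
  "integral\<^sup>L torus (\<lambda>\<xi>. cis (dotp \<xi> x)) = (if x = 0 then 1 else 0)"
proof -
  have "integral\<^sup>L torus (\<lambda>\<xi>. cis (dotp \<xi> x))
      = (\<Prod>i\<in>UNIV. integral\<^sup>L unif (\<lambda>t. cis (t * real_of_int (x $ i))))"
    unfolding torus_def cis_dotp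
    by (rule torus_factors.product_integral_prod)
       (auto intro!: unif.integrable_const_bound[where B=1])
  then show ?thesis
    by (auto simp: integral_cis_unif vec_eq_iff)
qed

lemma chi_walk: "chi (walk q n) \<xi> = chi q \<xi> ^ n"
proof (induction n)
  case (Suc n)
  have "chi (walk q (Suc n)) \<xi> = measure_pmf.expectation q
     (\<lambda>y. measure_pmf.expectation (walk q n) (\<lambda>z. cis (dotp \<xi> (y + z))))"
    unfolding chi_def walk.simps by (subst integral_bind_pmf_complex[where B=1]) auto
  also have "\<dots> = chi q \<xi> * chi (walk q n) \<xi>"
    by (simp add: dotp_add cis_mult[symmetric] chi_def)
  finally show ?case using Suc by simp
qed (simp add: chi_def)

lemma norm_chi_le_1: "norm (chi p \<xi>) \<le> 1"
  unfolding chi_def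
  by (rule order_trans[OF integral_norm_bound measure_pmf.integral_le_const])
     (auto intro!: measure_pmf.integrable_const_bound[where B=1])

lemma measurable_cis_dotp_pair:
  "(\<lambda>(\<xi>, y). cis (dotp \<xi> (y - z))) \<in> borel_measurable (torus \<Otimes>\<^sub>M measure_pmf p)"
proof -
  have "(\<lambda>\<omega>. cis (dotp (fst \<omega>) (snd \<omega> - z))) \<in> borel_measurable (torus \<Otimes>\<^sub>M measure_pmf p)"
  proof (rule measurable_compose_countable[where g=snd and f="\<lambda>y \<omega>. cis (dotp (fst \<omega>) (y - z))"])
    show "snd \<in> torus \<Otimes>\<^sub>M measure_pmf p \<rightarrow>\<^sub>M count_space UNIV" by measurable
    fix y show "(\<lambda>\<omega>. cis (dotp (fst \<omega>) (y - z))) \<in> borel_measurable (torus \<Otimes>\<^sub>M measure_pmf p)"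
      by measurable
  qed
  then show ?thesis by (simp add: case_prod_beta')
qed

lemma integrable_cis_dotp_pair:
  "integrable (torus \<Otimes>\<^sub>M measure_pmf p) (\<lambda>(\<xi>, y). cis (dotp \<xi> (y - z)))"
proof -
  interpret tp: pair_prob_space torus "measure_pmf p" ..
  show ?thesis
    by (rule tp.integrable_const_bound[where B=1]) (auto simp: measurable_cis_dotp_pair)
qed

text \<open>
  Exchange the integral over the torus with the expectation over \<open>p\<close>; by orthogonality of the
  characters only the term \<open>y = z\<close> survives.
\<close>

lemma Fourier_inversion:
  "complex_of_real (pmf p z) = integral\<^sup>L torus (\<lambda>\<xi>. chi p \<xi> * cis (- dotp \<xi> z))"
proof -
  interpret tp: pair_prob_space torus "measure_pmf p" ..
  have "integral\<^sup>L torus (\<lambda>\<xi>. chi p \<xi> * cis (- dotp \<xi> z))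
     = integral\<^sup>L torus (\<lambda>\<xi>. measure_pmf.expectation p (\<lambda>y. cis (dotp \<xi> (y - z))))"
  proof -
    have "cis (dotp \<xi> (y - z)) = cis (dotp \<xi> y) * cis (- dotp \<xi> z)" for \<xi> y
      by (simp add: dotp_diff cis_mult)
    then show ?thesis by (simp add: chi_def)
  qed
  also have "\<dots> = measure_pmf.expectation p (\<lambda>y. integral\<^sup>L torus (\<lambda>\<xi>. cis (dotp \<xi> (y - z))))"
    by (rule tp.Fubini_integral[symmetric, OF integrable_cis_dotp_pair])
  also have "\<dots> = measure_pmf.expectation p (\<lambda>y. complex_of_real (indicator {z} y))"
    by (intro Bochner_Integration.integral_cong) (auto simp: integral_cis_torus split: split_indicator)
  also have "\<dots> = complex_of_real (pmf p z)"
    by (simp add: pmf.rep_eq)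
  finally show ?thesis by simp
qed

lemma measurable_chi [measurable]: "chi p \<in> borel_measurable torus"
proof -
  have "(\<lambda>\<xi>. measure_pmf.expectation p (\<lambda>y. cis (dotp \<xi> (y - 0)))) \<in> borel_measurable torus"
    by (rule measure_pmf.borel_measurable_lebesgue_integral) (rule measurable_cis_dotp_pair)
  then show ?thesis by (simp add: chi_def[abs_def])
qed

section \<open>Gaussian integrals over the torus\<close>

lemma integrable_torus_bounded:
  fixes f :: "('d::finite \<Rightarrow> real) \<Rightarrow> 'b::{banach, second_countable_topology}"
  assumes "f \<in> borel_measurable torus" "\<And>\<xi>. norm (f \<xi>) \<le> B"
  shows "integrable torus f"
  by (rule torus.integrable_const_bound[where B=B]) (use assms in auto)

text \<open>
  Extending the integral to the whole line gives a normal density up to normalisation.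
\<close>

lemma integral_gauss_unif:
  assumes a: "0 < a"
  shows "integral\<^sup>L unif (\<lambda>t. exp (- (a * t\<^sup>2))) \<le> 1 / sqrt a"
proof -
  define \<sigma> where "\<sigma> = 1 / sqrt (2 * a)"
  have s: "\<sigma> > 0" "\<sigma>\<^sup>2 = 1 / (2 * a)" using a by (auto simp: \<sigma>_def power_divide)
  have e: "exp (- (a * t\<^sup>2)) = sqrt (pi / a) * normal_density 0 \<sigma> t" for t
    using a by (simp add: normal_density_def s(2) real_sqrt_divide real_sqrt_mult field_simps)
  have "integral\<^sup>L unif (\<lambda>t. exp (- (a * t\<^sup>2)))
      = (1 / (2 * pi)) * (LINT t:{-pi..pi}|lborel. exp (- (a * t\<^sup>2)))"
    by (subst integral_unif) auto
  also have "(LINT t:{-pi..pi}|lborel. exp (- (a * t\<^sup>2))) \<le> (LINT t|lborel. sqrt (pi / a) * normal_density 0 \<sigma> t)"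
    unfolding set_lebesgue_integral_def e
  proof (rule integral_mono)
    show i: "integrable lborel (\<lambda>t. sqrt (pi / a) * normal_density 0 \<sigma> t)" using s by simp
    show "integrable lborel (\<lambda>t. indicator {-pi..pi} t *\<^sub>R (sqrt (pi / a) * normal_density 0 \<sigma> t))"
      by (rule integrable_mult_indicator[OF _ i]) simp
  qed (use a in \<open>auto split: split_indicator\<close>)
  also have "\<dots> = sqrt (pi / a)" using s by simp
  finally have "integral\<^sup>L unif (\<lambda>t. exp (- (a * t\<^sup>2))) \<le> (1 / (2 * pi)) * sqrt (pi / a)"
    by (simp add: field_simps)
  also have "\<dots> = sqrt pi / (2 * pi) * (1 / sqrt a)"
    by (simp add: real_sqrt_divide)
  also have "\<dots> \<le> 1 * (1 / sqrt a)"
  proof (rule mult_right_mono)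
    have "1 \<le> pi" using pi_gt3 by simp
    then have "sqrt pi * 1 \<le> sqrt pi * sqrt pi" by (intro mult_left_mono) auto
    then have "sqrt pi \<le> pi" by simp
    then have "sqrt pi \<le> 2 * pi" using pi_gt_zero by linarith
    then show "sqrt pi / (2 * pi) \<le> 1" by (simp add: divide_le_eq)
  qed (use a in auto)
  finally show ?thesis by simp
qed

lemma integral_gauss_torus:
  assumes a: "0 < a"
  shows "integral\<^sup>L torus (\<lambda>\<xi>::'d::finite \<Rightarrow> real. exp (- (a * sq_norm \<xi>))) \<le> (1 / sqrt a) ^ CARD('d)"
proof -
  have "exp (- (a * sq_norm \<xi>)) = (\<Prod>i\<in>UNIV. exp (- (a * (\<xi> i)\<^sup>2)))" for \<xi> :: "'d \<Rightarrow> real"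
    by (simp add: sq_norm_def sum_distrib_left sum_negf[symmetric] exp_sum)
  then have "integral\<^sup>L torus (\<lambda>\<xi>::'d \<Rightarrow> real. exp (- (a * sq_norm \<xi>)))
      = (\<Prod>i\<in>(UNIV::'d set). integral\<^sup>L unif (\<lambda>t. exp (- (a * t\<^sup>2))))"
    unfolding torus_def
    by (simp only:) (rule torus_factors.product_integral_prod,
       use a in \<open>auto intro!: unif.integrable_const_bound[where B=1]
         simp: measurable_cong_sets[OF sets_unif refl]\<close>)
  also have "\<dots> \<le> (\<Prod>i\<in>(UNIV::'d set). 1 / sqrt a)"
    by (intro prod_mono conjI integral_gauss_unif a integral_nonneg) auto
  finally show ?thesis by simp
qed

lemma integrable_gauss_torus: "0 \<le> a \<Longrightarrow> integrable torus (\<lambda>\<xi>. exp (- (a * sq_norm \<xi>)))"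
  by (rule integrable_torus_bounded[where B=1]) (auto simp: sq_norm_def intro!: sum_nonneg mult_nonneg_nonneg)

section \<open>Heat kernel estimates\<close>

locale lattice_step =
  fixes \<theta> :: "(int^'d::finite) pmf"
  assumes dim: "CARD('d) \<ge> 5"
    and step_mean: "integrable (measure_pmf \<theta>) real_vec" "measure_pmf.expectation \<theta> real_vec = 0"
    and step_supp: "\<And>H. add_subgroup H \<Longrightarrow> H \<noteq> UNIV \<Longrightarrow> \<not> set_pmf \<theta> \<subseteq> H"
    and step_tail: "\<exists>C::real. C > 0 \<and>
      (\<forall>r::real. r \<ge> 1 \<longrightarrow> measure_pmf.prob \<theta> {z. znorm z > r} < C * r powr - real CARD('d))"
begin

abbreviation "q \<equiv> lazy \<theta>"
abbreviation "hk n \<equiv> pmf (walk q n)"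

end

lemma one_minus_Re_chi: "1 - Re (chi p \<xi>) = measure_pmf.expectation p (\<lambda>x. 1 - cos (dotp \<xi> x))"
proof -
  have I: "integrable (measure_pmf p) (\<lambda>x. cis (dotp \<xi> x))"
    by (rule integrable_pmf_bounded[where B=1]) simp
  have "Re (chi p \<xi>) = measure_pmf.expectation p (\<lambda>x. cos (dotp \<xi> x))"
    unfolding chi_def by (subst integral_Re[OF I, symmetric]) simp
  moreover have "integrable (measure_pmf p) (\<lambda>x. cos (dotp \<xi> x))"
    by (rule integrable_pmf_bounded[where B=1]) simp
  ultimately show ?thesis by simp
qed

lemma Im_chi: "Im (chi p \<xi>) = measure_pmf.expectation p (\<lambda>x. sin (dotp \<xi> x))"
proof -
  have I: "integrable (measure_pmf p) (\<lambda>x. cis (dotp \<xi> x))"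
    by (rule integrable_pmf_bounded[where B=1]) simp
  show ?thesis unfolding chi_def by (subst integral_Im[OF I, symmetric]) simp
qed

text \<open>
  Third order Taylor expansion of the sine at \<open>t / 2\<close>, which lies in \<open>[-1.6, 1.6]\<close>.
\<close>

lemma one_minus_cos_ge:
  fixes t :: real assumes "\<bar>t\<bar> \<le> pi" shows "t\<^sup>2 / 8 \<le> 1 - cos t"
proof -
  define u where "u = t / 2"
  have u: "\<bar>u\<bar> \<le> 1.6" using assms pi_less_4 pi_approx by (simp add: u_def)
  have "\<bar>sin u - (\<Sum>m<3. sin_coeff m * u ^ m)\<bar> \<le> inverse (fact 3) * \<bar>u\<bar> ^ 3"
    by (rule Maclaurin_sin_bound)
  then have "\<bar>sin u - u\<bar> \<le> \<bar>u\<bar> ^ 3 / 6"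
    by (simp add: numeral_3_eq_3 sin_coeff_def)
  also have "\<bar>u\<bar> ^ 3 / 6 \<le> \<bar>u\<bar> / 2"
  proof -
    have "\<bar>u\<bar>\<^sup>2 \<le> 1.6\<^sup>2" by (intro power_mono u) auto
    then have "\<bar>u\<bar> * \<bar>u\<bar>\<^sup>2 \<le> \<bar>u\<bar> * 3" by (intro mult_left_mono) (auto simp: power2_eq_square)
    then show ?thesis by (simp add: numeral_3_eq_3 power2_eq_square)
  qed
  finally have "\<bar>u\<bar> / 2 \<le> \<bar>sin u\<bar>" by linarith
  then have "(\<bar>u\<bar> / 2)\<^sup>2 \<le> \<bar>sin u\<bar>\<^sup>2" by (intro power_mono) auto
  then have "u\<^sup>2 / 4 \<le> (sin u)\<^sup>2" by (simp add: power_divide)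
  moreover have "cos t = 1 - 2 * (sin u)\<^sup>2"
    using cos_double_sin[of u] by (simp add: u_def)
  ultimately show ?thesis by (simp add: u_def power_divide)
qed

lemma sin_minus_self_le: "\<bar>sin u - u\<bar> \<le> \<bar>u\<bar> ^ 3" for u :: real
proof -
  have "\<bar>sin u - (\<Sum>m<3. sin_coeff m * u ^ m)\<bar> \<le> inverse (fact 3) * \<bar>u\<bar> ^ 3"
    by (rule Maclaurin_sin_bound)
  then have "\<bar>sin u - u\<bar> \<le> \<bar>u\<bar> ^ 3 / 6"
    by (simp add: numeral_3_eq_3 sin_coeff_def)
  also have "\<dots> \<le> \<bar>u\<bar> ^ 3" by simp
  finally show ?thesis .
qed

lemma one_minus_cos_le: "1 - cos u \<le> u\<^sup>2" for u :: real
proof -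
  have "cos u = 1 - 2 * (sin (u/2))\<^sup>2" using cos_double_sin[of "u/2"] by simp
  moreover have "(sin (u/2))\<^sup>2 \<le> (u/2)\<^sup>2"
    using abs_sin_x_le_abs_x[of "u/2"] by (simp only: abs_le_square_iff)
  moreover from this have "4 * (sin (u/2))\<^sup>2 \<le> u\<^sup>2" by (simp add: power_divide)
  moreover have "0 \<le> (sin (u/2))\<^sup>2" by simp
  ultimately show ?thesis by linarith
qed

lemma norm_cis_diff_le: "norm (cis a - cis b) \<le> \<bar>a - b\<bar>"
proof -
  have "cis a - cis b = cis b * (cis (a - b) - 1)" by (simp add: algebra_simps cis_mult)
  then have *: "norm (cis a - cis b) = norm (cis (a - b) - 1)" by (simp add: norm_mult)
  define u where "u = a - b"
  have "(norm (cis u - 1))\<^sup>2 = (cos u - 1)\<^sup>2 + (sin u)\<^sup>2"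
    by (simp add: cmod_power2)
  also have "\<dots> = 2 * (1 - cos u)"
    using sin_cos_squared_add[of u] by (simp add: power2_eq_square algebra_simps)
  also have "\<dots> = 4 * (sin (u/2))\<^sup>2" using cos_double_sin[of "u/2"] by simp
  also have "\<dots> \<le> 4 * (u/2)\<^sup>2"
    using abs_sin_x_le_abs_x[of "u/2"] by (simp only: abs_le_square_iff)
  also have "\<dots> = \<bar>u\<bar>\<^sup>2" by (simp add: power_divide)
  finally have "norm (cis u - 1) \<le> \<bar>u\<bar>" by (rule power2_le_imp_le) simp
  with * show ?thesis by (simp add: u_def)
qed

lemma sq_norm_nonneg [simp]: "0 \<le> sq_norm \<xi>"
  by (simp add: sq_norm_def sum_nonneg)

lemma dotp_le: "\<bar>dotp \<xi> x\<bar> \<le> sqrt (sq_norm \<xi>) * znorm x"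
proof -
  have "dotp \<xi> x = (\<chi> i. \<xi> i) \<bullet> real_vec x"
    by (simp add: dotp_def inner_vec_def real_vec_def)
  moreover have "norm (\<chi> i. \<xi> i) = sqrt (sq_norm \<xi>)"
    by (simp add: norm_vec_def L2_set_def sq_norm_def)
  ultimately show ?thesis
    using Cauchy_Schwarz_ineq2[of "\<chi> i. \<xi> i" "real_vec x"] by (simp add: znorm_def)
qed

lemma sq_norm_le_cube:
  assumes "\<And>i. \<bar>\<xi> i\<bar> \<le> b" shows "sq_norm (\<xi> :: 'd::finite \<Rightarrow> real) \<le> real CARD('d) * b\<^sup>2"
proof -
  have "(\<xi> i)\<^sup>2 \<le> b\<^sup>2" for i
    using power_mono[OF assms[of i], of 2] by simp
  then have "sq_norm \<xi> \<le> (\<Sum>i\<in>(UNIV::'d set). b\<^sup>2)" unfolding sq_norm_def by (intro sum_mono)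
  then show ?thesis by simp
qed

context lattice_step
begin

text \<open>
  The vectors \<open>x\<close> for which \<open>1 - cos(\<xi> \<cdot> x)\<close> is bounded by a multiple of \<open>1 - Re (chi \<theta> \<xi>)\<close>,
  uniformly in \<open>\<xi>\<close>, form a subgroup, because \<open>1 - cos(s + t) \<le> 2 (1 - cos s) + 2 (1 - cos t)\<close>. It
  contains the support of \<open>\<theta>\<close>, as one summand of the expectation is at most the whole. Hence it
  contains the unit vectors, for which \<open>1 - cos \<xi>\<^sub>i\<close> is comparable to \<open>\<xi>\<^sub>i\<^sup>2\<close> on the cube. This yields
  the bound near the origin and away from it at once, with no compactness argument.
\<close>

lemma spectral_gap:
  "\<exists>c>0. \<forall>\<xi>. (\<forall>i. \<bar>\<xi> i\<bar> \<le> pi) \<longrightarrow> c * sq_norm \<xi> \<le> 1 - Re (chi \<theta> \<xi>)"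
proof -
  define G where "G \<xi> = 1 - Re (chi \<theta> \<xi>)" for \<xi>
  have intc: "integrable (measure_pmf \<theta>) (\<lambda>x. 1 - cos (dotp \<xi> x))" for \<xi>
  proof (rule integrable_pmf_bounded[where B=2])
    fix x show "norm (1 - cos (dotp \<xi> x)) \<le> 2"
      using cos_le_one[of "dotp \<xi> x"] cos_ge_minus_one[of "dotp \<xi> x"] by (auto simp del: cos_le_one cos_ge_minus_one)
  qed
  have G0: "G \<xi> \<ge> 0" for \<xi>
    unfolding G_def one_minus_Re_chi by (intro Bochner_Integration.integral_nonneg) auto
  define H where "H = {x. \<exists>C\<ge>0. \<forall>\<xi>. 1 - cos (dotp \<xi> x) \<le> C * G \<xi>}"
  have "add_subgroup H"
    unfolding add_subgroup_def
  proof (intro conjI ballI)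
    show "0 \<in> H" by (auto simp: H_def intro!: exI[of _ 0])
  next
    fix a b assume "a \<in> H" "b \<in> H"
    then obtain A B where A: "A \<ge> 0" "\<And>\<xi>. 1 - cos (dotp \<xi> a) \<le> A * G \<xi>"
      and B: "B \<ge> 0" "\<And>\<xi>. 1 - cos (dotp \<xi> b) \<le> B * G \<xi>" by (auto simp: H_def)
    have "1 - cos (dotp \<xi> (a + b)) \<le> (2 * A + 2 * B) * G \<xi>" for \<xi>
    proof -
      let ?s = "dotp \<xi> a" and ?t = "dotp \<xi> b"
      have "(sin (?s/2 + ?t/2))\<^sup>2 \<le> 2 * (sin (?s/2))\<^sup>2 + 2 * (sin (?t/2))\<^sup>2"
      proof -
        let ?x = "sin (?s/2)" and ?y = "sin (?t/2)"
        have "\<bar>sin (?s/2 + ?t/2)\<bar> \<le> \<bar>?x\<bar> * \<bar>cos (?t/2)\<bar> + \<bar>cos (?s/2)\<bar> * \<bar>?y\<bar>"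
          unfolding sin_add by (rule order_trans[OF abs_triangle_ineq]) (simp add: abs_mult)
        also have "\<dots> \<le> \<bar>?x\<bar> * 1 + 1 * \<bar>?y\<bar>"
          by (intro add_mono mult_left_mono mult_right_mono) auto
        finally have "\<bar>sin (?s/2 + ?t/2)\<bar>\<^sup>2 \<le> (\<bar>?x\<bar> + \<bar>?y\<bar>)\<^sup>2"
          by (intro power_mono) auto
        also have "\<dots> \<le> 2 * \<bar>?x\<bar>\<^sup>2 + 2 * \<bar>?y\<bar>\<^sup>2"
          using sum_squares_bound[of "\<bar>?x\<bar>" "\<bar>?y\<bar>"] by (simp add: power2_sum)
        finally show ?thesis by simp
      qed
      moreover have "cos u = 1 - 2 * (sin (u/2))\<^sup>2" for u :: real
        using cos_double_sin[of "u/2"] by simp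
      ultimately have "1 - cos (dotp \<xi> (a + b)) \<le> 2 * (1 - cos ?s) + 2 * (1 - cos ?t)"
        by (simp add: dotp_add add_divide_distrib)
      with A(2)[of \<xi>] B(2)[of \<xi>] show ?thesis by (simp add: algebra_simps)
    qed
    with A(1) B(1) show "a + b \<in> H"
      by (auto simp: H_def intro!: exI[of _ "2 * A + 2 * B"])
  next
    fix a assume "a \<in> H" then show "- a \<in> H" by (auto simp: H_def dotp_uminus)
  qed
  moreover have "set_pmf \<theta> \<subseteq> H"
  proof
    fix x assume x: "x \<in> set_pmf \<theta>"
    then have px: "pmf \<theta> x > 0" by (simp add: pmf_positive)
    have "1 - cos (dotp \<xi> x) \<le> (1 / pmf \<theta> x) * G \<xi>" for \<xi>
    proof -
      have "pmf \<theta> x * (1 - cos (dotp \<xi> x))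
          = measure_pmf.expectation \<theta> (\<lambda>y. indicator {x} y * (1 - cos (dotp \<xi> y)))"
        by (subst integral_measure_pmf_real[of "{x}"]) (auto simp: mult.commute indicator_def split: if_splits)
      also have "\<dots> \<le> measure_pmf.expectation \<theta> (\<lambda>y. 1 - cos (dotp \<xi> y))"
        by (intro integral_mono intc)
           (auto split: split_indicator intro!: integrable_pmf_bounded[where B=2] order_trans[OF abs_triangle_ineq4] add_mono[of _ 1 _ 1, simplified])
      finally show ?thesis using px by (simp add: G_def one_minus_Re_chi field_simps)
    qed
    with px show "x \<in> H" by (auto simp: H_def intro!: exI[of _ "1 / pmf \<theta> x"])
  qed
  ultimately have HU: "H = UNIV" using step_supp by blast
  have "\<exists>C. \<forall>i. C i \<ge> 0 \<and> (\<forall>\<xi>. 1 - cos (dotp \<xi> (axis i 1 :: int^'d)) \<le> C i * G \<xi>)"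
    using HU by (intro choice) (auto simp: H_def)
  then obtain C where C: "\<And>i. C i \<ge> 0" "\<And>i \<xi>. 1 - cos (dotp \<xi> (axis i 1 :: int^'d)) \<le> C i * G \<xi>"
    by blast
  have dax: "dotp \<xi> (axis i 1 :: int^'d) = \<xi> i" for \<xi> i
    by (simp add: dotp_def axis_def if_distrib[of "\<lambda>x. _ * real_of_int x"] cong: if_cong)
  define S where "S = 1 + 8 * sum C UNIV"
  have S: "S > 0" using C(1) by (simp add: S_def add_pos_nonneg sum_nonneg)
  have "sq_norm \<xi> \<le> S * G \<xi>" if "\<forall>i. \<bar>\<xi> i\<bar> \<le> pi" for \<xi>
  proof -
    have "(\<xi> i)\<^sup>2 \<le> 8 * C i * G \<xi>" for i
      using one_minus_cos_ge[of "\<xi> i"] that C(2)[of \<xi> i] by (simp add: dax)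
    then have "sq_norm \<xi> \<le> (\<Sum>i\<in>UNIV. 8 * C i * G \<xi>)" unfolding sq_norm_def by (rule sum_mono)
    also have "\<dots> \<le> S * G \<xi>" using G0[of \<xi>]
      by (simp add: S_def sum_distrib_left sum_distrib_right algebra_simps)
    finally show ?thesis .
  qed
  then show ?thesis using S
    by (intro exI[of _ "1 / S"]) (auto simp: G_def field_simps)
qed

lemma chi_lazy: "chi q \<xi> = (chi \<theta> \<xi> + 1) / 2"
  unfolding chi_def by (subst expectation_lazy_complex[where B=1]) auto

text \<open>
  For \<open>|z| \<le> 1\<close> one has \<open>|(1 + z) / 2|\<^sup>2 \<le> (1 + Re z) / 2\<close>, so the gap of the real part controls the
  modulus of the lazy characteristic function.
\<close>

lemma norm_chi_lazy_le:
  "\<exists>c>0. \<forall>\<xi>. (\<forall>i. \<bar>\<xi> i\<bar> \<le> pi) \<longrightarrow> norm (chi q \<xi>) \<le> exp (- (c * sq_norm \<xi>))"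
proof -
  obtain c where c: "c > 0" "\<And>\<xi>. (\<forall>i. \<bar>\<xi> i\<bar> \<le> pi) \<Longrightarrow> c * sq_norm \<xi> \<le> 1 - Re (chi \<theta> \<xi>)"
    using spectral_gap by blast
  have "norm (chi q \<xi>) \<le> exp (- (c / 4 * sq_norm \<xi>))" if cube: "\<forall>i. \<bar>\<xi> i\<bar> \<le> pi" for \<xi>
  proof -
    let ?z = "chi \<theta> \<xi>"
    have "(norm ?z)\<^sup>2 \<le> 1" using norm_chi_le_1[of \<theta> \<xi>] by (simp add: power_le_one)
    then have n1: "(Re ?z)\<^sup>2 + (Im ?z)\<^sup>2 \<le> 1" by (simp add: cmod_power2)
    have "(norm (chi q \<xi>))\<^sup>2 = ((Re ?z + 1)\<^sup>2 + (Im ?z)\<^sup>2) / 4"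
      by (simp add: chi_lazy norm_divide power_divide cmod_power2)
    also have "\<dots> \<le> (2 + 2 * Re ?z) / 4"
      using n1 by (simp add: power2_sum)
    also have "\<dots> \<le> 1 - c / 2 * sq_norm \<xi>" using c(2)[OF cube] by simp
    also have "\<dots> \<le> exp (- (c / 2 * sq_norm \<xi>))"
      using exp_ge_add_one_self[of "- (c / 2 * sq_norm \<xi>)"] by simp
    also have "\<dots> = (exp (- (c / 4 * sq_norm \<xi>)))\<^sup>2"
      by (simp add: power2_eq_square exp_add[symmetric])
    finally show ?thesis by (rule power2_le_imp_le) simp
  qed
  with c(1) show ?thesis by (intro exI[of _ "c / 4"]) auto
qed

text \<open>
  Since \<open>sq_norm\<close> is bounded on the cube, the exponents \<open>n\<close> and \<open>n - 1\<close> may be replaced by \<open>n + 1\<close>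
  at the cost of a constant; the resulting Gaussian bounds hold for all \<open>n\<close>, including zero.
\<close>

lemma norm_chi_lazy_power_le:
  "\<exists>c>0. \<exists>B>0. \<forall>k\<in>{0,1}. \<forall>n. AE \<xi> in torus. norm (chi q \<xi>) ^ (n - k) \<le> B * exp (- (c * real (n + 1) * sq_norm \<xi>))"
proof -
  obtain c where c: "c > 0" "\<And>\<xi>. (\<forall>i. \<bar>\<xi> i\<bar> \<le> pi) \<Longrightarrow> norm (chi q \<xi>) \<le> exp (- (c * sq_norm \<xi>))"
    using norm_chi_lazy_le by blast
  define B where "B = exp (2 * c * (real CARD('d) * pi\<^sup>2))"
  have "norm (chi q \<xi>) ^ (n - k) \<le> B * exp (- (c * real (n + 1) * sq_norm \<xi>))"
    if "\<forall>i. \<bar>\<xi> i\<bar> \<le> pi" "k \<in> {0, 1}" for \<xi> n k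
  proof -
    have "norm (chi q \<xi>) ^ (n - k) \<le> exp (- (c * sq_norm \<xi>)) ^ (n - k)"
      by (intro power_mono c that) auto
    also have "\<dots> = exp (real (n - k) * (- (c * sq_norm \<xi>)))" by (simp only: exp_of_nat_mult)
    also have "\<dots> \<le> exp (2 * c * (real CARD('d) * pi\<^sup>2) - c * real (n + 1) * sq_norm \<xi>)"
    proof (subst exp_le_cancel_iff)
      have s: "sq_norm \<xi> \<le> real CARD('d) * pi\<^sup>2" using that sq_norm_le_cube by blast
      have "real (n + 1) - real (n - k) \<le> 2" using that by (cases n) auto
      then have "(real (n + 1) - real (n - k)) * (c * sq_norm \<xi>) \<le> 2 * (c * sq_norm \<xi>)"
        by (rule mult_right_mono) (use c in auto)
      also have "\<dots> \<le> 2 * (c * (real CARD('d) * pi\<^sup>2))"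
        using s c(1) by (intro mult_left_mono) auto
      finally show "real (n - k) * (- (c * sq_norm \<xi>)) \<le> 2 * c * (real CARD('d) * pi\<^sup>2) - c * real (n + 1) * sq_norm \<xi>"
        by (simp add: algebra_simps)
    qed
    also have "\<dots> = B * exp (- (c * real (n + 1) * sq_norm \<xi>))"
      by (simp add: B_def exp_add[symmetric])
    finally show ?thesis .
  qed
  note bound = this
  have "AE \<xi> in torus. norm (chi q \<xi>) ^ (n - k) \<le> B * exp (- (c * real (n + 1) * sq_norm \<xi>))" if "k \<in> {0, 1}" for n k
    using AE_torus by (rule eventually_mono) (use bound that c(2) in blast)
  moreover have "B > 0" by (simp add: B_def)
  ultimately show ?thesis
    using c(1) by blast
qed

end

text \<open>
  With \<open>u\<^sup>2 = a s\<close> these two lemmas say that \<open>u\<close> and \<open>u\<^sup>3\<close> are at most constant multiples of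
  \<open>exp (u\<^sup>2 / 2)\<close>. They convert each factor \<open>|\<xi>|\<close> in a Fourier integral into a factor \<open>n\<^sup>-\<^sup>1\<^sup>/\<^sup>2\<close>.
\<close>

lemma gauss_weight_1: "sqrt s * exp (- (a * s)) \<le> 1 / sqrt a * exp (- (a / 2 * s))"
  if "0 \<le> s" "0 < a" for a s :: real
proof -
  define u where "u = sqrt (a * s)"
  have u: "u \<ge> 0" "u\<^sup>2 = a * s" using that by (auto simp: u_def)
  have "2 * u \<le> 2 + u\<^sup>2" using zero_le_power2[of "u - 1"] by (simp add: power2_diff)
  then have "u \<le> 1 + u\<^sup>2 / 2" by simp
  also have "\<dots> \<le> exp (u\<^sup>2 / 2)" by (rule exp_ge_add_one_self)
  finally have *: "u \<le> exp (a * s / 2)" by (simp add: u)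
  have "sqrt s * exp (- (a * s)) = 1 / sqrt a * (u * exp (- (a * s)))"
    using that by (simp add: u_def real_sqrt_mult)
  also have "\<dots> \<le> 1 / sqrt a * (exp (a * s / 2) * exp (- (a * s)))"
    using * that by (intro mult_left_mono mult_right_mono) auto
  also have "\<dots> = 1 / sqrt a * exp (- (a / 2 * s))"
    by (simp add: exp_add[symmetric])
  finally show ?thesis .
qed

lemma gauss_weight_3: "sqrt s ^ 3 * exp (- (a * s)) \<le> (2 / sqrt a) ^ 3 * exp (- (a / 2 * s))"
  if "0 \<le> s" "0 < a" for a s :: real
proof -
  define u where "u = sqrt (a * s)"
  have u: "u \<ge> 0" "u\<^sup>2 = a * s" using that by (auto simp: u_def)
  have "3 * u \<le> 6 + u\<^sup>2" using zero_le_power2[of "u - 3/2"] by (simp add: power2_diff) (simp add: power2_eq_square)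
  then have "u \<le> 2 * (1 + u\<^sup>2 / 6)" by simp
  also have "\<dots> \<le> 2 * exp (u\<^sup>2 / 6)" by (intro mult_left_mono exp_ge_add_one_self) simp
  finally have "u ^ 3 \<le> (2 * exp (a * s / 6)) ^ 3" using u by (intro power_mono) auto
  also have "\<dots> = 2 ^ 3 * exp (a * s / 2)"
    by (simp add: power_mult_distrib exp_of_nat_mult[symmetric])
  finally have *: "u ^ 3 \<le> 2 ^ 3 * exp (a * s / 2)" .
  have "sqrt s ^ 3 * exp (- (a * s)) = (1 / sqrt a) ^ 3 * (u ^ 3 * exp (- (a * s)))"
    using that by (simp add: u_def real_sqrt_mult power_mult_distrib power_divide)
  also have "\<dots> \<le> (1 / sqrt a) ^ 3 * (2 ^ 3 * exp (a * s / 2) * exp (- (a * s)))"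
    using * that by (intro mult_left_mono mult_right_mono) auto
  also have "\<dots> = (2 / sqrt a) ^ 3 * exp (- (a / 2 * s))"
    by (simp add: exp_add[symmetric] power_divide)
  finally show ?thesis .
qed

lemma norm_power_diff_le:
  fixes z w :: complex
  assumes "norm z \<le> r" "norm w \<le> r"
  shows "norm (z ^ n - w ^ n) \<le> real n * r ^ (n - 1) * norm (z - w)"
proof (induction n)
  case (Suc n)
  have r: "0 \<le> r" using assms(1) norm_ge_zero order_trans by blast
  have "z ^ Suc n - w ^ Suc n = z * (z ^ n - w ^ n) + (z - w) * w ^ n"
    by (simp add: algebra_simps)
  then have "norm (z ^ Suc n - w ^ Suc n) \<le> norm z * norm (z ^ n - w ^ n) + norm (z - w) * norm w ^ n"
    by (metis norm_mult norm_power norm_triangle_ineq)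
  also have "\<dots> \<le> r * (real n * r ^ (n - 1) * norm (z - w)) + norm (z - w) * r ^ n"
    by (intro add_mono mult_mono Suc assms power_mono) (use r in auto)
  also have "\<dots> = real (Suc n) * r ^ (Suc n - 1) * norm (z - w)"
    by (cases n) (auto simp: algebra_simps)
  finally show ?case .
qed simp

lemma integral_norm_le_AE:
  fixes f :: "'a \<Rightarrow> 'b::{banach, second_countable_topology}"
  assumes "integrable M f" "integrable M g" "AE x in M. norm (f x) \<le> g x"
  shows "norm (integral\<^sup>L M f) \<le> integral\<^sup>L M g"
  by (rule order_trans[OF integral_norm_bound integral_mono_AE]) (use assms in auto)

context lattice_step
begin

text \<open>
  A dyadic layer-cake bound: \<open>|x|\<^sup>3\<close> is at most one plus the sum of \<open>8\<^sup>j\<^sup>+\<^sup>1\<close> over those \<open>j\<close> with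
  \<open>|x| > 2\<^sup>j\<close>, and the tail hypothesis with \<open>d \<ge> 5\<close> makes the expected sum geometric.
\<close>

lemma third_moment: "integrable (measure_pmf \<theta>) (\<lambda>x. znorm x ^ 3)"
proof (rule integrableI_bounded)
  obtain C where C: "C > 0" and tail: "\<And>r. r \<ge> 1 \<Longrightarrow>
    measure_pmf.prob \<theta> {z. znorm z > r} < C * r powr - real CARD('d)"
    using step_tail by blast
  define f where "f j x = ennreal (8 ^ Suc j) * indicator {z. znorm z > 2 ^ j} x" for j and x :: "int^'d"
  have point: "ennreal (znorm x ^ 3) \<le> 1 + (\<Sum>j. f j x)" for x :: "int^'d"
  proof (cases "znorm x \<le> 1")
    case True
    then have "znorm x ^ 3 \<le> 1" by (simp add: power_le_one)
    then have "ennreal (znorm x ^ 3) \<le> 1" using ennreal_leI[of _ 1] by simp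
    then show ?thesis by (rule order_trans) simp
  next
    case False
    have ex: "\<exists>j. znorm x \<le> 2 ^ j" using real_arch_pow[of 2 "znorm x"] by (auto intro: less_imp_le)
    define j where "j = (LEAST j. znorm x \<le> 2 ^ j)"
    have j: "znorm x \<le> 2 ^ j" unfolding j_def by (rule LeastI_ex[OF ex])
    with False have "j \<noteq> 0" by (intro notI) simp
    then obtain i where i: "j = Suc i" by (cases j) auto
    have "\<not> znorm x \<le> 2 ^ i" using not_less_Least[of i "\<lambda>j. znorm x \<le> 2 ^ j"] i by (auto simp: j_def)
    then have "f i x = ennreal (8 ^ Suc i)" by (simp add: f_def)
    moreover have "znorm x ^ 3 \<le> (2 ^ Suc i) ^ 3" using j i by (intro power_mono) auto
    moreover have "((2::real) ^ Suc i) ^ 3 = 8 ^ Suc i"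
      by (simp only: power_mult[symmetric] mult.commute[of "Suc i"]) (simp only: power_mult, simp)
    ultimately have "ennreal (znorm x ^ 3) \<le> f i x" by (simp only: ennreal_leI)
    also have "\<dots> \<le> (\<Sum>j. f j x)" using sum_le_suminf[OF summableI, of "{i}" "\<lambda>j. f j x"] by simp
    also have "\<dots> \<le> 1 + (\<Sum>j. f j x)" by simp
    finally show ?thesis .
  qed
  have "(\<integral>\<^sup>+ x. ennreal (norm (znorm x ^ 3)) \<partial>measure_pmf \<theta>) \<le> (\<integral>\<^sup>+ x. 1 + (\<Sum>j. f j x) \<partial>measure_pmf \<theta>)"
    by (intro nn_integral_mono) (use point in simp)
  also have "\<dots> = 1 + (\<Sum>j. \<integral>\<^sup>+ x. f j x \<partial>measure_pmf \<theta>)"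
    by (subst nn_integral_add) (auto simp: nn_integral_suminf)
  also have "(\<Sum>j. \<integral>\<^sup>+ x. f j x \<partial>measure_pmf \<theta>) \<le> (\<Sum>j. ennreal (8 * C * (1 / 4) ^ j))"
  proof (intro suminf_le summableI)
    fix j
    have "(\<integral>\<^sup>+ x. f j x \<partial>measure_pmf \<theta>) = ennreal (8 ^ Suc j) * emeasure (measure_pmf \<theta>) {z. znorm z > 2 ^ j}"
      unfolding f_def by (subst nn_integral_cmult_indicator) auto
    also have "\<dots> = ennreal (8 ^ Suc j * measure_pmf.prob \<theta> {z. znorm z > 2 ^ j})"
      by (simp add: measure_pmf.emeasure_eq_measure ennreal_mult)
    also have "\<dots> \<le> ennreal (8 ^ Suc j * (C * (1 / 32) ^ j))"
    proof (intro ennreal_leI mult_left_mono)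
      have "measure_pmf.prob \<theta> {z. znorm z > 2 ^ j} \<le> C * (2 ^ j) powr - real CARD('d)"
        using tail[of "2 ^ j"] by simp
      also have "((2::real) ^ j) powr - real CARD('d) \<le> (2 ^ j) powr - real 5"
        using dim by (intro powr_mono) auto
      also have "((2::real) ^ j) powr - real 5 = inverse ((2 ^ j) ^ 5)"
        by (subst powr_minus, subst powr_realpow) auto
      also have "\<dots> = (1 / 32) ^ j"
        by (simp only: power_mult[symmetric] mult.commute[of j]) (simp only: power_mult, simp add: power_one_over inverse_eq_divide)
      finally show "measure_pmf.prob \<theta> {z. znorm z > 2 ^ j} \<le> C * (1 / 32) ^ j" using C by simp
    qed simp
    also have "8 ^ Suc j * (C * (1 / 32) ^ j) = 8 * C * (1 / 4) ^ j"
      by (simp add: power_divide) (simp add: field_simps power_mult_distrib[symmetric])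
    finally show "(\<integral>\<^sup>+ x. f j x \<partial>measure_pmf \<theta>) \<le> ennreal (8 * C * (1 / 4) ^ j)" .
  qed
  also have "(\<Sum>j. ennreal (8 * C * (1 / 4) ^ j)) = ennreal (\<Sum>j. 8 * C * (1 / 4) ^ j)"
    by (rule suminf_ennreal2) (use C in \<open>auto intro!: summable_mult summable_geometric\<close>)
  finally show "(\<integral>\<^sup>+ x. ennreal (norm (znorm x ^ 3)) \<partial>measure_pmf \<theta>) < \<infinity>"
    by (rule le_less_trans) (auto simp: add_left_mono)
qed simp

lemma second_moment: "integrable (measure_pmf \<theta>) (\<lambda>x. (znorm x)\<^sup>2)"
proof (rule Bochner_Integration.integrable_bound)
  show "integrable (measure_pmf \<theta>) (\<lambda>x. 1 + znorm x ^ 3)" using third_moment by simp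
  have "(znorm x)\<^sup>2 \<le> 1 + znorm x ^ 3" for x :: "int^'d"
  proof (cases "znorm x \<le> 1")
    case True
    then have "(znorm x)\<^sup>2 \<le> 1" by (simp add: power_le_one)
    moreover have "0 \<le> znorm x ^ 3" by simp
    ultimately show ?thesis by linarith
  next
    case False
    then have "(znorm x)\<^sup>2 \<le> znorm x ^ 3" by (intro power_increasing) auto
    then show ?thesis by simp
  qed
  then show "AE x in measure_pmf \<theta>. norm ((znorm x)\<^sup>2) \<le> norm (1 + znorm x ^ 3)"
    by (intro AE_I2) (simp add: order_trans[OF _ abs_ge_self])
qed simp

lemma expectation_dotp:
  "integrable (measure_pmf \<theta>) (dotp \<xi>)" "measure_pmf.expectation \<theta> (dotp \<xi>) = 0"
proof -
  have *: "dotp \<xi> = (\<lambda>x. (\<chi> i. \<xi> i) \<bullet> real_vec x)"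
    by (auto simp: dotp_def inner_vec_def real_vec_def)
  show "integrable (measure_pmf \<theta>) (dotp \<xi>)" unfolding * using step_mean(1) by simp
  show "measure_pmf.expectation \<theta> (dotp \<xi>) = 0" unfolding * using step_mean
    by simp
qed

text \<open>
  As the mean is zero, the imaginary part is the expectation of \<open>sin u - u\<close> with \<open>u = \<xi> \<cdot> x\<close>, so it
  is of third order and the third moment bounds it.
\<close>

lemma chi_lazy_near_0:
  "\<exists>C>0. \<forall>\<xi>. 1 - Re (chi q \<xi>) \<le> C * sq_norm \<xi> \<and> \<bar>Im (chi q \<xi>)\<bar> \<le> C * sqrt (sq_norm \<xi>) ^ 3"
proof -
  define C where "C = 1 + measure_pmf.expectation \<theta> (\<lambda>x. (znorm x)\<^sup>2) + measure_pmf.expectation \<theta> (\<lambda>x. znorm x ^ 3)"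
  have nn: "measure_pmf.expectation \<theta> (\<lambda>x. (znorm x)\<^sup>2) \<ge> 0" "measure_pmf.expectation \<theta> (\<lambda>x. znorm x ^ 3) \<ge> 0"
    by (auto intro!: Bochner_Integration.integral_nonneg)
  then have C: "C > 0" unfolding C_def by linarith
  have "1 - Re (chi q \<xi>) \<le> C * sq_norm \<xi>" for \<xi>
  proof -
    have bd: "norm (1 - cos (dotp \<xi> x)) \<le> 2" for x
      using cos_le_one[of "dotp \<xi> x"] cos_ge_minus_one[of "dotp \<xi> x"] by (auto simp del: cos_le_one cos_ge_minus_one)
    have "1 - Re (chi \<theta> \<xi>) \<le> measure_pmf.expectation \<theta> (\<lambda>x. sq_norm \<xi> * (znorm x)\<^sup>2)"
      unfolding one_minus_Re_chi
    proof (rule integral_mono)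
      show "integrable (measure_pmf \<theta>) (\<lambda>x. 1 - cos (dotp \<xi> x))" by (rule integrable_pmf_bounded[OF bd])
      show "integrable (measure_pmf \<theta>) (\<lambda>x. sq_norm \<xi> * (znorm x)\<^sup>2)" using second_moment by simp
      fix x
      have "1 - cos (dotp \<xi> x) \<le> \<bar>dotp \<xi> x\<bar>\<^sup>2" using one_minus_cos_le by simp
      also have "\<dots> \<le> (sqrt (sq_norm \<xi>) * znorm x)\<^sup>2" by (intro power_mono dotp_le) auto
      finally show "1 - cos (dotp \<xi> x) \<le> sq_norm \<xi> * (znorm x)\<^sup>2" by (simp add: power_mult_distrib)
    qed
    also have "\<dots> \<le> sq_norm \<xi> * C" using nn by (simp add: C_def mult_left_mono)
    finally have *: "1 - Re (chi \<theta> \<xi>) \<le> sq_norm \<xi> * C" .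
    have "1 - Re (chi q \<xi>) = (1 - Re (chi \<theta> \<xi>)) / 2" by (simp add: chi_lazy field_simps)
    moreover have "0 \<le> sq_norm \<xi> * C" using C by simp
    ultimately show ?thesis using * by (simp add: mult.commute)
  qed
  moreover have "\<bar>Im (chi q \<xi>)\<bar> \<le> C * sqrt (sq_norm \<xi>) ^ 3" for \<xi>
  proof -
    have I: "integrable (measure_pmf \<theta>) (\<lambda>x. sin (dotp \<xi> x))"
      by (rule integrable_pmf_bounded[where B=1]) simp
    have "Im (chi \<theta> \<xi>) = measure_pmf.expectation \<theta> (\<lambda>x. sin (dotp \<xi> x) - dotp \<xi> x)"
      using I expectation_dotp[of \<xi>] by (simp add: Im_chi)
    also have "\<bar>\<dots>\<bar> \<le> measure_pmf.expectation \<theta> (\<lambda>x. sqrt (sq_norm \<xi>) ^ 3 * znorm x ^ 3)"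
    proof (subst real_norm_def[symmetric], rule integral_norm_le_AE)
      show "integrable (measure_pmf \<theta>) (\<lambda>x. sin (dotp \<xi> x) - dotp \<xi> x)"
        using I expectation_dotp[of \<xi>] by simp
      show "integrable (measure_pmf \<theta>) (\<lambda>x. sqrt (sq_norm \<xi>) ^ 3 * znorm x ^ 3)" using third_moment by simp
      have "\<bar>sin (dotp \<xi> x) - dotp \<xi> x\<bar> \<le> sqrt (sq_norm \<xi>) ^ 3 * znorm x ^ 3" for x
      proof -
        have "\<bar>sin (dotp \<xi> x) - dotp \<xi> x\<bar> \<le> \<bar>dotp \<xi> x\<bar> ^ 3" by (rule sin_minus_self_le)
        also have "\<dots> \<le> (sqrt (sq_norm \<xi>) * znorm x) ^ 3" by (intro power_mono dotp_le) auto
        finally show ?thesis by (simp add: power_mult_distrib)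
      qed
      then show "AE x in measure_pmf \<theta>. norm (sin (dotp \<xi> x) - dotp \<xi> x) \<le> sqrt (sq_norm \<xi>) ^ 3 * znorm x ^ 3"
        by simp
    qed
    also have "\<dots> \<le> sqrt (sq_norm \<xi>) ^ 3 * C" using nn by (simp add: C_def mult_left_mono)
    finally have *: "\<bar>Im (chi \<theta> \<xi>)\<bar> \<le> sqrt (sq_norm \<xi>) ^ 3 * C" .
    have "\<bar>Im (chi q \<xi>)\<bar> = \<bar>Im (chi \<theta> \<xi>)\<bar> / 2" by (simp add: chi_lazy)
    moreover have "0 \<le> sqrt (sq_norm \<xi>) ^ 3 * C" using C by simp
    ultimately show ?thesis using * by (simp add: mult.commute)
  qed
  ultimately show ?thesis using C by blast
qed

lemma Re_chi_lazy_nonneg: "0 \<le> Re (chi q \<xi>)"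
  using norm_chi_le_1[of \<theta> \<xi>] abs_Re_le_cmod[of "chi \<theta> \<xi>"] by (simp add: chi_lazy)

lemma hk_Fourier: "complex_of_real (hk n z) = integral\<^sup>L torus (\<lambda>\<xi>::'d \<Rightarrow> real. chi q \<xi> ^ n * cis (- dotp \<xi> z))"
  unfolding Fourier_inversion chi_walk ..

lemma integrable_hk_Fourier: "integrable torus (\<lambda>\<xi>::'d \<Rightarrow> real. chi q \<xi> ^ n * cis (- dotp \<xi> z))"
  by (rule integrable_torus_bounded[where B=1])
     (auto simp: norm_mult norm_power norm_chi_le_1 power_le_one)

lemma gauss_scaled:
  assumes "0 < c"
  shows "integral\<^sup>L torus (\<lambda>\<xi>::'d \<Rightarrow> real. exp (- (c * real (n + 1) * sq_norm \<xi>)))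
     \<le> (1 / sqrt c) ^ CARD('d) / sqrt (real (n + 1)) ^ CARD('d)"
proof -
  have "integral\<^sup>L torus (\<lambda>\<xi>::'d \<Rightarrow> real. exp (- (c * real (n + 1) * sq_norm \<xi>)))
     \<le> (1 / sqrt (c * real (n + 1))) ^ CARD('d)"
    by (rule integral_gauss_torus) (use assms in simp)
  also have "\<dots> = (1 / sqrt c) ^ CARD('d) / sqrt (real (n + 1)) ^ CARD('d)"
    by (simp add: real_sqrt_mult power_divide power_mult_distrib)
  finally show ?thesis .
qed

text \<open>
  Take absolute values in the inversion formula.
\<close>

lemma hk_upper: "\<exists>C>0. \<forall>n z. hk n z \<le> C / sqrt (real (n + 1)) ^ CARD('d)"
proof -
  obtain c B where c: "c > 0" "B > 0" and AE: "\<And>n. AE \<xi> in torus.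
      norm (chi q \<xi>) ^ (n - 0) \<le> B * exp (- (c * real (n + 1) * sq_norm \<xi>))"
    using norm_chi_lazy_power_le by blast
  have "hk n z \<le> B * (1 / sqrt c) ^ CARD('d) / sqrt (real (n + 1)) ^ CARD('d)" for n z
  proof -
    have "hk n z = norm (complex_of_real (hk n z))" by simp
    also have "\<dots> \<le> integral\<^sup>L torus (\<lambda>\<xi>::'d \<Rightarrow> real. B * exp (- (c * real (n + 1) * sq_norm \<xi>)))"
      unfolding hk_Fourier
    proof (rule integral_norm_le_AE[OF integrable_hk_Fourier])
      show "integrable torus (\<lambda>\<xi>::'d \<Rightarrow> real. B * exp (- (c * real (n + 1) * sq_norm \<xi>)))"
        using c by (intro Bochner_Integration.integrable_mult_right integrable_gauss_torus) auto
      show "AE \<xi> in torus. norm (chi q \<xi> ^ n * cis (- dotp \<xi> z)) \<le> B * exp (- (c * real (n + 1) * sq_norm \<xi>))"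
        using AE[of n] by eventually_elim (simp add: norm_mult norm_power)
    qed
    also have "\<dots> \<le> B * ((1 / sqrt c) ^ CARD('d) / sqrt (real (n + 1)) ^ CARD('d))"
      using gauss_scaled[OF c(1), of n] c(2) by (simp only: integral_mult_right_zero mult_left_mono)
    finally show ?thesis by simp
  qed
  moreover have "B * (1 / sqrt c) ^ CARD('d) > 0" using c by simp
  ultimately show ?thesis by blast
qed

text \<open>
  The increment of the character contributes \<open>|\<xi>| |e|\<close>, hence one factor \<open>n\<^sup>-\<^sup>1\<^sup>/\<^sup>2\<close> more than in
  \<open>hk_upper\<close>.
\<close>

lemma hk_gradient:
  "\<exists>C>0. \<forall>n z e. \<bar>hk n (z + e) - hk n z\<bar> \<le> C * znorm e / sqrt (real (n + 1)) ^ (CARD('d) + 1)"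
proof -
  obtain c B where c: "c > 0" "B > 0" and AE: "\<And>n. AE \<xi> in torus.
      norm (chi q \<xi>) ^ (n - 0) \<le> B * exp (- (c * real (n + 1) * sq_norm \<xi>))"
    using norm_chi_lazy_power_le by blast
  have c2: "c / 2 > 0" using c by simp
  define C where "C = B / sqrt c * (1 / sqrt (c / 2)) ^ CARD('d)"
  have "\<bar>hk n (z + e) - hk n z\<bar> \<le> C * znorm e / sqrt (real (n + 1)) ^ (CARD('d) + 1)" for n z e
  proof -
    let ?s = "sqrt (real (n + 1))"
    have "\<bar>hk n (z + e) - hk n z\<bar> = norm (complex_of_real (hk n (z + e)) - complex_of_real (hk n z))"
      by (metis norm_of_real of_real_diff)
    also have "complex_of_real (hk n (z + e)) - complex_of_real (hk n z) =
        integral\<^sup>L torus (\<lambda>\<xi>::'d \<Rightarrow> real. chi q \<xi> ^ n * cis (- dotp \<xi> (z + e)) - chi q \<xi> ^ n * cis (- dotp \<xi> z))"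
      unfolding hk_Fourier by (rule Bochner_Integration.integral_diff[symmetric]) (rule integrable_hk_Fourier)+
    also have "norm \<dots> \<le> integral\<^sup>L torus (\<lambda>\<xi>::'d \<Rightarrow> real. B * znorm e / (sqrt c * ?s) * exp (- (c / 2 * real (n + 1) * sq_norm \<xi>)))"
    proof (rule integral_norm_le_AE[OF Bochner_Integration.integrable_diff[OF integrable_hk_Fourier integrable_hk_Fourier]])
      show "integrable torus (\<lambda>\<xi>::'d \<Rightarrow> real. B * znorm e / (sqrt c * ?s) * exp (- (c / 2 * real (n + 1) * sq_norm \<xi>)))"
        using c by (intro Bochner_Integration.integrable_mult_right integrable_gauss_torus) auto
      show "AE \<xi> in torus. norm (chi q \<xi> ^ n * cis (- dotp \<xi> (z + e)) - chi q \<xi> ^ n * cis (- dotp \<xi> z))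
          \<le> B * znorm e / (sqrt c * ?s) * exp (- (c / 2 * real (n + 1) * sq_norm \<xi>))"
        using AE[of n]
      proof eventually_elim
        fix \<xi> assume *: "norm (chi q \<xi>) ^ (n - 0) \<le> B * exp (- (c * real (n + 1) * sq_norm \<xi>))"
        have "norm (chi q \<xi> ^ n * cis (- dotp \<xi> (z + e)) - chi q \<xi> ^ n * cis (- dotp \<xi> z))
          = norm (chi q \<xi>) ^ n * norm (cis (- dotp \<xi> (z + e)) - cis (- dotp \<xi> z))"
          by (simp add: right_diff_distrib[symmetric] norm_mult norm_power)
        also have "\<dots> \<le> (B * exp (- (c * real (n + 1) * sq_norm \<xi>))) * (sqrt (sq_norm \<xi>) * znorm e)"
        proof (intro mult_mono)
          have "norm (cis (- dotp \<xi> (z + e)) - cis (- dotp \<xi> z)) \<le> \<bar>dotp \<xi> e\<bar>"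
            using norm_cis_diff_le[of "- dotp \<xi> (z + e)" "- dotp \<xi> z"] by (simp add: dotp_add)
          with dotp_le[of \<xi> e] show "norm (cis (- dotp \<xi> (z + e)) - cis (- dotp \<xi> z)) \<le> sqrt (sq_norm \<xi>) * znorm e"
            by linarith
        qed (use * c in auto)
        also have "\<dots> = B * znorm e * (sqrt (sq_norm \<xi>) * exp (- (c * real (n + 1) * sq_norm \<xi>)))"
          by (simp add: algebra_simps)
        also have "\<dots> \<le> B * znorm e * (1 / sqrt (c * real (n + 1)) * exp (- (c * real (n + 1) / 2 * sq_norm \<xi>)))"
          using c by (intro mult_left_mono gauss_weight_1) auto
        also have "\<dots> = B * znorm e / (sqrt c * ?s) * exp (- (c / 2 * real (n + 1) * sq_norm \<xi>))"
          by (simp add: real_sqrt_mult)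
        finally show "norm (chi q \<xi> ^ n * cis (- dotp \<xi> (z + e)) - chi q \<xi> ^ n * cis (- dotp \<xi> z))
          \<le> B * znorm e / (sqrt c * ?s) * exp (- (c / 2 * real (n + 1) * sq_norm \<xi>))" .
      qed
    qed
    also have "\<dots> \<le> B * znorm e / (sqrt c * ?s) * ((1 / sqrt (c/2)) ^ CARD('d) / ?s ^ CARD('d))"
      unfolding integral_mult_right_zero using c
      by (intro mult_left_mono gauss_scaled[OF c2]) auto
    also have "\<dots> = C * znorm e / ?s ^ (CARD('d) + 1)" by (simp add: C_def mult_ac)
    finally show ?thesis .
  qed
  moreover have "C > 0" using c by (simp add: C_def)
  ultimately show ?thesis by blast
qed

text \<open>
  Compare \<open>chi q\<close> with its real part. The real part is nonnegative by laziness and at least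
  \<open>1 - 1 / (2 (n + 1))\<close> on a cube of side of order \<open>(n + 1)\<^sup>-\<^sup>1\<^sup>/\<^sup>2\<close>, which gives the main term of order
  \<open>n\<^sup>-\<^sup>d\<^sup>/\<^sup>2\<close>. The imaginary part is cubic in \<open>\<xi>\<close>, so the error is \<open>n \<cdot> n\<^sup>-\<^sup>3\<^sup>/\<^sup>2 = n\<^sup>-\<^sup>1\<^sup>/\<^sup>2\<close> times smaller.
\<close>

lemma hk_lower_origin:
  "\<exists>c>0. \<exists>C>0. \<forall>n. c / sqrt (real (n + 1)) ^ CARD('d) - C / sqrt (real (n + 1)) ^ (CARD('d) + 1) \<le> hk n 0"
proof -
  obtain c B where c: "c > 0" "B > 0" and AE0: "\<And>k n. k \<in> {0,1} \<Longrightarrow> AE \<xi> in torus.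
      norm (chi q \<xi>) ^ (n - k) \<le> B * exp (- (c * real (n + 1) * sq_norm \<xi>))"
    using norm_chi_lazy_power_le by blast
  have AE: "\<And>n. AE \<xi> in torus. norm (chi q \<xi>) ^ (n - 1) \<le> B * exp (- (c * real (n + 1) * sq_norm \<xi>))"
    using AE0[of 1] by simp
  have c2: "c / 2 > 0" using c by simp
  obtain M where M: "M > 0" "\<And>\<xi>. 1 - Re (chi q \<xi>) \<le> M * sq_norm \<xi>" "\<And>\<xi>. \<bar>Im (chi q \<xi>)\<bar> \<le> M * sqrt (sq_norm \<xi>) ^ 3"
    using chi_lazy_near_0 by blast
  let ?d = "real CARD('d)"
  define \<kappa> where "\<kappa> = min 1 (1 / (2 * M * ?d))"
  have \<kappa>: "\<kappa> > 0" "\<kappa> \<le> 1" "M * ?d * \<kappa>\<^sup>2 \<le> 1 / 2"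
  proof -
    show k: "\<kappa> > 0" "\<kappa> \<le> 1" using M(1) by (auto simp: \<kappa>_def)
    have "\<kappa>\<^sup>2 \<le> \<kappa>" using k by (simp add: power2_eq_square mult_left_le)
    also have "\<kappa> \<le> 1 / (2 * M * ?d)" by (simp add: \<kappa>_def)
    finally show "M * ?d * \<kappa>\<^sup>2 \<le> 1 / 2" using M(1) by (simp add: field_simps)
  qed
  define C where "C = M * B * (2 / sqrt c) ^ 3 * (1 / sqrt (c / 2)) ^ CARD('d)"
  have "1 / 2 * (\<kappa> / pi) ^ CARD('d) / sqrt (real (n + 1)) ^ CARD('d) - C / sqrt (real (n + 1)) ^ (CARD('d) + 1) \<le> hk n 0" for n
  proof -
    let ?s = "sqrt (real (n + 1))"
    let ?b = "\<kappa> / ?s"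
    have s1: "?s \<ge> 1" by simp
    have "\<kappa> \<le> ?s" using \<kappa>(2) s1 by linarith
    then have b: "?b > 0" "?b \<le> 1" using \<kappa> by (auto simp: divide_le_eq)
    have Ir: "integrable torus (\<lambda>\<xi>::'d \<Rightarrow> real. complex_of_real (Re (chi q \<xi>) ^ n))"
    proof (rule integrable_torus_bounded[where B=1])
      fix \<xi>
      have "\<bar>Re (chi q \<xi>)\<bar> \<le> 1" using abs_Re_le_cmod[of "chi q \<xi>"] norm_chi_le_1[of q \<xi>] by linarith
      then show "norm (complex_of_real (Re (chi q \<xi>) ^ n)) \<le> 1"
        by (simp add: norm_power power_le_one)
    qed measurable
    have Ic: "integrable torus (\<lambda>\<xi>::'d \<Rightarrow> real. chi q \<xi> ^ n)" using integrable_hk_Fourier[of n 0] by simp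
    let ?R = "integral\<^sup>L torus (\<lambda>\<xi>::'d \<Rightarrow> real. Re (chi q \<xi>) ^ n)"
    have "norm (complex_of_real (hk n 0) - complex_of_real ?R)
        = norm (integral\<^sup>L torus (\<lambda>\<xi>::'d \<Rightarrow> real. chi q \<xi> ^ n - complex_of_real (Re (chi q \<xi>) ^ n)))"
      using hk_Fourier[of n 0] Ir Ic by (simp add: Bochner_Integration.integral_diff del: of_real_power)
    also have "\<dots> \<le> integral\<^sup>L torus (\<lambda>\<xi>::'d \<Rightarrow> real. real (n + 1) * M * B * (2 / sqrt (c * real (n + 1))) ^ 3 * exp (- (c / 2 * real (n + 1) * sq_norm \<xi>)))"
    proof (rule integral_norm_le_AE[OF Bochner_Integration.integrable_diff[OF Ic Ir]])
      show "integrable torus (\<lambda>\<xi>::'d \<Rightarrow> real. real (n + 1) * M * B * (2 / sqrt (c * real (n + 1))) ^ 3 * exp (- (c / 2 * real (n + 1) * sq_norm \<xi>)))"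
        using c by (intro Bochner_Integration.integrable_mult_right integrable_gauss_torus) auto
      show "AE \<xi> in torus. norm (chi q \<xi> ^ n - complex_of_real (Re (chi q \<xi>) ^ n))
          \<le> real (n + 1) * M * B * (2 / sqrt (c * real (n + 1))) ^ 3 * exp (- (c / 2 * real (n + 1) * sq_norm \<xi>))"
        using AE[of n]
      proof eventually_elim
        fix \<xi> assume *: "norm (chi q \<xi>) ^ (n - 1) \<le> B * exp (- (c * real (n + 1) * sq_norm \<xi>))"
        have "norm (chi q \<xi> ^ n - complex_of_real (Re (chi q \<xi>)) ^ n)
          \<le> real n * norm (chi q \<xi>) ^ (n - 1) * norm (chi q \<xi> - complex_of_real (Re (chi q \<xi>)))"
          by (rule norm_power_diff_le) (auto simp: abs_Re_le_cmod)
        also have "norm (chi q \<xi> - complex_of_real (Re (chi q \<xi>))) = \<bar>Im (chi q \<xi>)\<bar>"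
          by (simp add: cmod_def)
        also have "real n * norm (chi q \<xi>) ^ (n - 1) * \<bar>Im (chi q \<xi>)\<bar>
           \<le> real (n + 1) * (B * exp (- (c * real (n + 1) * sq_norm \<xi>))) * (M * sqrt (sq_norm \<xi>) ^ 3)"
          using * c by (intro mult_mono M) auto
        also have "\<dots> = real (n + 1) * M * B * (sqrt (sq_norm \<xi>) ^ 3 * exp (- (c * real (n + 1) * sq_norm \<xi>)))"
          by (simp only: ac_simps)
        also have "\<dots> \<le> real (n + 1) * M * B * ((2 / sqrt (c * real (n + 1))) ^ 3 * exp (- (c * real (n + 1) / 2 * sq_norm \<xi>)))"
          using c M by (intro mult_left_mono gauss_weight_3) auto
        finally show "norm (chi q \<xi> ^ n - complex_of_real (Re (chi q \<xi>) ^ n))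
          \<le> real (n + 1) * M * B * (2 / sqrt (c * real (n + 1))) ^ 3 * exp (- (c / 2 * real (n + 1) * sq_norm \<xi>))"
          by (simp add: mult.assoc)
      qed
    qed
    also have "\<dots> \<le> real (n + 1) * M * B * (2 / sqrt (c * real (n + 1))) ^ 3 * ((1 / sqrt (c/2)) ^ CARD('d) / ?s ^ CARD('d))"
      unfolding integral_mult_right_zero using c M
      by (intro mult_left_mono gauss_scaled[OF c2]) auto
    also have "\<dots> = C / ?s ^ (CARD('d) + 1)"
    proof -
      have "real (n + 1) / ?s ^ 3 = 1 / ?s"
      proof -
        have "y * y / y ^ 3 = 1 / y" if "y > 0" for y :: real
          using that by (simp add: power3_eq_cube)
        from this[of ?s] show ?thesis by simp
      qed
      moreover have "real (n + 1) * (2 / sqrt (c * real (n + 1))) ^ 3 = (2 / sqrt c) ^ 3 * (real (n + 1) / ?s ^ 3)"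
        by (simp add: real_sqrt_mult power_divide power_mult_distrib)
      ultimately have "real (n + 1) * (2 / sqrt (c * real (n + 1))) ^ 3 = (2 / sqrt c) ^ 3 * (1 / ?s)"
        by (simp only:)
      then have "real (n + 1) * M * B * (2 / sqrt (c * real (n + 1))) ^ 3 = M * B * ((2 / sqrt c) ^ 3 * (1 / ?s))"
        by (metis mult.assoc mult.commute)
      then show ?thesis by (simp only: C_def) simp
    qed
    finally have "norm (complex_of_real (hk n 0 - ?R)) \<le> C / ?s ^ (CARD('d) + 1)"
      by (simp only: of_real_diff)
    then have err: "\<bar>hk n 0 - ?R\<bar> \<le> C / ?s ^ (CARD('d) + 1)" by (simp only: norm_of_real)
    have "1 / 2 * (\<kappa> / pi) ^ CARD('d) / ?s ^ CARD('d) = 1 / 2 * (\<Prod>i\<in>(UNIV::'d set). ?b / pi)"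
      by (simp add: power_divide power_mult_distrib)
    also have "(\<Prod>i\<in>(UNIV::'d set). ?b / pi) = (\<Prod>i\<in>(UNIV::'d set). integral\<^sup>L unif (\<lambda>t. indicator {-?b..?b} t))"
    proof (rule prod.cong[OF refl])
      have "integral\<^sup>L unif (\<lambda>t. indicator {-?b..?b} t) = (1 / (2 * pi)) * (LINT t:{-pi..pi}|lborel. indicator {-?b..?b} t)"
        by (subst integral_unif) auto
      also have "(LINT t:{-pi..pi}|lborel. indicator {-?b..?b} t :: real) = (LINT t|lborel. indicator {-?b..?b} t)"
      proof -
        have "indicator {-pi..pi} t *\<^sub>R indicator {-a..a} t = (indicator {-a..a} t :: real)" if "a < pi" for a t
          using that by (auto split: split_indicator)
        moreover have "?b < pi" using b(2) pi_gt3 by linarith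
        ultimately show ?thesis unfolding set_lebesgue_integral_def by (simp only:)
      qed
      also have "\<dots> = 2 * ?b" using b by simp
      finally show "?b / pi = integral\<^sup>L unif (\<lambda>t. indicator {-?b..?b} t)" by simp
    qed
    also have "\<dots> = integral\<^sup>L torus (\<lambda>\<xi>::'d\<Rightarrow>real. \<Prod>i\<in>UNIV. indicator {-?b..?b} (\<xi> i))"
      unfolding torus_def
      by (rule torus_factors.product_integral_prod[symmetric])
         (auto intro!: unif.integrable_const_bound[where B=1] simp: measurable_cong_sets[OF sets_unif refl] split: split_indicator)
    also have "1 / 2 * \<dots> = integral\<^sup>L torus (\<lambda>\<xi>::'d\<Rightarrow>real. 1 / 2 * (\<Prod>i\<in>UNIV. indicator {-?b..?b} (\<xi> i)))"
      by simp
    also have "\<dots> \<le> ?R"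
    proof (rule integral_mono)
      have "\<bar>\<Prod>i\<in>(UNIV::'d set). indicator {-?b..?b} (\<xi> i) :: real\<bar> \<le> 1" for \<xi> :: "'d \<Rightarrow> real"
        by (auto simp: abs_prod intro!: prod_le_1 split: split_indicator)
      then show "integrable torus (\<lambda>\<xi>::'d\<Rightarrow>real. (1 / 2 :: real) * (\<Prod>i\<in>UNIV. indicator {-?b..?b} (\<xi> i)))"
        by (intro Bochner_Integration.integrable_mult_right integrable_torus_bounded[where B=1]) auto
      show "integrable torus (\<lambda>\<xi>::'d \<Rightarrow> real. Re (chi q \<xi>) ^ n)"
        using integrable_Re[OF Ir] by simp
      fix \<xi> :: "'d \<Rightarrow> real"
      show "1 / 2 * (\<Prod>i\<in>UNIV. indicator {-?b..?b} (\<xi> i)) \<le> Re (chi q \<xi>) ^ n"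
      proof (cases "\<forall>i. \<bar>\<xi> i\<bar> \<le> ?b")
        case True
        then have sq: "sq_norm \<xi> \<le> ?d * ?b\<^sup>2" using sq_norm_le_cube by blast
        have "?b\<^sup>2 = \<kappa>\<^sup>2 / real (n + 1)" by (simp add: power_divide)
        with sq have "sq_norm \<xi> * M \<le> ?d * (\<kappa>\<^sup>2 / real (n + 1)) * M" using M(1) by (intro mult_right_mono) auto
        also have "\<dots> = (M * ?d * \<kappa>\<^sup>2) / real (n + 1)" by (simp add: field_simps)
        also have "\<dots> \<le> (1 / 2) / real (n + 1)" by (intro divide_right_mono \<kappa>) simp
        finally have "1 - Re (chi q \<xi>) \<le> (1 / 2) / real (n + 1)" using M(2)[of \<xi>] by (simp add: mult.commute)
        then have "1 + real n * ((1 - 1 / (2 * real (n + 1))) - 1) \<ge> 1 / 2 \<and> 1 - 1 / (2 * real (n + 1)) \<le> Re (chi q \<xi>)"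
          by (auto simp: field_simps)
        then have l: "1 - 1 / (2 * real (n + 1)) \<le> Re (chi q \<xi>)" "1 / 2 \<le> 1 + real n * (- (1 / (2 * real (n + 1))))" by auto
        note l(2)
        also have "1 + real n * (- (1 / (2 * real (n + 1)))) \<le> (1 + (- (1 / (2 * real (n + 1))))) ^ n"
          by (rule Bernoulli_inequality) (simp add: field_simps)
        also have "\<dots> \<le> Re (chi q \<xi>) ^ n" using l(1) by (intro power_mono) (auto simp: field_simps)
        finally have "1 / 2 \<le> Re (chi q \<xi>) ^ n" .
        moreover have "(\<Prod>i\<in>(UNIV::'d set). indicator {-?b..?b} (\<xi> i) :: real) \<le> 1"
          by (auto intro!: prod_le_1 split: split_indicator)
        ultimately show ?thesis by linarith
      next
        case False
        then obtain i where "\<not> \<bar>\<xi> i\<bar> \<le> ?b" by blast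
        then have "indicator {-?b..?b} (\<xi> i) = (0::real)" by (auto split: split_indicator)
        then have "(\<Prod>i\<in>(UNIV::'d set). indicator {-?b..?b} (\<xi> i) :: real) = 0"
          by (intro prod_zero) auto
        moreover have "0 \<le> Re (chi q \<xi>) ^ n" using Re_chi_lazy_nonneg[of \<xi>] by simp
        ultimately show ?thesis by linarith
      qed
    qed
    finally show ?thesis using err by linarith
  qed
  moreover have "1 / 2 * (\<kappa> / pi) ^ CARD('d) > 0" using \<kappa> by simp
  moreover have "C > 0" using c M by (simp add: C_def)
  ultimately show ?thesis by blast
qed

text \<open>
  Propagate the bound at the origin with the gradient estimate.
\<close>

lemma hk_lower:
  "\<exists>c>0. \<exists>n0. \<forall>n\<ge>n0. \<forall>z. znorm z \<le> c * sqrt (real (n + 1)) \<longrightarrow> c / sqrt (real (n + 1)) ^ CARD('d) \<le> hk n z"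
proof -
  obtain c C where c: "c > 0" "C > 0" and
    lo: "\<And>n. c / sqrt (real (n + 1)) ^ CARD('d) - C / sqrt (real (n + 1)) ^ (CARD('d) + 1) \<le> hk n 0"
    using hk_lower_origin by blast
  obtain D where D: "D > 0" and gr: "\<And>n z e. \<bar>hk n (z + e) - hk n z\<bar> \<le> D * znorm e / sqrt (real (n + 1)) ^ (CARD('d) + 1)"
    using hk_gradient by blast
  define c' where "c' = min (c / 4) (c / (4 * D))"
  have c': "c' > 0" "c' \<le> c / 4" "c' \<le> c / (4 * D)" using c D by (auto simp: c'_def)
  obtain n0 :: nat where n0: "(2 * C / c)\<^sup>2 \<le> real n0" using real_arch_simple by blast
  have "c' / sqrt (real (n + 1)) ^ CARD('d) \<le> hk n z"
    if n: "n \<ge> n0" and z: "znorm z \<le> c' * sqrt (real (n + 1))" for n z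
  proof -
    let ?s = "sqrt (real (n + 1))"
    have s: "?s > 0" by simp
    have "sqrt ((2 * C / c)\<^sup>2) \<le> ?s" using n0 n by (intro real_sqrt_le_mono) simp
    then have "2 * C / c \<le> ?s" using c by simp
    then have a: "C / ?s \<le> c / 2" using c s by (simp add: field_simps)
    have "c' * ?s \<le> c / (4 * D) * ?s" using c'(3) by (rule mult_right_mono) simp
    then have "D * znorm z \<le> D * (c / (4 * D) * ?s)"
      using z D by (intro mult_left_mono) auto
    then have b: "D * znorm z / ?s \<le> c / 4" using D s by (simp add: field_simps)
    have "c' / ?s ^ CARD('d) \<le> (c - c / 2 - c / 4) / ?s ^ CARD('d)"
      using c'(2) by (intro divide_right_mono) auto
    also have "\<dots> \<le> (c - C / ?s - D * znorm z / ?s) / ?s ^ CARD('d)"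
      using a b by (intro divide_right_mono) auto
    also have "\<dots> = c / ?s ^ CARD('d) - C / ?s ^ (CARD('d) + 1) - D * znorm z / ?s ^ (CARD('d) + 1)"
      by (simp add: diff_divide_distrib)
    also have "\<dots> \<le> hk n z" using lo[of n] gr[of n 0 z] by simp
    finally show ?thesis .
  qed
  with c'(1) show ?thesis by blast
qed

end

section \<open>Tail estimates\<close>

text \<open>
  For \<open>u \<ge> -1\<close>, multiply \<open>(1 - u) exp u \<le> 1\<close> by \<open>1 + u\<close>; for smaller \<open>u\<close> the right-hand side is at
  least one.
\<close>

lemma exp_le_quadratic:
  fixes u v :: real assumes "u \<le> v" "0 \<le> v"
  shows "exp u \<le> 1 + u + u\<^sup>2 * exp v"
proof (cases "u \<ge> -1")
  case True
  have "(1 - u) * exp u \<le> exp (- u) * exp u"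
    using exp_ge_add_one_self[of "-u"] by (intro mult_right_mono) auto
  also have "exp (- u) * exp u = 1" by (simp add: exp_add[symmetric])
  finally have "(1 + u) * ((1 - u) * exp u) \<le> (1 + u) * 1"
    using True by (intro mult_left_mono) auto
  then have "exp u \<le> 1 + u + u\<^sup>2 * exp u" by (simp add: algebra_simps power2_eq_square)
  also have "u\<^sup>2 * exp u \<le> u\<^sup>2 * exp v" using assms by (intro mult_left_mono) auto
  finally show ?thesis by simp
next
  case False
  then have "0 \<le> (- u) * (- u - 1)" by (intro mult_nonneg_nonneg) auto
  then have "1 \<le> 1 + u + u\<^sup>2 * 1" by (simp add: algebra_simps power2_eq_square)
  also have "u\<^sup>2 * 1 \<le> u\<^sup>2 * exp v" using assms by (intro mult_left_mono) auto
  finally have "1 \<le> 1 + u + u\<^sup>2 * exp v" by simp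
  moreover have "exp u \<le> 1" using False by simp
  ultimately show ?thesis by linarith
qed

lemma prob_walk_Suc:
  "measure_pmf.prob (walk p (Suc n)) {w. l w} =
    measure_pmf.expectation p (\<lambda>x. measure_pmf.prob (walk p n) {w. l (x + w)})"
proof -
  have "measure_pmf.prob (walk p (Suc n)) {w. l w} = measure_pmf.expectation (walk p (Suc n)) (indicator {w. l w})"
    by simp
  also have "\<dots> = measure_pmf.expectation p (\<lambda>x. measure_pmf.prob (map_pmf ((+) x) (walk p n)) {w. l w})"
    unfolding walk.simps by (subst integral_bind_pmf_real[where B=1]) (auto split: split_indicator)
  finally show ?thesis by (simp add: vimage_def)
qed

text \<open>
  A Fuk--Nagaev inequality. Steps with \<open>l x > y\<close> are paid for by a union bound, the others by an
  exponential moment. Quantifying over all real \<open>z\<close> makes the induction close: the first step moves the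
  threshold from \<open>z\<close> to \<open>z - l x\<close>.
\<close>

lemma truncated_exponential_tail:
  fixes p :: "'a::ab_group_add pmf" and l :: "'a \<Rightarrow> real" and lam y :: real
  assumes add: "\<And>x y. l (x + y) = l x + l y" and lam: "0 \<le> lam"
  defines "A \<equiv> measure_pmf.expectation p (\<lambda>x. exp (lam * l x) * indicator {x. l x \<le> y} x)"
    and "B \<equiv> measure_pmf.prob p {x. l x > y}"
  shows "measure_pmf.prob (walk p n) {x. l x > z} \<le> real n * B + A ^ n * exp (- lam * z)"
proof (induction n arbitrary: z)
  case 0
  have "l 0 = 0" using add[of 0 0] by simp
  then show ?case using lam by (auto simp: measure_return_pmf indicator_def mult_nonneg_nonpos)
next
  case (Suc n)
  have intA: "integrable (measure_pmf p) (\<lambda>x. exp (lam * l x) * indicator {x. l x \<le> y} x)"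
    by (rule integrable_pmf_bounded[where B="exp (lam * y)"])
       (use lam in \<open>auto simp: mult_left_mono split: split_indicator\<close>)
  have intB: "integrable (measure_pmf p) (indicator {x. l x > y} :: 'a \<Rightarrow> real)"
    by (rule integrable_pmf_bounded[where B=1]) (auto split: split_indicator)
  have A0: "A \<ge> 0" unfolding A_def by (intro Bochner_Integration.integral_nonneg) auto
  have B0: "B \<ge> 0" by (simp add: B_def)
  have "measure_pmf.prob (walk p (Suc n)) {x. l x > z}
      = measure_pmf.expectation p (\<lambda>x. measure_pmf.prob (walk p n) {w. l w > z - l x})"
    unfolding prob_walk_Suc by (simp add: add less_diff_eq algebra_simps)
  also have "\<dots> \<le> measure_pmf.expectation p (\<lambda>x. indicator {x. l x > y} x + (real n * B
       + A ^ n * exp (- lam * z) * (exp (lam * l x) * indicator {x. l x \<le> y} x)))"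
  proof (rule integral_mono)
    show "integrable (measure_pmf p) (\<lambda>x. measure_pmf.prob (walk p n) {w. l w > z - l x})"
      by (rule integrable_pmf_bounded[where B=1]) auto
    show "integrable (measure_pmf p) (\<lambda>x. indicator {x. l x > y} x + (real n * B
       + A ^ n * exp (- lam * z) * (exp (lam * l x) * indicator {x. l x \<le> y} x)))"
      using intA intB by auto
    fix x
    show "measure_pmf.prob (walk p n) {w. l w > z - l x} \<le> indicator {x. l x > y} x + (real n * B
       + A ^ n * exp (- lam * z) * (exp (lam * l x) * indicator {x. l x \<le> y} x))"
    proof (cases "l x > y")
      case True
      have "measure_pmf.prob (walk p n) {w. l w > z - l x} \<le> 1" by simp
      also have "1 \<le> 1 + real n * B" using B0 by simp
      finally show ?thesis using True by simp
    next
      case False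
      have "exp (- lam * (z - l x)) = exp (- lam * z) * exp (lam * l x)"
        by (simp add: exp_add[symmetric] algebra_simps)
      then show ?thesis using Suc[of "z - l x"] False by (simp add: mult.assoc)
    qed
  qed
  also have "\<dots> = B + (real n * B + A ^ n * exp (- lam * z) * A)"
    using intA intB by (simp add: A_def B_def)
  finally show ?case by (simp add: algebra_simps)
qed

text \<open>
  Used to reverse the roles of the two halves of a path: the sup bound is taken on the first half and
  the large displacement is charged to the second.
\<close>

lemma expectation_indicator_shift_le:
  fixes p r :: "'a::ab_group_add pmf"
  assumes B: "\<And>x. pmf p x \<le> B" "0 \<le> B"
  shows "measure_pmf.expectation p (\<lambda>y. pmf r (z - y) * indicator S (z - y)) \<le> B * measure_pmf.prob r S"
proof -
  let ?f = "\<lambda>y. pmf r (z - y) * indicator S (z - y) :: real"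
  have "ennreal (measure_pmf.expectation p ?f) = (\<integral>\<^sup>+ y. ennreal (?f y) \<partial>measure_pmf p)"
    by (rule nn_integral_eq_integral[symmetric])
       (auto intro!: integrable_pmf_bounded[where B=1] simp: pmf_le_1 split: split_indicator)
  also have "\<dots> = (\<integral>\<^sup>+ y. ennreal (pmf p y) * ennreal (?f y) \<partial>count_space UNIV)"
    by (rule nn_integral_measure_pmf)
  also have "\<dots> \<le> (\<integral>\<^sup>+ y. ennreal B * ennreal (?f y) \<partial>count_space UNIV)"
    by (intro nn_integral_mono mult_right_mono ennreal_leI B) auto
  also have "\<dots> = ennreal B * (\<integral>\<^sup>+ y. ennreal (?f y) \<partial>count_space UNIV)"
    by (rule nn_integral_cmult) simp
  also have "(\<integral>\<^sup>+ y. ennreal (?f y) \<partial>count_space UNIV) = (\<integral>\<^sup>+ w. ennreal (pmf r w * indicator S w) \<partial>count_space UNIV)"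
  proof (rule nn_integral_bij_count_space[where g="\<lambda>y. z - y"])
    show "bij_betw (\<lambda>y. z - y) UNIV UNIV"
      by (rule bij_betwI[where g="\<lambda>y. z - y"]) auto
  qed
  also have "\<dots> = (\<integral>\<^sup>+ w. indicator S w \<partial>measure_pmf r)"
    unfolding nn_integral_measure_pmf by (intro nn_integral_cong) (auto split: split_indicator)
  also have "\<dots> = ennreal (measure_pmf.prob r S)"
    by (simp add: measure_pmf.emeasure_eq_measure)
  finally have "ennreal (measure_pmf.expectation p ?f) \<le> ennreal (B * measure_pmf.prob r S)"
    using B by (simp add: ennreal_mult)
  then show ?thesis using B by (subst (asm) ennreal_le_iff) auto
qed

context lattice_step
begin

lemma step_tail_dotp:
  "\<exists>C\<ge>1. \<forall>\<xi> y. sq_norm \<xi> = 1 \<longrightarrow> y > 0 \<longrightarrow> measure_pmf.prob q {x. dotp \<xi> x > y} \<le> C / y ^ CARD('d)"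
proof -
  obtain C where C: "C > 0" and tail: "\<And>r. r \<ge> 1 \<Longrightarrow>
    measure_pmf.prob \<theta> {z. znorm z > r} < C * r powr - real CARD('d)"
    using step_tail by blast
  have "measure_pmf.prob q {x. dotp \<xi> x > y} \<le> (C + 1) / y ^ CARD('d)" if "sq_norm \<xi> = 1" "y > 0" for \<xi> y
  proof (cases "y \<ge> 1")
    case True
    have "measure_pmf.prob q {x. dotp \<xi> x > y} = measure_pmf.expectation q (indicator {x. dotp \<xi> x > y})"
      by simp
    also have "\<dots> = measure_pmf.prob \<theta> {x. dotp \<xi> x > y} / 2"
      using that by (subst expectation_lazy_real[where B=1]) (auto split: split_indicator)
    also have "\<dots> \<le> measure_pmf.prob \<theta> {x. dotp \<xi> x > y}" by simp
    also have "\<dots> \<le> measure_pmf.prob \<theta> {z. znorm z > y}"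
    proof (rule measure_pmf.finite_measure_mono)
      show "{x. dotp \<xi> x > y} \<subseteq> {z. znorm z > y}"
      proof clarify
        fix x assume "y < dotp \<xi> x"
        with dotp_le[of \<xi> x] that show "y < znorm x" by simp
      qed
    qed simp
    also have "\<dots> \<le> C * y powr - real CARD('d)" using tail[OF True] by simp
    also have "\<dots> = C / y ^ CARD('d)"
      using that by (simp add: powr_minus powr_realpow divide_inverse)
    also have "\<dots> \<le> (C + 1) / y ^ CARD('d)" using that by (intro divide_right_mono) auto
    finally show ?thesis .
  next
    case False
    then have "y ^ CARD('d) \<le> 1" using that by (intro power_le_one) auto
    then have "1 \<le> (C + 1) / y ^ CARD('d)" using that C by (simp add: le_divide_eq)
    then show ?thesis by (rule order_trans[OF measure_pmf.prob_le_1])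
  qed
  then show ?thesis using C by (intro exI[of _ "C + 1"]) auto
qed

text \<open>
  The exponent \<open>d\<close> of the tail hypothesis survives: a single big step has probability
  \<open>n r\<^sup>-\<^sup>d \<le> (n\<^sup>1\<^sup>/\<^sup>2 / r)\<^sup>d\<close>, and truncating at \<open>r / d\<close> lets the exponential bound reach the same power.
\<close>

lemma walk_tail_dotp:
  "\<exists>C>0. \<forall>\<xi> n r. sq_norm \<xi> = 1 \<longrightarrow> r > 0 \<longrightarrow>
     measure_pmf.prob (walk q n) {x. dotp \<xi> x > r} \<le> C * (sqrt (real (n + 1)) / r) ^ CARD('d)"
proof -
  obtain C where C: "C \<ge> 1" and tail: "\<And>\<xi> y. sq_norm \<xi> = 1 \<Longrightarrow> y > 0 \<Longrightarrow>
      measure_pmf.prob q {x. dotp \<xi> x > y} \<le> C / y ^ CARD('d)"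
    using step_tail_dotp by blast
  define V where "V = measure_pmf.expectation \<theta> (\<lambda>x. (znorm x)\<^sup>2)"
  have V0: "V \<ge> 0" by (simp add: V_def)
  let ?d = "real CARD('d)"
  define K where "K = C * ?d ^ CARD('d) + exp (?d\<^sup>2 * V * 4)"
  have e1: "exp (?d\<^sup>2 * V * 4) \<ge> 1" using V0 by simp
  have cd0: "C * ?d ^ CARD('d) \<ge> 0" using C by simp
  have K: "K \<ge> 1" using e1 cd0 unfolding K_def by linarith
  have "measure_pmf.prob (walk q n) {x. dotp \<xi> x > r} \<le> K * (sqrt (real (n + 1)) / r) ^ CARD('d)"
    if \<xi>: "sq_norm \<xi> = 1" and r: "r > 0" for \<xi> n r
  proof (cases "sqrt (real (n + 1)) \<le> r")
    case False
    then have "1 \<le> (sqrt (real (n + 1)) / r) ^ CARD('d)" using r by (intro one_le_power) simp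
    then have "1 * 1 \<le> K * (sqrt (real (n + 1)) / r) ^ CARD('d)" using K by (intro mult_mono) auto
    then show ?thesis by (intro order_trans[OF measure_pmf.prob_le_1]) simp
  next
    case True
    let ?s = "sqrt (real (n + 1))"
    have s: "?s \<ge> 1" by simp
    define t where "t = r / ?s"
    \<comment> \<open>With \<open>t = r / sqrt (n + 1)\<close> the choice of \<open>lam\<close> gives \<open>exp (lam y) = t\<close> and \<open>exp (- lam r) = t\<^sup>-\<^sup>d\<close>;
      the quadratic term \<open>n lam\<^sup>2 t\<close> is of order \<open>(ln t)\<^sup>2 / t\<close>, hence bounded.\<close>
    define y where "y = r / ?d"
    define lam where "lam = ?d * ln t / r"
    have t: "t \<ge> 1" using True s by (simp add: t_def)
    then have lnt: "ln t \<ge> 0" by simp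
    have y: "y > 0" using r by (simp add: y_def)
    have lam: "lam \<ge> 0" using lnt r by (simp add: lam_def)
    have ly: "exp (lam * y) = t" using r t by (simp add: lam_def y_def)
    have lr: "exp (- lam * r) = (1 / t) ^ CARD('d)"
    proof -
      have "exp (- lam * r) = exp (?d * (- ln t))" using r by (simp add: lam_def)
      also have "\<dots> = exp (- ln t) ^ CARD('d)" by (rule exp_of_nat_mult)
      finally show ?thesis using t by (simp add: exp_minus divide_inverse)
    qed
    define A where "A = measure_pmf.expectation q (\<lambda>x. exp (lam * dotp \<xi> x) * indicator {x. dotp \<xi> x \<le> y} x)"
    have A0: "A \<ge> 0" unfolding A_def by (intro Bochner_Integration.integral_nonneg) auto
    have bdd: "\<bar>exp (lam * dotp \<xi> x) * indicator {x. dotp \<xi> x \<le> y} x\<bar> \<le> exp (lam * y)" for x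
      using lam by (auto simp: mult_left_mono split: split_indicator)
    have "A = (measure_pmf.expectation \<theta> (\<lambda>x. exp (lam * dotp \<xi> x) * indicator {x. dotp \<xi> x \<le> y} x) + 1) / 2"
      unfolding A_def using y by (subst expectation_lazy_real[OF bdd]) simp
    also have "measure_pmf.expectation \<theta> (\<lambda>x. exp (lam * dotp \<xi> x) * indicator {x. dotp \<xi> x \<le> y} x)
      \<le> measure_pmf.expectation \<theta> (\<lambda>x. 1 + lam * dotp \<xi> x + lam\<^sup>2 * t * (znorm x)\<^sup>2)"
    proof (rule integral_mono)
      show "integrable (measure_pmf \<theta>) (\<lambda>x. exp (lam * dotp \<xi> x) * indicator {x. dotp \<xi> x \<le> y} x)"
        by (rule integrable_pmf_bounded[where B="exp (lam * y)"]) (use bdd in simp)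
      show "integrable (measure_pmf \<theta>) (\<lambda>x. 1 + lam * dotp \<xi> x + lam\<^sup>2 * t * (znorm x)\<^sup>2)"
        using expectation_dotp(1)[of \<xi>] second_moment by auto
      fix x
      have "(dotp \<xi> x)\<^sup>2 \<le> (znorm x)\<^sup>2"
        using power_mono[OF dotp_le[of \<xi> x], of 2] \<xi> by simp
      then have q: "(lam * dotp \<xi> x)\<^sup>2 * t \<le> lam\<^sup>2 * t * (znorm x)\<^sup>2"
        using t mult_left_mono[of "(dotp \<xi> x)\<^sup>2" "(znorm x)\<^sup>2" "lam\<^sup>2 * t"] by (simp add: power_mult_distrib mult_ac)
      show "exp (lam * dotp \<xi> x) * indicator {x. dotp \<xi> x \<le> y} x \<le> 1 + lam * dotp \<xi> x + lam\<^sup>2 * t * (znorm x)\<^sup>2"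
      proof (cases "dotp \<xi> x \<le> y")
        case True
        then have "exp (lam * dotp \<xi> x) \<le> 1 + lam * dotp \<xi> x + (lam * dotp \<xi> x)\<^sup>2 * exp (lam * y)"
          using lam y by (intro exp_le_quadratic mult_left_mono) auto
        with q True show ?thesis by (simp add: ly)
      next
        case False
        then have "0 \<le> lam * dotp \<xi> x" using lam y by simp
        moreover have "0 \<le> lam\<^sup>2 * t * (znorm x)\<^sup>2" using t by simp
        ultimately show ?thesis using False by simp
      qed
    qed
    also have "\<dots> = 1 + lam\<^sup>2 * t * V"
      using expectation_dotp[of \<xi>] second_moment by (simp add: V_def)
    finally have "A \<le> ((1 + lam\<^sup>2 * t * V) + 1) / 2" by (simp add: divide_right_mono)
    also have "((1 + lam\<^sup>2 * t * V) + 1) / 2 \<le> 1 + lam\<^sup>2 * t * V"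
    proof -
      have "((1 + a) + 1) / 2 \<le> 1 + a" if "0 \<le> a" for a :: real using that by simp
      moreover have "0 \<le> lam\<^sup>2 * t * V" using V0 t by simp
      ultimately show ?thesis by blast
    qed
    finally have "A \<le> 1 + lam\<^sup>2 * t * V" .
    also have "\<dots> \<le> exp (lam\<^sup>2 * t * V)" by (rule exp_ge_add_one_self)
    finally have "A ^ n \<le> exp (lam\<^sup>2 * t * V) ^ n" using A0 by (intro power_mono)
    also have "\<dots> = exp (real n * (lam\<^sup>2 * t * V))" by (simp add: exp_of_nat_mult)
    also have "\<dots> \<le> exp (?d\<^sup>2 * V * 4)"
    proof (subst exp_le_cancel_iff)
      have "ln t / 2 \<le> exp (ln t / 2)" using exp_ge_add_one_self[of "ln t / 2"] by linarith
      then have "(ln t / 2)\<^sup>2 \<le> (exp (ln t / 2))\<^sup>2" using lnt by (intro power_mono) auto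
      also have "\<dots> = t" using t by (simp add: power2_eq_square exp_add[symmetric])
      finally have ll: "(ln t)\<^sup>2 \<le> 4 * t" by (simp add: power_divide)
      have "real n * (lam\<^sup>2 * t * V) \<le> real (n + 1) * (lam\<^sup>2 * t * V)"
        using V0 t by (intro mult_right_mono) auto
      also have "real (n + 1) = r\<^sup>2 / t\<^sup>2" using r by (simp add: t_def power_divide)
      also have "r\<^sup>2 / t\<^sup>2 * (lam\<^sup>2 * t * V) = ?d\<^sup>2 * V * ((ln t)\<^sup>2 / t)"
        using r t by (simp add: lam_def power_divide power_mult_distrib power2_eq_square)
      also have "\<dots> \<le> ?d\<^sup>2 * V * 4" using ll t V0 by (intro mult_left_mono) (auto simp: divide_le_eq)
      finally show "real n * (lam\<^sup>2 * t * V) \<le> ?d\<^sup>2 * V * 4" .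
    qed
    finally have An: "A ^ n \<le> exp (?d\<^sup>2 * V * 4)" .
    have "real n * measure_pmf.prob q {x. dotp \<xi> x > y} \<le> real (n + 1) * (C / y ^ CARD('d))"
      using tail[OF \<xi> y] by (intro mult_mono) auto
    also have "real (n + 1) = ?s ^ 2" by simp
    also have "\<dots> * (C / y ^ CARD('d)) \<le> ?s ^ CARD('d) * (C / y ^ CARD('d))"
      using dim s y C by (intro mult_right_mono power_increasing) auto
    also have "\<dots> = C * ?d ^ CARD('d) * (1 / t) ^ CARD('d)"
      by (simp add: y_def t_def power_divide)
    finally have Bn: "real n * measure_pmf.prob q {x. dotp \<xi> x > y} \<le> C * ?d ^ CARD('d) * (1 / t) ^ CARD('d)" .
    have "measure_pmf.prob (walk q n) {x. dotp \<xi> x > r}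
       \<le> real n * measure_pmf.prob q {x. dotp \<xi> x > y} + A ^ n * exp (- lam * r)"
      unfolding A_def by (rule truncated_exponential_tail) (auto simp: dotp_add lam)
    also have "\<dots> \<le> C * ?d ^ CARD('d) * (1 / t) ^ CARD('d) + exp (?d\<^sup>2 * V * 4) * (1 / t) ^ CARD('d)"
      unfolding lr using An Bn t by (intro add_mono mult_right_mono) auto
    also have "\<dots> = K * (?s / r) ^ CARD('d)"
      by (simp add: K_def t_def algebra_simps)
    finally show ?thesis .
  qed
  then show ?thesis using K by (intro exI[of _ K]) auto
qed

lemma walk_tail:
  "\<exists>C>0. \<forall>n r. r > 0 \<longrightarrow> measure_pmf.prob (walk q n) {x. znorm x \<ge> r} \<le> C * (sqrt (real (n + 1)) / r) ^ CARD('d)"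
proof -
  obtain C where C: "C > 0" and tail: "\<And>\<xi> n r. sq_norm \<xi> = 1 \<Longrightarrow> r > 0 \<Longrightarrow>
     measure_pmf.prob (walk q n) {x. dotp \<xi> x > r} \<le> C * (sqrt (real (n + 1)) / r) ^ CARD('d)"
    using walk_tail_dotp by blast
  let ?d = "real CARD('d)"
  define e where "e s i = (\<lambda>j. if j = i then s else 0)" for s :: real and i :: 'd
  have e: "sq_norm (e s i) = s\<^sup>2" "dotp (e s i) x = s * real_of_int (x $ i)" for s i x
    by (simp_all add: e_def sq_norm_def dotp_def if_distrib[of "\<lambda>x. x^2"] if_distrib[of "\<lambda>x. x * _"] cong: if_cong)
  have "measure_pmf.prob (walk q n) {x. znorm x \<ge> r} \<le> 2 * ?d * C * (2 * ?d) ^ CARD('d) * (sqrt (real (n + 1)) / r) ^ CARD('d)"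
    if r: "r > 0" for n r
  proof -
    have "measure_pmf.prob (walk q n) {x. znorm x \<ge> r}
      \<le> measure_pmf.prob (walk q n) (\<Union>(s, i)\<in>{1, -1} \<times> UNIV. {x. dotp (e s i) x > r / (2 * ?d)})"
    proof (rule measure_pmf.finite_measure_mono)
      show "{x. znorm x \<ge> r} \<subseteq> (\<Union>(s, i)\<in>{1, -1} \<times> UNIV. {x. dotp (e s i) x > r / (2 * ?d)})"
      proof
        fix x :: "int^'d" assume "x \<in> {x. znorm x \<ge> r}"
        then obtain i where "r \<le> ?d * \<bar>real_of_int (x $ i)\<bar>"
          using exists_large_component[of x] by (auto intro: order_trans)
        then have "r < 2 * ?d * \<bar>real_of_int (x $ i)\<bar>" using r by linarith
        then have "r / (2 * ?d) < \<bar>real_of_int (x $ i)\<bar>" by (simp add: divide_less_eq mult_ac)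
        then have "r / (2 * ?d) < dotp (e 1 i) x \<or> r / (2 * ?d) < dotp (e (-1) i) x"
          unfolding e by linarith
        then show "x \<in> (\<Union>(s, i)\<in>{1, -1} \<times> UNIV. {x. dotp (e s i) x > r / (2 * ?d)})" by auto
      qed
    qed simp
    also have "\<dots> \<le> (\<Sum>k\<in>{1, -1} \<times> (UNIV::'d set). measure_pmf.prob (walk q n) {x. dotp (e (fst k) (snd k)) x > r / (2 * ?d)})"
      unfolding case_prod_beta by (rule measure_pmf.finite_measure_subadditive_finite) auto
    also have "\<dots> \<le> (\<Sum>k\<in>{1, -1::real} \<times> (UNIV::'d set). C * (sqrt (real (n + 1)) / (r / (2 * ?d))) ^ CARD('d))"
      by (intro sum_mono tail) (use r e in auto)
    also have "\<dots> = 2 * ?d * (C * (sqrt (real (n + 1)) / (r / (2 * ?d))) ^ CARD('d))"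
      by (simp add: card_cartesian_product)
    also have "\<dots> = 2 * ?d * C * (2 * ?d) ^ CARD('d) * (sqrt (real (n + 1)) / r) ^ CARD('d)"
      by (simp add: power_divide power_mult_distrib)
    finally show ?thesis .
  qed
  moreover have "2 * ?d * C * (2 * ?d) ^ CARD('d) > 0" using C by simp
  ultimately show ?thesis by blast
qed

text \<open>
  Cut a path of length \<open>n\<close> in the middle. One of the halves covers at least half of \<open>|z|\<close>, which costs
  \<open>(n\<^sup>1\<^sup>/\<^sup>2 / |z|)\<^sup>d\<close>; the other half contributes the uniform bound \<open>n\<^sup>-\<^sup>d\<^sup>/\<^sup>2\<close>, and the powers of \<open>n\<close> cancel.
\<close>

lemma hk_off_diagonal: "\<exists>C>0. \<forall>n z. z \<noteq> 0 \<longrightarrow> hk n z \<le> C / znorm z ^ CARD('d)"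
proof -
  obtain C where C: "C > 0" and up: "\<And>n z. hk n z \<le> C / sqrt (real (n + 1)) ^ CARD('d)"
    using hk_upper by blast
  obtain D where D: "D > 0" and tail: "\<And>n r. r > 0 \<Longrightarrow>
      measure_pmf.prob (walk q n) {x. znorm x \<ge> r} \<le> D * (sqrt (real (n + 1)) / r) ^ CARD('d)"
    using walk_tail by blast
  have "hk n z \<le> 2 * C * D * 4 ^ CARD('d) / znorm z ^ CARD('d)" if z: "z \<noteq> 0" for n z
  proof -
    define m where "m = n div 2"
    define k where "k = n - m"
    have mk: "n = m + k" "m \<le> k" "k + 1 \<le> 2 * (m + 1)" by (auto simp: m_def k_def)
    have zr: "znorm z > 0"
    proof -
      have "\<exists>i. z $ i \<noteq> 0" using z by (simp add: vec_eq_iff)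
      then obtain i where "z $ i \<noteq> 0" by blast
      with component_le_znorm[of z i] show ?thesis by linarith
    qed
    define r where "r = znorm z / 2"
    have r: "r > 0" using zr by (simp add: r_def)
    let ?S = "{x :: int^'d. znorm x \<ge> r}"
    let ?Cm = "C / sqrt (real (m + 1)) ^ CARD('d)" and ?Ck = "C / sqrt (real (k + 1)) ^ CARD('d)"
    have hb: "0 \<le> hk k w" "hk k w \<le> 1" for w by (auto simp: pmf_le_1)
    have I1: "integrable (measure_pmf (walk q m)) (\<lambda>y. ?Ck * indicator ?S y)"
      by (rule Bochner_Integration.integrable_mult_right)
         (rule integrable_pmf_bounded[where B=1], simp split: split_indicator)
    have I2: "integrable (measure_pmf (walk q m)) (\<lambda>y. hk k (z - y) * indicator ?S (z - y))"
      by (rule integrable_pmf_bounded[where B=1]) (use hb in \<open>simp split: split_indicator\<close>)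
    have "hk n z = measure_pmf.expectation (walk q m) (\<lambda>y. hk k (z - y))"
      unfolding mk(1) pmf_walk_add ..
    also have "\<dots> \<le> measure_pmf.expectation (walk q m) (\<lambda>y. ?Ck * indicator ?S y + hk k (z - y) * indicator ?S (z - y))"
    proof (rule integral_mono)
      show "integrable (measure_pmf (walk q m)) (\<lambda>y. hk k (z - y))"
        by (rule integrable_pmf_bounded[where B=1]) (use hb in auto)
      show "integrable (measure_pmf (walk q m)) (\<lambda>y. ?Ck * indicator ?S y + hk k (z - y) * indicator ?S (z - y))"
        by (rule Bochner_Integration.integrable_add[OF I1 I2])
      fix y
      have "znorm z \<le> znorm y + znorm (z - y)" using znorm_triangle[of y "z - y"] by simp
      then have "y \<in> ?S \<or> z - y \<in> ?S" by (auto simp: r_def)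
      then show "hk k (z - y) \<le> ?Ck * indicator ?S y + hk k (z - y) * indicator ?S (z - y)"
        using up[of k "z - y"] hb[of "z - y"] C by (auto split: split_indicator)
    qed
    also have "\<dots> = ?Ck * measure_pmf.prob (walk q m) ?S
        + measure_pmf.expectation (walk q m) (\<lambda>y. hk k (z - y) * indicator ?S (z - y))"
      by (subst Bochner_Integration.integral_add[OF I1 I2]) simp
    also have "\<dots> \<le> ?Ck * measure_pmf.prob (walk q m) ?S + ?Cm * measure_pmf.prob (walk q k) ?S"
      by (intro add_left_mono expectation_indicator_shift_le up) (use C in auto)
    also have "\<dots> \<le> ?Ck * (D * (sqrt (real (m + 1)) / r) ^ CARD('d)) + ?Cm * (D * (sqrt (real (k + 1)) / r) ^ CARD('d))"
      using tail[OF r] C by (intro add_mono mult_left_mono) auto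
    also have "\<dots> = C * D / r ^ CARD('d) * ((sqrt (real (m + 1)) / sqrt (real (k + 1))) ^ CARD('d)
        + (sqrt (real (k + 1)) / sqrt (real (m + 1))) ^ CARD('d))"
      by (simp add: power_divide algebra_simps)
    also have "\<dots> \<le> C * D / r ^ CARD('d) * (2 ^ CARD('d) + 2 ^ CARD('d))"
    proof (intro mult_left_mono add_mono power_mono)
      have "sqrt (real (m + 1)) \<le> 1 * sqrt (real (k + 1))" using mk by simp
      also have "\<dots> \<le> 2 * sqrt (real (k + 1))" by (intro mult_right_mono) auto
      finally show "sqrt (real (m + 1)) / sqrt (real (k + 1)) \<le> 2" by (simp add: divide_le_eq)
      have "sqrt (real (k + 1)) \<le> sqrt (2\<^sup>2 * real (m + 1))" using mk by (intro real_sqrt_le_mono) simp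
      also have "\<dots> = 2 * sqrt (real (m + 1))" by (simp only: real_sqrt_mult) simp
      finally show "sqrt (real (k + 1)) / sqrt (real (m + 1)) \<le> 2" by (simp add: divide_le_eq)
    qed (use C D r in auto)
    also have "\<dots> = 2 * C * D * 4 ^ CARD('d) / znorm z ^ CARD('d)"
      by (simp add: r_def power_divide power_mult_distrib[symmetric] field_simps)
    finally show ?thesis .
  qed
  moreover have "2 * C * D * 4 ^ CARD('d) > 0" using C D by simp
  ultimately show ?thesis by blast
qed

end

section \<open>The Green function\<close>

definition green :: "'a::ab_group_add pmf \<Rightarrow> 'a \<Rightarrow> real" where
  "green p z = (\<Sum>n. pmf (walk p n) z)"

text \<open>
  Replaces the norm in the decay estimates that are to hold at the origin as well.
\<close>

definition bracket :: "int^'d::finite \<Rightarrow> real" where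
  "bracket z = 1 + znorm z"

text \<open>
  The diffusive scale at time \<open>n\<close>, shifted by one to be positive at time zero.
\<close>

definition root_time :: "nat \<Rightarrow> real" where
  "root_time n = sqrt (real (n + 1))"

lemma root_time_ge_1 [simp]: "1 \<le> root_time n" by (simp add: root_time_def)

lemma root_time_pos [simp]: "0 < root_time n" by (simp add: root_time_def)

lemma root_time_mono: "m \<le> n \<Longrightarrow> root_time m \<le> root_time n" by (simp add: root_time_def)

lemma root_time_square: "root_time n ^ 2 = real (n + 1)" by (simp add: root_time_def)

lemma bracket_ge_1 [simp]: "1 \<le> bracket z" by (simp add: bracket_def)

lemma bracket_pos [simp]: "0 < bracket z" using bracket_ge_1[of z] by linarith

lemma bracket_nonneg [simp]: "0 \<le> bracket z" using bracket_ge_1[of z] by linarith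

lemma bracket_neq_0 [simp]: "bracket z \<noteq> 0" using bracket_ge_1[of z] by linarith

lemma bracket_uminus [simp]: "bracket (- z) = bracket z" by (simp add: bracket_def)

lemma bracket_triangle: "bracket x \<le> bracket (y - x) + bracket y"
  using znorm_triangle_diff[of x y] by (simp add: bracket_def)

lemma znorm_ge_1: "z \<noteq> 0 \<Longrightarrow> 1 \<le> znorm (z :: int^'d)"
proof -
  assume "z \<noteq> 0"
  then obtain i where "z $ i \<noteq> 0" by (auto simp: vec_eq_iff)
  then have "1 \<le> \<bar>real_of_int (z $ i)\<bar>" by linarith
  with component_le_znorm[of z i] show ?thesis by linarith
qed

text \<open>
  Compare with the telescoping sum of \<open>2 (1 / (n + 1) - 1 / (n + 2)) \<ge> 1 / (n + 1)\<^sup>2\<close>.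
\<close>

lemma root_time_power_sums:
  assumes "m \<ge> 4"
  shows "summable (\<lambda>n. 1 / root_time (n + N) ^ m)" "(\<Sum>n. 1 / root_time (n + N) ^ m) \<le> 2 / root_time N ^ (m - 2)"
proof -
  let ?a = "\<lambda>n. 1 / root_time N ^ (m - 4) * (2 * (1 / real (n + N + 1)))"
  have "(\<lambda>n. 1 / real (n + N + 1)) \<longlonglongrightarrow> 0"
    using LIMSEQ_ignore_initial_segment[OF lim_1_over_n[where ?'a=real], of "N + 1"] by (simp only: add.assoc)
  then have "?a \<longlonglongrightarrow> 1 / root_time N ^ (m - 4) * (2 * 0)" by (intro tendsto_mult tendsto_const)
  from telescope_sums'[OF this]
  have sums: "(\<lambda>n. ?a n - ?a (Suc n)) sums (1 / root_time N ^ (m - 4) * (2 / real (N + 1)))"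
    by simp
  have le: "1 / root_time (n + N) ^ m \<le> ?a n - ?a (Suc n)" for n
  proof -
    have "m = (m - 4) + 2 * 2" using assms by simp
    then have "root_time (n + N) ^ m = root_time (n + N) ^ (m - 4) * (root_time (n + N) ^ 2) ^ 2"
      by (metis power_add power_mult)
    then have e: "root_time (n + N) ^ m = root_time (n + N) ^ (m - 4) * real (n + N + 1) ^ 2" by (simp add: root_time_square)
    have "1 / root_time (n + N) ^ m = 1 / root_time (n + N) ^ (m - 4) * (1 / real (n + N + 1) ^ 2)"
      unfolding e by simp
    also have "\<dots> \<le> 1 / root_time N ^ (m - 4) * (2 * (1 / real (n + N + 1) - 1 / real (Suc n + N + 1)))"
    proof (intro mult_mono)
      show "1 / root_time (n + N) ^ (m - 4) \<le> 1 / root_time N ^ (m - 4)"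
        by (intro divide_left_mono power_mono root_time_mono mult_pos_pos zero_less_power)
           (auto intro: less_imp_le)
      have gen: "1 / x ^ 2 \<le> 2 * (1 / x - 1 / (x + 1))" if "x \<ge> 1" for x :: real
      proof -
        have "2 * (1 / x - 1 / (x + 1)) = 2 / (x * (x + 1))" using that by (simp add: field_simps)
        also have "\<dots> \<ge> 2 / (x * (x + x))" using that by (intro divide_left_mono mult_left_mono) auto
        also have "2 / (x * (x + x)) = 1 / x ^ 2" using that by (simp add: power2_eq_square field_simps)
        finally show ?thesis by simp
      qed
      show "1 / real (n + N + 1) ^ 2 \<le> 2 * (1 / real (n + N + 1) - 1 / real (Suc n + N + 1))"
        using gen[of "real (n + N + 1)"] by simp
    qed (auto intro: less_imp_le)
    finally show ?thesis by (simp add: right_diff_distrib)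
  qed
  show S: "summable (\<lambda>n. 1 / root_time (n + N) ^ m)"
  proof (rule summable_comparison_test')
    show "summable (\<lambda>n. ?a n - ?a (Suc n))" using sums by (rule sums_summable)
    fix n show "norm (1 / root_time (n + N) ^ m) \<le> ?a n - ?a (Suc n)"
      using le[of n] by (simp add: less_imp_le)
  qed
  have "(\<Sum>n. 1 / root_time (n + N) ^ m) \<le> 1 / root_time N ^ (m - 4) * (2 / real (N + 1))"
    using suminf_le[OF le S sums_summable[OF sums]] sums_unique[OF sums] by linarith
  also have "\<dots> = 2 / (root_time N ^ (m - 4) * root_time N ^ 2)" by (simp add: root_time_square)
  also have "root_time N ^ (m - 4) * root_time N ^ 2 = root_time N ^ (m - 2)"
  proof -
    have "m - 2 = (m - 4) + 2" using assms by simp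
    then show ?thesis by (simp only: power_add)
  qed
  finally show "(\<Sum>n. 1 / root_time (n + N) ^ m) \<le> 2 / root_time N ^ (m - 2)" .
qed

lemma root_time_cube_summable: "summable (\<lambda>n. 1 / root_time n ^ 3)"
proof -
  have "summable (\<lambda>n. real (n + 1) powr (- (3/2)))"
    using summable_ignore_initial_segment[of "\<lambda>n. real n powr (- (3/2))" 1] by (simp add: summable_real_powr_iff)
  also have "(\<lambda>n. real (n + 1) powr (- (3/2))) = (\<lambda>n. 1 / root_time n ^ 3)"
  proof
    fix n
    have "root_time n ^ 3 = (real (n + 1) powr (1/2)) powr 3"
      by (simp add: root_time_def powr_half_sqrt powr_numeral)
    also have "\<dots> = real (n + 1) powr (3/2)" by (simp add: powr_powr)
    finally show "real (n + 1) powr (- (3/2)) = 1 / root_time n ^ 3"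
      by (simp only: powr_minus_divide)
  qed
  finally show ?thesis .
qed

context lattice_step
begin

abbreviation "g \<equiv> green q"

text \<open>
  The decay exponent \<open>d - 2\<close> of the Green function.
\<close>

definition k :: nat where "k = CARD('d) - 2"

lemma d_eq: "CARD('d) = k + 2" "k \<ge> 3"
  using dim by (auto simp: k_def)

lemma hk_nonneg [simp]: "0 \<le> hk n z" by simp

lemma hk_upper_root_time: "\<exists>C>0. \<forall>n z. hk n z \<le> C / root_time n ^ (k + 2)"
  using hk_upper unfolding root_time_def d_eq(1) .

lemma hk_summable_shift: "summable (\<lambda>n. hk (n + N) z)"
proof -
  obtain C where C: "C > 0" "\<And>n z. hk n z \<le> C / root_time n ^ (k + 2)" using hk_upper_root_time by blast
  have "summable (\<lambda>n. C * (1 / root_time (n + N) ^ (k + 2)))"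
    using d_eq by (intro summable_mult root_time_power_sums) auto
  then show ?thesis
    by (rule summable_comparison_test'[where N=0]) (use C in auto)
qed

lemma hk_summable: "summable (\<lambda>n. hk n z)"
  using hk_summable_shift[of 0] by simp

lemma green_split: "g z = (\<Sum>n. hk (n + N) z) + (\<Sum>n<N. hk n z)"
  unfolding green_def by (rule suminf_split_initial_segment[OF hk_summable])

lemma green_nonneg [simp]: "0 \<le> g z"
  unfolding green_def by (intro suminf_nonneg hk_summable) auto

lemma hk_tail_sum: "\<exists>C>0. \<forall>N z. (\<Sum>n. hk (n + N) z) \<le> C / root_time N ^ k"
proof -
  obtain C where C: "C > 0" "\<And>n z. hk n z \<le> C / root_time n ^ (k + 2)" using hk_upper_root_time by blast
  have "(\<Sum>n. hk (n + N) z) \<le> 2 * C / root_time N ^ k" for N z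
  proof -
    have s: "summable (\<lambda>n. 1 / root_time (n + N) ^ (k + 2))" "(\<Sum>n. 1 / root_time (n + N) ^ (k + 2)) \<le> 2 / root_time N ^ k"
      using root_time_power_sums[of "k + 2" N] d_eq by auto
    have "(\<Sum>n. hk (n + N) z) \<le> (\<Sum>n. C * (1 / root_time (n + N) ^ (k + 2)))"
      by (intro suminf_le hk_summable_shift summable_mult s) (use C in auto)
    also have "\<dots> = C * (\<Sum>n. 1 / root_time (n + N) ^ (k + 2))" by (rule suminf_mult[OF s(1)])
    also have "\<dots> \<le> C * (2 / root_time N ^ k)" using s(2) C by (intro mult_left_mono) auto
    finally show ?thesis by (simp add: mult.commute)
  qed
  then show ?thesis using C(1) by (intro exI[of _ "2 * C"]) auto
qed

lemma ceiling_bounds: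
  fixes a :: real assumes "a \<ge> 0"
  shows "a \<le> real (nat \<lceil>a\<rceil>)" "real (nat \<lceil>a\<rceil>) \<le> a + 1"
  using assms by (auto simp: of_nat_ceiling)

lemma root_time_ge_of_square: "a ^ 2 \<le> real N \<Longrightarrow> a \<le> root_time N" for a :: real
  unfolding root_time_def by (rule real_le_rsqrt) simp

text \<open>
  Use \<open>hk_off_diagonal\<close> for the first \<open>|z|\<^sup>2\<close> times and the tail sum of \<open>hk_upper\<close> afterwards.
\<close>

lemma green_upper: "\<exists>C>0. \<forall>z. g z \<le> C / bracket z ^ k"
proof -
  obtain C where C: "C > 0" "\<And>N z. (\<Sum>n. hk (n + N) z) \<le> C / root_time N ^ k" using hk_tail_sum by blast
  obtain D where D: "D > 0" "\<And>n z. z \<noteq> 0 \<Longrightarrow> hk n z \<le> D / znorm z ^ (k + 2)"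
    using hk_off_diagonal unfolding d_eq(1) by blast
  have "g z \<le> (C + 2 * D) * 2 ^ k / bracket z ^ k" for z
  proof (cases "z = 0")
    case True
    have "g z = (\<Sum>n. hk (n + 0) z)" by (simp add: green_def)
    also have "\<dots> \<le> C" using C(2)[of 0 z] by (simp add: root_time_def)
    also have "\<dots> \<le> (C + 2 * D) * 2 ^ k"
    proof -
      have "C * 1 \<le> (C + 2 * D) * 2 ^ k" using C D by (intro mult_mono) auto
      then show ?thesis by simp
    qed
    finally show ?thesis using True by (simp add: bracket_def)
  next
    case False
    let ?r = "znorm z"
    have r: "?r \<ge> 1" using znorm_ge_1[OF False] .
    define N where "N = nat \<lceil>?r ^ 2\<rceil>"
    have N: "?r ^ 2 \<le> real N" "real N \<le> ?r ^ 2 + 1" using ceiling_bounds[of "?r ^ 2"] by (auto simp: N_def)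
    have r2: "1 \<le> ?r ^ 2" using r by simp
    have N2: "real N \<le> 2 * ?r ^ 2" using N r2 by linarith
    have "(\<Sum>n<N. hk n z) \<le> (\<Sum>n<N. D / ?r ^ (k + 2))"
      using D(2)[OF False] by (intro sum_mono) auto
    also have "\<dots> = real N * (D / ?r ^ (k + 2))" by simp
    also have "\<dots> \<le> (2 * ?r ^ 2) * (D / ?r ^ (k + 2))"
      using D r by (intro mult_right_mono N2) auto
    also have "\<dots> = 2 * D / ?r ^ k" using r by (simp add: power_add power2_eq_square)
    finally have a: "(\<Sum>n<N. hk n z) \<le> 2 * D / ?r ^ k" .
    have "(\<Sum>n. hk (n + N) z) \<le> C / root_time N ^ k" by (rule C)
    also have "\<dots> \<le> C / ?r ^ k"
      using C r N by (intro divide_left_mono power_mono root_time_ge_of_square mult_pos_pos zero_less_power) auto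
    finally have "g z \<le> (C + 2 * D) / ?r ^ k"
      using a unfolding green_split[of z N] by (simp add: add_divide_distrib)
    also have "\<dots> \<le> (C + 2 * D) / (bracket z / 2) ^ k"
      using r C D by (intro divide_left_mono power_mono mult_pos_pos zero_less_power) (auto simp: bracket_def)
    also have "\<dots> = (C + 2 * D) * 2 ^ k / bracket z ^ k" by (simp add: power_divide)
    finally show ?thesis .
  qed
  then show ?thesis using C D by (intro exI[of _ "(C + 2 * D) * 2 ^ k"]) auto
qed

text \<open>
  The order of \<open>|z|\<^sup>2\<close> times \<open>n\<close> between \<open>N\<close> and \<open>2 N\<close>, where \<open>N\<close> is a large multiple of \<open>|z|\<^sup>2\<close>,
  each contribute order \<open>|z|\<^sup>-\<^sup>d\<close> by \<open>hk_lower\<close>.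
\<close>

lemma green_lower: "\<exists>c>0. \<forall>z. c / bracket z ^ k \<le> g z"
proof -
  obtain c n0 where c: "c > 0" and lo: "\<And>n z. n \<ge> n0 \<Longrightarrow> znorm z \<le> c * root_time n \<Longrightarrow> c / root_time n ^ (k + 2) \<le> hk n z"
    using hk_lower unfolding root_time_def d_eq(1) by blast
  define K where "K = 1 / c ^ 2 + 1 + real n0"
  have K: "K > 0" using c by (simp add: K_def add_pos_nonneg)
  define c' where "c' = 1 / (c * sqrt (2 * K) ^ (k + 2))"
  have "c' / bracket z ^ k \<le> g z" for z
  proof -
    let ?J = "bracket z"
    define N where "N = nat \<lceil>(?J / c) ^ 2\<rceil> + n0"
    have J2: "1 \<le> ?J ^ 2" by simp
    have N: "(?J / c) ^ 2 \<le> real N" "real N \<le> (?J / c) ^ 2 + 1 + real n0"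
      using ceiling_bounds[of "(?J / c) ^ 2"] unfolding N_def of_nat_add by (smt (verit) zero_le_power2 of_nat_0_le_iff)+
    note N(2)
    also have "(?J / c) ^ 2 + 1 + real n0 \<le> (?J / c) ^ 2 + ?J ^ 2 * 1 + ?J ^ 2 * real n0"
      using J2 mult_right_mono[OF J2, of "real n0"] by (intro add_mono) auto
    also have "\<dots> = K * ?J ^ 2" by (simp add: K_def power_divide algebra_simps)
    finally have NK: "real N \<le> K * ?J ^ 2" .
    have "c' / ?J ^ k = (?J / c) ^ 2 * (c / (sqrt (2 * K) * ?J) ^ (k + 2))"
      using c bracket_pos[of z, THEN less_imp_neq] by (simp add: c'_def power_divide power_mult_distrib power_add power2_eq_square)
    also have "\<dots> \<le> real N * (c / (sqrt (2 * K) * ?J) ^ (k + 2))"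
      using N c K by (intro mult_right_mono) (auto intro!: divide_nonneg_nonneg simp: less_imp_le)
    also have "\<dots> = (\<Sum>n\<in>{N..<2 * N}. c / (sqrt (2 * K) * ?J) ^ (k + 2))" by simp
    also have "\<dots> \<le> (\<Sum>n\<in>{N..<2 * N}. hk n z)"
    proof (rule sum_mono)
      fix n assume n: "n \<in> {N..<2 * N}"
      have "?J / c \<le> root_time N" using N by (intro root_time_ge_of_square)
      also have "root_time N \<le> root_time n" using n by (intro root_time_mono) auto
      finally have "?J \<le> c * root_time n" using c by (simp add: field_simps)
      then have z: "znorm z \<le> c * root_time n" by (simp add: bracket_def)
      have "real (n + 1) \<le> real (2 * N)" using n by (simp only: of_nat_le_iff) auto
      also have "real (2 * N) \<le> 2 * K * ?J ^ 2" using NK by simp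
      finally have "root_time n \<le> sqrt (2 * K * ?J ^ 2)" unfolding root_time_def by (rule real_sqrt_le_mono)
      also have "\<dots> = sqrt (2 * K) * ?J" by (simp add: real_sqrt_mult less_imp_le)
      finally have "c / (sqrt (2 * K) * ?J) ^ (k + 2) \<le> c / root_time n ^ (k + 2)"
        using c K by (intro divide_left_mono power_mono mult_pos_pos zero_less_power) (auto simp: less_imp_le)
      also have "\<dots> \<le> hk n z" using n z by (intro lo) (auto simp: N_def)
      finally show "c / (sqrt (2 * K) * ?J) ^ (k + 2) \<le> hk n z" .
    qed
    also have "\<dots> \<le> (\<Sum>n<2 * N. hk n z)" by (rule sum_mono2) auto
    also have "\<dots> \<le> g z"
      unfolding green_def by (rule sum_le_suminf[OF hk_summable]) auto
    finally show ?thesis .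
  qed
  moreover have "c' > 0" using c K by (simp add: c'_def)
  ultimately show ?thesis by blast
qed

text \<open>
  The first \<open>\<eta> |z|\<^sup>2\<close> times contribute at most a constant times \<open>\<eta> |z|\<^sup>2\<^sup>-\<^sup>d\<close> by \<open>hk_off_diagonal\<close>, the later ones a
  constant depending on \<open>\<eta>\<close> times \<open>|z|\<^sup>1\<^sup>-\<^sup>d\<close> by \<open>hk_gradient\<close>. Choose \<open>\<eta>\<close> small, then \<open>|z|\<close> large.
\<close>

lemma green_difference:
  assumes "\<epsilon> > 0"
  shows "\<forall>\<^sub>F z in at_znorm_infinity. \<bar>g (z + e) - g z\<bar> \<le> \<epsilon> / bracket z ^ k"
proof -
  obtain D where D: "D > 0" "\<And>n z. z \<noteq> 0 \<Longrightarrow> hk n z \<le> D / znorm z ^ (k + 2)"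
    using hk_off_diagonal unfolding d_eq(1) by blast
  obtain E where E: "E > 0" "\<And>n z e. \<bar>hk n (z + e) - hk n z\<bar> \<le> E * znorm e / root_time n ^ (k + 3)"
    using hk_gradient unfolding d_eq(1) root_time_def by (auto simp: add.assoc numeral_3_eq_3)
  define A where "A = 2 ^ k * 2 * (2 ^ (k + 2) + 1) * D"
  have A: "A > 0" using D by (simp add: A_def add_pos_pos)
  define \<eta> where "\<eta> = \<epsilon> / (2 * A)"
  have eta: "\<eta> > 0" using A assms by (simp add: \<eta>_def)
  define B where "B = 2 ^ k * 2 * E * znorm e / sqrt \<eta> ^ (k + 1)"
  have B: "B \<ge> 0" using E eta by (simp add: B_def)
  define R where "R = 1 + 2 * znorm e + 1 / \<eta> + 2 * B / \<epsilon>"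
  have "\<bar>g (z + e) - g z\<bar> \<le> \<epsilon> / bracket z ^ k" if z: "znorm z \<ge> R" for z
  proof -
    let ?r = "znorm z"
    have parts: "0 \<le> znorm e" "0 \<le> 1 / \<eta>" "0 \<le> 2 * B / \<epsilon>" using eta B assms by auto
    then have r: "?r \<ge> 1" "?r \<ge> 1 / \<eta>" "?r \<ge> 2 * B / \<epsilon>" "znorm e \<le> ?r / 2"
      using z unfolding R_def by linarith+
    have "znorm z \<le> znorm (z + e) + znorm e" using znorm_triangle[of "z + e" "- e"] by simp
    then have ze: "?r / 2 \<le> znorm (z + e)" using r by linarith
    have z0: "z \<noteq> 0" "z + e \<noteq> 0" using r ze by auto
    define N where "N = nat \<lceil>\<eta> * ?r ^ 2\<rceil>"
    have N: "\<eta> * ?r ^ 2 \<le> real N" "real N \<le> \<eta> * ?r ^ 2 + 1"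
      using ceiling_bounds[of "\<eta> * ?r ^ 2"] eta by (auto simp: N_def)
    have "1 \<le> \<eta> * ?r" using r(2) eta by (simp add: field_simps)
    also have "\<dots> \<le> \<eta> * ?r ^ 2" using eta r by (intro mult_left_mono) (auto simp: power2_eq_square)
    finally have N2: "real N \<le> 2 * \<eta> * ?r ^ 2" using N by linarith
    have near: "(\<Sum>n<N. \<bar>hk n (z + e) - hk n z\<bar>) \<le> (2 * \<eta> * ?r ^ 2) * ((2 ^ (k + 2) + 1) * D / ?r ^ (k + 2))"
    proof -
      have "\<bar>hk n (z + e) - hk n z\<bar> \<le> (2 ^ (k + 2) + 1) * D / ?r ^ (k + 2)" for n
      proof -
        have "hk n (z + e) \<le> D / znorm (z + e) ^ (k + 2)" by (rule D(2)[OF z0(2)])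
        also have "\<dots> \<le> D / (?r / 2) ^ (k + 2)"
          using ze r D by (intro divide_left_mono power_mono mult_pos_pos zero_less_power) auto
        also have "\<dots> = 2 ^ (k + 2) * D / ?r ^ (k + 2)" by (simp add: power_divide)
        finally have "hk n (z + e) \<le> 2 ^ (k + 2) * D / ?r ^ (k + 2)" .
        moreover have "hk n z \<le> D / ?r ^ (k + 2)" by (rule D(2)[OF z0(1)])
        moreover have "0 \<le> hk n z" "0 \<le> hk n (z + e)" by auto
        ultimately have "\<bar>hk n (z + e) - hk n z\<bar> \<le> 2 ^ (k + 2) * D / ?r ^ (k + 2) + D / ?r ^ (k + 2)"
          by linarith
        then show ?thesis by (simp add: algebra_simps add_divide_distrib)
      qed
      then have "(\<Sum>n<N. \<bar>hk n (z + e) - hk n z\<bar>) \<le> (\<Sum>n<N. (2 ^ (k + 2) + 1) * D / ?r ^ (k + 2))"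
        by (intro sum_mono) auto
      also have "\<dots> = real N * ((2 ^ (k + 2) + 1) * D / ?r ^ (k + 2))" by simp
      also have "\<dots> \<le> (2 * \<eta> * ?r ^ 2) * ((2 ^ (k + 2) + 1) * D / ?r ^ (k + 2))"
        using N2 D r by (intro mult_right_mono) (auto intro!: divide_nonneg_nonneg mult_nonneg_nonneg)
      finally show ?thesis .
    qed
    have s3: "summable (\<lambda>n. 1 / root_time (n + N) ^ (k + 3))" "(\<Sum>n. 1 / root_time (n + N) ^ (k + 3)) \<le> 2 / root_time N ^ (k + 1)"
      using root_time_power_sums[of "k + 3" N] d_eq by auto
    have le3: "norm (hk (n + N) (z + e) - hk (n + N) z) \<le> E * znorm e * (1 / root_time (n + N) ^ (k + 3))" for n
      using E(2)[of "n + N" z e] by simp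
    have sumd: "summable (\<lambda>n. norm (hk (n + N) (z + e) - hk (n + N) z))"
      by (rule summable_comparison_test'[OF summable_mult[OF s3(1)], where N=0]) (use le3 in simp)
    have "\<bar>\<Sum>n. hk (n + N) (z + e) - hk (n + N) z\<bar> \<le> (\<Sum>n. norm (hk (n + N) (z + e) - hk (n + N) z))"
      using summable_norm[OF sumd] by simp
    also have "\<dots> \<le> (\<Sum>n. E * znorm e * (1 / root_time (n + N) ^ (k + 3)))"
      by (intro suminf_le le3 sumd summable_mult s3)
    also have "\<dots> = E * znorm e * (\<Sum>n. 1 / root_time (n + N) ^ (k + 3))" by (rule suminf_mult[OF s3(1)])
    also have "\<dots> \<le> E * znorm e * (2 / root_time N ^ (k + 1))" using s3(2) E by (intro mult_left_mono) auto
    also have "\<dots> \<le> E * znorm e * (2 / (sqrt \<eta> * ?r) ^ (k + 1))"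
    proof -
      have "sqrt \<eta> * ?r \<le> root_time N"
        using N eta by (intro root_time_ge_of_square) (simp add: power_mult_distrib)
      then show ?thesis using eta r E
        by (intro mult_left_mono divide_left_mono power_mono mult_pos_pos zero_less_power) auto
    qed
    finally have far: "\<bar>\<Sum>n. hk (n + N) (z + e) - hk (n + N) z\<bar> \<le> E * znorm e * (2 / (sqrt \<eta> * ?r) ^ (k + 1))" .
    have "g (z + e) - g z = (\<Sum>n. hk (n + N) (z + e) - hk (n + N) z) + (\<Sum>n<N. hk n (z + e) - hk n z)"
      unfolding green_split[of _ N] by (simp add: suminf_diff[OF hk_summable_shift hk_summable_shift, symmetric] sum_subtractf)
    then have "\<bar>g (z + e) - g z\<bar> \<le> \<bar>\<Sum>n. hk (n + N) (z + e) - hk (n + N) z\<bar> + (\<Sum>n<N. \<bar>hk n (z + e) - hk n z\<bar>)"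
      by (simp only:) (rule order_trans[OF abs_triangle_ineq add_left_mono[OF sum_abs]])
    also have "\<dots> \<le> E * znorm e * (2 / (sqrt \<eta> * ?r) ^ (k + 1)) + (2 * \<eta> * ?r ^ 2) * ((2 ^ (k + 2) + 1) * D / ?r ^ (k + 2))"
      by (rule add_mono[OF far near])
    also have "\<dots> = (B / ?r + A * \<eta>) / 2 ^ k / ?r ^ k"
    proof -
      have a: "E * znorm e * (2 / (sqrt \<eta> * ?r) ^ (k + 1)) = B / ?r / 2 ^ k / ?r ^ k"
        by (simp add: B_def power_mult_distrib mult_ac)
      have "?r ^ 2 / ?r ^ (k + 2) = 1 / ?r ^ k" using r by (simp add: power_add power2_eq_square)
      then have "(2 * \<eta> * ?r ^ 2) * ((2 ^ (k + 2) + 1) * D / ?r ^ (k + 2)) = 2 * \<eta> * ((2 ^ (k + 2) + 1) * D) * (1 / ?r ^ k)"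
      proof -
        assume *: "?r ^ 2 / ?r ^ (k + 2) = 1 / ?r ^ k"
        have "a * b * (c / d) = a * c * (b / d)" for a b c d :: real by simp
        from this[of "2 * \<eta>" "?r ^ 2" "(2 ^ (k + 2) + 1) * D" "?r ^ (k + 2)"] show ?thesis unfolding * .
      qed
      also have "\<dots> = A * \<eta> / 2 ^ k / ?r ^ k" by (simp add: A_def)
      finally show ?thesis using a by (simp add: add_divide_distrib)
    qed
    also have "\<dots> \<le> \<epsilon> / 2 ^ k / ?r ^ k"
    proof (intro divide_right_mono)
      have "B / ?r \<le> \<epsilon> / 2" using r(1,3) assms by (simp add: field_simps)
      moreover have "A * \<eta> = \<epsilon> / 2" using A by (simp add: \<eta>_def)
      ultimately show "B / ?r + A * \<eta> \<le> \<epsilon>" by linarith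
    qed (use r in auto)
    also have "\<dots> = \<epsilon> / (2 * ?r) ^ k" by (simp add: power_mult_distrib)
    also have "\<dots> \<le> \<epsilon> / bracket z ^ k"
      using r assms by (intro divide_left_mono power_mono mult_pos_pos zero_less_power) (auto simp: bracket_def)
    finally show ?thesis .
  qed
  then show ?thesis unfolding at_znorm_infinity_iff by blast
qed

lemma green_walk:
  "measure_pmf.expectation (walk q n) (\<lambda>y. g (z - y)) = (\<Sum>m. hk (n + m) z)"
proof -
  obtain C where C: "C > 0" "\<And>n z. hk n z \<le> C / root_time n ^ (k + 2)" using hk_upper_root_time by blast
  have s: "summable (\<lambda>n. C * (1 / root_time (n + 0) ^ (k + 2)))"
    using d_eq by (intro summable_mult root_time_power_sums) auto
  have I: "integrable (measure_pmf p) (\<lambda>y. hk m (z - y))" for m and p :: "(int^'d) pmf"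
    by (rule integrable_pmf_bounded[where B=1]) (auto simp: pmf_le_1)
  have "measure_pmf.expectation (walk q n) (\<lambda>y. \<Sum>m. hk m (z - y))
      = (\<Sum>m. measure_pmf.expectation (walk q n) (\<lambda>y. hk m (z - y)))"
  proof (rule integral_suminf[OF I])
    show "AE y in measure_pmf (walk q n). summable (\<lambda>m. norm (hk m (z - y)))"
      using hk_summable by simp
    show "summable (\<lambda>m. LINT y|measure_pmf (walk q n). norm (hk m (z - y)))"
    proof (rule summable_comparison_test'[OF s, where N=0])
      fix m
      have "(LINT y|measure_pmf (walk q n). norm (hk m (z - y))) \<le> C / root_time m ^ (k + 2)"
        by (rule measure_pmf.integral_le_const) (use I C in auto)
      then show "norm (LINT y|measure_pmf (walk q n). norm (hk m (z - y))) \<le> C * (1 / root_time (m + 0) ^ (k + 2))"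
        by simp
    qed
  qed
  then show ?thesis by (simp add: green_def pmf_walk_add)
qed

lemma green_step: "measure_pmf.expectation q (\<lambda>y. g (z - y)) = g z - (if z = 0 then 1 else 0)"
proof -
  have "walk q 1 = q"
    by (simp add: map_return_pmf bind_return_pmf')
  then have "measure_pmf.expectation q (\<lambda>y. g (z - y)) = (\<Sum>m. hk (1 + m) z)"
    using green_walk[of 1 z] by simp
  also have "\<dots> = g z - hk 0 z"
    using suminf_split_head[OF hk_summable[of z]] by (simp add: green_def)
  finally show ?thesis by (simp add: indicator_def)
qed

lemma green_bounded: "\<exists>C>0. \<forall>z. \<bar>g z\<bar> \<le> C"
proof -
  obtain C where C: "C > 0" "\<And>z. g z \<le> C / bracket z ^ k" using green_upper by blast
  have "g z \<le> C" for z
  proof -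
    have "C / bracket z ^ k \<le> C / 1" using C by (intro divide_left_mono one_le_power) auto
    with C(2)[of z] show ?thesis by simp
  qed
  with C(1) show ?thesis by (intro exI[of _ C]) auto
qed

text \<open>
  By \<open>green_lower\<close> it is enough to sum \<open>g(z) g(-z)\<close>. Expanding both factors, the sum over \<open>z\<close> of
  \<open>hk n z \<cdot> hk m (-z)\<close> is the return probability \<open>hk (n + m) 0\<close>, and its double series converges since
  \<open>d > 4\<close>.
\<close>

lemma bracket_summable: "integrable (count_space UNIV) (\<lambda>z :: int^'d. 1 / bracket z ^ (2 * k))"
proof -
  obtain C where C: "C > 0" "\<And>N z. (\<Sum>n. hk (n + N) z) \<le> C / root_time N ^ k" using hk_tail_sum by blast
  obtain c where c: "c > 0" "\<And>z. c / bracket z ^ k \<le> g z" using green_lower by blast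
  have "(\<integral>\<^sup>+ z. ennreal (g z) * ennreal (g (- z)) \<partial>count_space UNIV)
      = (\<integral>\<^sup>+ z. (\<Sum>n. ennreal (hk n z) * ennreal (g (- z))) \<partial>count_space UNIV)"
    unfolding green_def by (subst suminf_ennreal2[symmetric]) (auto simp: hk_summable)
  also have "\<dots> = (\<Sum>n. \<integral>\<^sup>+ z. ennreal (hk n z) * ennreal (g (- z)) \<partial>count_space UNIV)"
    by (rule nn_integral_suminf) simp
  also have "\<dots> = (\<Sum>n. \<integral>\<^sup>+ z. ennreal (g (0 - z)) \<partial>measure_pmf (walk q n))"
    by (simp add: nn_integral_measure_pmf)
  also have "\<dots> = (\<Sum>n. ennreal (\<Sum>m. hk (n + m) 0))"
  proof (intro suminf_cong)
    fix n
    obtain B where B: "\<And>z. \<bar>g z\<bar> \<le> B" using green_bounded by blast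
    have "(\<integral>\<^sup>+ z. ennreal (g (0 - z)) \<partial>measure_pmf (walk q n)) = ennreal (measure_pmf.expectation (walk q n) (\<lambda>z. g (0 - z)))"
      by (rule nn_integral_eq_integral) (use B in \<open>auto intro!: integrable_pmf_bounded[where B=B]\<close>)
    then show "(\<integral>\<^sup>+ z. ennreal (g (0 - z)) \<partial>measure_pmf (walk q n)) = ennreal (\<Sum>m. hk (n + m) 0)"
      by (simp only: green_walk)
  qed
  also have "\<dots> \<le> (\<Sum>n. ennreal (C * (1 / root_time n ^ 3)))"
  proof (intro suminf_le summableI ennreal_leI)
    fix n
    have "(\<Sum>m. hk (n + m) 0) \<le> C / root_time n ^ k" using C(2)[where N=n and z=0] by (simp add: add.commute)
    also have "\<dots> \<le> C / root_time n ^ 3"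
      using C d_eq by (intro divide_left_mono power_increasing mult_pos_pos zero_less_power) auto
    finally show "(\<Sum>m. hk (n + m) 0) \<le> C * (1 / root_time n ^ 3)" by simp
  qed
  also have "\<dots> = ennreal (\<Sum>n. C * (1 / root_time n ^ 3))"
    using C by (intro suminf_ennreal2 summable_mult root_time_cube_summable) (auto simp: less_imp_le)
  also have "\<dots> < \<infinity>" by simp
  finally have fin: "(\<integral>\<^sup>+ z. ennreal (g z) * ennreal (g (- z)) \<partial>count_space UNIV) < \<infinity>" .
  have "integrable (count_space UNIV) (\<lambda>z. g z * g (- z))"
    using fin by (intro integrableI_bounded) (auto simp: ennreal_mult abs_mult)
  then have I: "integrable (count_space UNIV) (\<lambda>z. 1 / c ^ 2 * (g z * g (- z)))" by simp
  show ?thesis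
  proof (rule Bochner_Integration.integrable_bound[OF I])
    have "1 / bracket z ^ (2 * k) \<le> 1 / c ^ 2 * (g z * g (- z))" for z
    proof -
      have "c / bracket z ^ k * (c / bracket (- z) ^ k) \<le> g z * g (- z)"
        using c(1) by (intro mult_mono c(2)) (auto simp: less_imp_le)
      then have "c ^ 2 * (1 / bracket z ^ (2 * k)) \<le> g z * g (- z)"
        by (simp add: power2_eq_square mult_2 power_add)
      then show ?thesis using c by (simp add: field_simps)
    qed
    then show "AE z in count_space UNIV. norm (1 / bracket z ^ (2 * k)) \<le> norm (1 / c ^ 2 * (g z * g (- z)))"
      by (intro AE_I2) (simp add: less_imp_le abs_mult)
  qed simp
qed

end

section \<open>Potentials of rapidly decaying charges\<close>

text \<open>
  Sums over the lattice are Bochner integrals against counting measure, which makes dominated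
  convergence and Fubini available.
\<close>

abbreviation lsum :: "('a \<Rightarrow> real) \<Rightarrow> real" where
  "lsum f \<equiv> integral\<^sup>L (count_space UNIV) f"

abbreviation lsummable :: "('a \<Rightarrow> real) \<Rightarrow> bool" where
  "lsummable f \<equiv> integrable (count_space UNIV) f"

lemma lsummable_translate:
  fixes f :: "'a::ab_group_add \<Rightarrow> real"
  shows "lsummable f \<Longrightarrow> lsummable (\<lambda>y. f (y - x))" and "lsum (\<lambda>y. f (y - x)) = lsum f"
proof -
  have bij: "bij_betw (\<lambda>y. y - x) UNIV UNIV"
    by (rule bij_betwI[where g="\<lambda>y. y + x"]) auto
  show "lsummable f \<Longrightarrow> lsummable (\<lambda>y. f (y - x))"
    using integrable_bij_count_space[OF bij, of f] by simp
  show "lsum (\<lambda>y. f (y - x)) = lsum f"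
    using integral_bij_count_space[OF bij, of f] by simp
qed

lemma lsummable_bound:
  fixes f h :: "'a \<Rightarrow> real"
  assumes "lsummable h" "\<And>y. \<bar>f y\<bar> \<le> h y"
  shows "lsummable f"
proof (rule Bochner_Integration.integrable_bound[OF assms(1)])
  have "norm (f y) \<le> norm (h y)" for y using assms(2)[of y] by simp
  then show "AE y in count_space UNIV. norm (f y) \<le> norm (h y)" by simp
qed simp

lemma lsum_single: "lsum (\<lambda>y. if y = x then f y else 0) = f x"
proof -
  have "lsum (\<lambda>y. if y = x then f y else 0) = (\<Sum>a | a \<in> UNIV \<and> (if a = x then f a else 0) \<noteq> 0. if a = x then f a else 0)"
    by (rule lebesgue_integral_count_space_finite_support) (auto intro: finite_subset[of _ "{x}"])
  also have "\<dots> = (\<Sum>a\<in>{x}. if a = x then f a else 0)"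
    by (rule sum.mono_neutral_left) auto
  finally show ?thesis by simp
qed


context lattice_step
begin

definition decay :: "int^'d \<Rightarrow> real" where
  "decay y = 1 / bracket y ^ (2 * k)"

definition pot :: "(int^'d \<Rightarrow> real) \<Rightarrow> int^'d \<Rightarrow> real" where
  "pot F x = lsum (\<lambda>y. g (y - x) * F y)"

lemma decay_pos [simp]: "0 < decay y" by (simp add: decay_def)

lemma decay_nonneg [simp]: "0 \<le> decay y" by (simp add: less_imp_le)

lemma decay_summable: "lsummable decay"
  using bracket_summable by (simp add: decay_def[abs_def])

lemma decay_eq: "decay y = (1 / bracket y ^ k) ^ 2"
  by (simp add: decay_def power_divide power_mult[symmetric] mult.commute)

lemma indicator_summable:
  assumes "lsummable f" shows "lsummable (\<lambda>y. indicator T y * f y)"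
  using integrable_mult_indicator[OF _ assms, of T] by simp

text \<open>
  With \<open>a = \<langle>y\<rangle>\<^sup>-\<^sup>k\<close> and \<open>b = \<langle>y - x\<rangle>\<^sup>-\<^sup>k\<close>, where \<open>\<langle>\<cdot>\<rangle>\<close> denotes \<open>bracket\<close>, the triangle inequality gives
  \<open>\<langle>x\<rangle>\<^sup>k b a\<^sup>2 \<le> 2\<^sup>k (a b + a\<^sup>2)\<close>, and \<open>a b \<le> a\<^sup>2 / \<eta> + \<eta> b\<^sup>2\<close>. Only the term \<open>\<eta> b\<^sup>2\<close> ignores the
  restriction to \<open>T\<close>, so the sum is small when the mass of \<open>T\<close> is.
\<close>

lemma convolution_estimate:
  "\<exists>C>0. \<forall>T \<eta> x. \<eta> > 0 \<longrightarrow> lsummable (\<lambda>y. indicator T y * (g (y - x) * decay y)) \<and>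
     lsum (\<lambda>y. indicator T y * (g (y - x) * decay y))
     \<le> C * ((1 + 1 / \<eta>) * lsum (\<lambda>y. indicator T y * decay y) + \<eta>) / bracket x ^ k"
proof -
  obtain C where C: "C > 0" "\<And>z. g z \<le> C / bracket z ^ k" using green_upper by blast
  define S where "S = lsum decay"
  have S0: "S \<ge> 0" by (simp add: S_def)
  define C' where "C' = C * 2 ^ k * (1 + S)"
  have C': "C' > 0" using C S0 by (simp add: C'_def)
  have "lsummable (\<lambda>y. indicator T y * (g (y - x) * decay y)) \<and>
     lsum (\<lambda>y. indicator T y * (g (y - x) * decay y))
     \<le> C' * ((1 + 1 / \<eta>) * lsum (\<lambda>y. indicator T y * decay y) + \<eta>) / bracket x ^ k"
    if eta: "\<eta> > 0" for T x and \<eta> :: real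
  proof -
    let ?h = "\<lambda>y. C * 2 ^ k / bracket x ^ k * ((1 + 1 / \<eta>) * (indicator T y * decay y) + \<eta> * decay (y - x))"
    have IT: "lsummable (\<lambda>y. indicator T y * decay y)" by (rule indicator_summable[OF decay_summable])
    have hS: "lsummable ?h" using IT lsummable_translate(1)[OF decay_summable] by auto
    have point: "indicator T y * (g (y - x) * decay y) \<le> ?h y" for y
    proof (cases "y \<in> T")
      case True
      let ?A = "bracket y" and ?B = "bracket (y - x)" and ?X = "bracket x"
      define a where "a = 1 / ?A ^ k"
      define b where "b = 1 / ?B ^ k"
      have ab: "a > 0" "b > 0" by (auto simp: a_def b_def)
      have "?X ^ k \<le> (2 * max ?A ?B) ^ k"
        using bracket_triangle[of x y] by (intro power_mono) (auto simp: less_imp_le)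
      also have "\<dots> = 2 ^ k * max ?A ?B ^ k" by (simp add: power_mult_distrib)
      also have "max ?A ?B ^ k \<le> ?A ^ k + ?B ^ k"
        by (cases "?A \<le> ?B") (auto simp: max_def less_imp_le)
      finally have X: "?X ^ k \<le> 2 ^ k * (?A ^ k + ?B ^ k)" by simp
      have "g (y - x) * decay y \<le> C * b * a ^ 2"
        using C(2)[of "y - x"] C(1) by (intro mult_mono) (auto simp: decay_eq a_def b_def less_imp_le)
      also have "\<dots> = C / ?X ^ k * (?X ^ k * b * a ^ 2)" by simp
      also have "\<dots> \<le> C / ?X ^ k * (2 ^ k * (?A ^ k + ?B ^ k) * b * a ^ 2)"
        using X C ab by (intro mult_left_mono mult_right_mono) (auto simp: less_imp_le)
      also have "2 ^ k * (?A ^ k + ?B ^ k) * b * a ^ 2 = 2 ^ k * (a * b + a ^ 2)"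
      proof -
        have 1: "?A ^ k * a = 1" "?B ^ k * b = 1" by (auto simp: a_def b_def)
        have "(?A ^ k + ?B ^ k) * b * a ^ 2 = (?A ^ k * a) * (a * b) + (?B ^ k * b) * a ^ 2"
          by (simp add: power2_eq_square algebra_simps)
        also have "\<dots> = a * b + a ^ 2" unfolding 1 by simp
        finally show ?thesis by (simp only: mult.assoc)
      qed
      also have "a * b \<le> 1 / \<eta> * a ^ 2 + \<eta> * b ^ 2"
      proof -
        have "0 \<le> (a - \<eta> * b) ^ 2" by simp
        then have "2 * \<eta> * (a * b) \<le> a ^ 2 + \<eta> ^ 2 * b ^ 2"
          by (simp add: power2_diff power_mult_distrib algebra_simps)
        moreover have "0 \<le> \<eta> * (a * b)" using eta ab by simp
        ultimately have "\<eta> * (a * b) \<le> a ^ 2 + \<eta> ^ 2 * b ^ 2" by linarith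
        then have "1 / \<eta> * (\<eta> * (a * b)) \<le> 1 / \<eta> * (a ^ 2 + \<eta> ^ 2 * b ^ 2)"
          using eta by (intro mult_left_mono) auto
        then show ?thesis using eta by (simp add: algebra_simps power2_eq_square)
      qed
      finally have "g (y - x) * decay y \<le> C / ?X ^ k * (2 ^ k * (1 / \<eta> * a ^ 2 + \<eta> * b ^ 2 + a ^ 2))"
        using C by (simp add: mult_left_mono divide_right_mono)
      also have "\<dots> = ?h y" using True by (simp add: decay_eq a_def b_def algebra_simps)
      finally show ?thesis using True by simp
    next
      case False
      then show ?thesis using C eta by simp
    qed
    have s: "lsummable (\<lambda>y. indicator T y * (g (y - x) * decay y))"
      by (rule lsummable_bound[OF hS]) (use point in simp)
    have "lsum (\<lambda>y. indicator T y * (g (y - x) * decay y)) \<le> lsum ?h"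
      by (rule integral_mono[OF s hS point])
    also have "\<dots> = C * 2 ^ k / bracket x ^ k * ((1 + 1 / \<eta>) * lsum (\<lambda>y. indicator T y * decay y) + \<eta> * S)"
      using IT lsummable_translate(1)[OF decay_summable, of x]
      by (simp add: lsummable_translate(2)[of decay] S_def)
    also have "\<dots> \<le> C * 2 ^ k / bracket x ^ k * ((1 + S) * ((1 + 1 / \<eta>) * lsum (\<lambda>y. indicator T y * decay y) + \<eta>))"
    proof (rule mult_left_mono)
      have "0 \<le> (1 + 1 / \<eta>) * lsum (\<lambda>y. indicator T y * decay y)" using eta by simp
      then have "1 * ((1 + 1 / \<eta>) * lsum (\<lambda>y. indicator T y * decay y)) \<le> (1 + S) * ((1 + 1 / \<eta>) * lsum (\<lambda>y. indicator T y * decay y))"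
        using S0 by (intro mult_right_mono) auto
      moreover have "\<eta> * S \<le> (1 + S) * \<eta>" using eta by (simp add: algebra_simps)
      ultimately show "(1 + 1 / \<eta>) * lsum (\<lambda>y. indicator T y * decay y) + \<eta> * S
          \<le> (1 + S) * ((1 + 1 / \<eta>) * lsum (\<lambda>y. indicator T y * decay y) + \<eta>)"
        unfolding distrib_left[of "1 + S"] by linarith
    qed (use C in simp)
    also have "\<dots> = C' * ((1 + 1 / \<eta>) * lsum (\<lambda>y. indicator T y * decay y) + \<eta>) / bracket x ^ k"
      by (simp add: C'_def)
    finally show ?thesis using s by simp
  qed
  then show ?thesis using C' by blast
qed

lemma decay_tail: "(\<lambda>n. lsum (\<lambda>y. indicator {y. znorm y > real n} y * decay y)) \<longlonglongrightarrow> 0"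
proof -
  have "(\<lambda>n. lsum (\<lambda>y. indicator {y. znorm y > real n} y * decay y)) \<longlonglongrightarrow> lsum (\<lambda>y::int^'d. 0)"
  proof (rule integral_dominated_convergence[where w=decay])
    show "AE y in count_space UNIV. (\<lambda>n. indicator {y. znorm y > real n} y * decay y) \<longlonglongrightarrow> 0"
    proof (rule AE_I2)
      fix y :: "int^'d"
      obtain N :: nat where "znorm y \<le> real N" using real_arch_simple by blast
      then have "\<forall>\<^sub>F n in sequentially. indicator {y. znorm y > real n} y * decay y = 0"
        by (intro eventually_sequentiallyI[of N]) (auto split: split_indicator)
      then show "(\<lambda>n. indicator {y. znorm y > real n} y * decay y) \<longlonglongrightarrow> 0" by (rule tendsto_eventually)
    qed
    show "AE y in count_space UNIV. norm (indicator {y. znorm y > real n} y * decay y) \<le> decay y" for n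
      by (intro AE_I2) (auto split: split_indicator)
  qed (auto intro: decay_summable)
  then show ?thesis by simp
qed

lemma convolution_tail:
  assumes "\<epsilon> > 0"
  shows "\<exists>R. lsum (\<lambda>y. indicator {y. znorm y > R} y * decay y) \<le> \<epsilon> \<and>
    (\<forall>x. lsum (\<lambda>y. indicator {y. znorm y > R} y * (g (y - x) * decay y)) \<le> \<epsilon> / bracket x ^ k)"
proof -
  obtain C where C: "C > 0" and conv: "\<And>T \<eta> x. \<eta> > 0 \<Longrightarrow>
     lsum (\<lambda>y. indicator T y * (g (y - x) * decay y))
     \<le> C * ((1 + 1 / \<eta>) * lsum (\<lambda>y. indicator T y * decay y) + \<eta>) / bracket x ^ k"
    using convolution_estimate by blast
  define \<eta> where "\<eta> = \<epsilon> / (2 * C)"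
  have eta: "\<eta> > 0" using assms C by (simp add: \<eta>_def)
  define \<delta> where "\<delta> = min \<epsilon> (\<epsilon> / (2 * C) / (1 + 1 / \<eta>))"
  have pe: "1 + 1 / \<eta> > 0" using eta by (simp add: add_pos_pos)
  have delta: "\<delta> > 0" using assms C pe by (simp add: \<delta>_def)
  from order_tendstoD(2)[OF decay_tail delta] obtain n :: nat
    where n: "lsum (\<lambda>y. indicator {y. znorm y > real n} y * decay y) < \<delta>"
    by (auto simp: eventually_sequentially)
  let ?t = "lsum (\<lambda>y. indicator {y. znorm y > real n} y * decay y)"
  have "?t * (1 + 1 / \<eta>) \<le> \<epsilon> / (2 * C)"
    using n pe by (simp add: \<delta>_def pos_le_divide_eq[symmetric])
  then have "C * ((1 + 1 / \<eta>) * ?t + \<eta>) \<le> C * (\<epsilon> / (2 * C) + \<epsilon> / (2 * C))"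
    using C by (intro mult_left_mono add_mono) (auto simp: \<eta>_def mult.commute)
  also have "\<dots> = \<epsilon>" using C by simp
  finally have e: "C * ((1 + 1 / \<eta>) * ?t + \<eta>) \<le> \<epsilon>" .
  have "lsum (\<lambda>y. indicator {y. znorm y > real n} y * (g (y - x) * decay y)) \<le> \<epsilon> / bracket x ^ k" for x
  proof -
    have "C * ((1 + 1 / \<eta>) * ?t + \<eta>) / bracket x ^ k \<le> \<epsilon> / bracket x ^ k" by (rule divide_right_mono[OF e]) simp
    with conv[OF eta, of "{y. znorm y > real n}" x] show ?thesis by (rule order_trans)
  qed
  moreover have "?t \<le> \<epsilon>" using n by (simp add: \<delta>_def)
  ultimately show ?thesis by blast
qed

lemma pot_summable:
  assumes "\<And>y. \<bar>F y\<bar> \<le> M * decay y"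
  shows "lsummable F" "lsummable (\<lambda>y. g (y - x) * F y)"
proof -
  obtain B where B: "\<And>z. \<bar>g z\<bar> \<le> B" using green_bounded by blast
  show "lsummable F"
    by (rule lsummable_bound[where h="\<lambda>y. M * decay y"]) (use decay_summable assms in auto)
  show "lsummable (\<lambda>y. g (y - x) * F y)"
  proof (rule lsummable_bound[where h="\<lambda>y. B * (M * decay y)"])
    show "lsummable (\<lambda>y. B * (M * decay y))" using decay_summable by auto
    fix y show "\<bar>g (y - x) * F y\<bar> \<le> B * (M * decay y)"
      unfolding abs_mult by (intro mult_mono B assms order_trans[OF abs_ge_zero B]) auto
  qed
qed

lemma pot_bound:
  assumes F: "\<And>y. \<bar>F y\<bar> \<le> M * decay y"
  shows "\<exists>M'>0. \<forall>x. \<bar>pot F x\<bar> \<le> M' / bracket x ^ k"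
proof -
  obtain C where C: "C > 0" and conv: "\<And>T \<eta> x. \<eta> > 0 \<Longrightarrow> lsummable (\<lambda>y. indicator T y * (g (y - x) * decay y)) \<and>
     lsum (\<lambda>y. indicator T y * (g (y - x) * decay y))
     \<le> C * ((1 + 1 / \<eta>) * lsum (\<lambda>y. indicator T y * decay y) + \<eta>) / bracket x ^ k"
    using convolution_estimate by blast
  define M0 where "M0 = max M 0 + 1"
  have M0: "M0 > 0" "M \<le> M0" by (auto simp: M0_def)
  define M' where "M' = M0 * (C * (2 * lsum decay + 1))"
  have "\<bar>pot F x\<bar> \<le> M' / bracket x ^ k" for x
  proof -
    have cv: "lsummable (\<lambda>y. g (y - x) * decay y)" "lsum (\<lambda>y. g (y - x) * decay y) \<le> C * (2 * lsum decay + 1) / bracket x ^ k"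
      using conv[of 1 UNIV x] by auto
    have "\<bar>pot F x\<bar> \<le> lsum (\<lambda>y. M0 * (g (y - x) * decay y))"
      unfolding pot_def real_norm_def[symmetric]
    proof (rule integral_norm_le_AE)
      show "lsummable (\<lambda>y. g (y - x) * F y)" by (rule pot_summable[OF F])
      show "lsummable (\<lambda>y. M0 * (g (y - x) * decay y))" using cv by simp
      have "\<bar>g (y - x) * F y\<bar> \<le> M0 * (g (y - x) * decay y)" for y
      proof -
        have "\<bar>F y\<bar> \<le> M0 * decay y" by (rule order_trans[OF F]) (intro mult_right_mono M0, simp)
        then have "g (y - x) * \<bar>F y\<bar> \<le> g (y - x) * (M0 * decay y)" by (intro mult_left_mono) auto
        then show ?thesis by (simp add: abs_mult mult_ac)
      qed
      then show "AE y in count_space UNIV. norm (g (y - x) * F y) \<le> M0 * (g (y - x) * decay y)" by simp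
    qed
    also have "\<dots> = M0 * lsum (\<lambda>y. g (y - x) * decay y)" by simp
    also have "\<dots> \<le> M0 * (C * (2 * lsum decay + 1) / bracket x ^ k)" using M0 cv by (intro mult_left_mono) auto
    finally show ?thesis by (simp add: M'_def)
  qed
  moreover have "M' > 0"
  proof -
    have "0 \<le> lsum decay" by simp
    then have "2 * lsum decay + 1 > 0" by linarith
    then show ?thesis using M0 C by (simp add: M'_def)
  qed
  ultimately show ?thesis by blast
qed

lemma eventually_reflect:
  "eventually Q at_znorm_infinity \<Longrightarrow> eventually (\<lambda>x. Q (- x)) at_znorm_infinity"
  unfolding at_znorm_infinity_iff by (metis znorm_uminus)

text \<open>
  Far charges are negligible by \<open>convolution_tail\<close>, uniformly in \<open>x\<close>; for the finitely many near
  charges \<open>g(y - x)\<close> may be replaced by \<open>g(-x)\<close> by \<open>green_difference\<close>.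
\<close>

lemma pot_asymptotic:
  assumes F: "\<And>y. \<bar>F y\<bar> \<le> M * decay y" and \<epsilon>: "\<epsilon> > 0"
  shows "\<forall>\<^sub>F x in at_znorm_infinity. \<bar>pot F x - g (- x) * lsum F\<bar> \<le> \<epsilon> / bracket x ^ k"
proof -
  obtain C where C: "C > 0" "\<And>z. g z \<le> C / bracket z ^ k" using green_upper by blast
  obtain C2 where conv: "\<And>T \<eta> x. \<eta> > 0 \<Longrightarrow> lsummable (\<lambda>y. indicator T y * (g (y - x) * decay y)) \<and>
     lsum (\<lambda>y. indicator T y * (g (y - x) * decay y))
     \<le> C2 * ((1 + 1 / \<eta>) * lsum (\<lambda>y. indicator T y * decay y) + \<eta>) / bracket x ^ k"
    using convolution_estimate by blast
  define M0 where "M0 = max M 0 + 1"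
  have M0: "M0 > 0" "M \<le> M0" by (auto simp: M0_def)
  have F0: "\<bar>F y\<bar> \<le> M0 * decay y" for y by (rule order_trans[OF F]) (intro mult_right_mono M0, simp)
  define S where "S = lsum decay"
  have S0: "S \<ge> 0" by (simp add: S_def)
  define \<epsilon>1 where "\<epsilon>1 = \<epsilon> / (3 * M0 * (1 + C))"
  have e1: "\<epsilon>1 > 0" using \<epsilon> M0 C by (simp add: \<epsilon>1_def)
  obtain R where R: "lsum (\<lambda>y. indicator {y. znorm y > R} y * decay y) \<le> \<epsilon>1"
    "\<And>x. lsum (\<lambda>y. indicator {y. znorm y > R} y * (g (y - x) * decay y)) \<le> \<epsilon>1 / bracket x ^ k"
    using convolution_tail[OF e1] by blast
  define \<delta> where "\<delta> = \<epsilon> / (3 * M0 * (1 + S))"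
  have delta: "\<delta> > 0" using \<epsilon> M0 S0 by (simp add: \<delta>_def)
  have "\<forall>\<^sub>F x in at_znorm_infinity. \<forall>y\<in>{y. znorm y \<le> R}. \<bar>g (- x + y) - g (- x)\<bar> \<le> \<delta> / bracket (- x) ^ k"
    by (rule eventually_reflect, rule eventually_ball_finite[OF finite_znorm_ball])
       (use green_difference[OF delta] in blast)
  then show ?thesis
  proof eventually_elim
    case (elim x)
    let ?I = "\<lambda>y. indicator {y. znorm y > R} y :: real"
    let ?X = "bracket x ^ k"
    have s1: "lsummable (\<lambda>y. ?I y * (g (y - x) * decay y))" using conv[OF zero_less_one] by blast
    have s2: "lsummable (\<lambda>y. ?I y * decay y)" by (rule indicator_summable[OF decay_summable])
    have sF: "lsummable (\<lambda>y. g (y - x) * F y)" "lsummable F" by (rule pot_summable[OF F])+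
    have "pot F x - g (- x) * lsum F = lsum (\<lambda>y. g (y - x) * F y - g (- x) * F y)"
      unfolding pot_def using sF by simp
    also have "\<bar>\<dots>\<bar> \<le> lsum (\<lambda>y. M0 * (\<delta> / ?X * decay y + (?I y * (g (y - x) * decay y) + g (- x) * (?I y * decay y))))"
      unfolding real_norm_def[symmetric]
    proof (rule integral_norm_le_AE)
      show "lsummable (\<lambda>y. g (y - x) * F y - g (- x) * F y)" using sF by simp
      show "lsummable (\<lambda>y. M0 * (\<delta> / ?X * decay y + (?I y * (g (y - x) * decay y) + g (- x) * (?I y * decay y))))"
        using s1 s2 decay_summable by (intro Bochner_Integration.integrable_mult_right Bochner_Integration.integrable_add)
      have "\<bar>g (y - x) * F y - g (- x) * F y\<bar> \<le> M0 * (\<delta> / ?X * decay y + (?I y * (g (y - x) * decay y) + g (- x) * (?I y * decay y)))" for y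
      proof -
        have "\<bar>g (y - x) - g (- x)\<bar> \<le> \<delta> / ?X + (?I y * g (y - x) + ?I y * g (- x))"
        proof (cases "znorm y \<le> R")
          case True
          then have "\<bar>g (- x + y) - g (- x)\<bar> \<le> \<delta> / bracket (- x) ^ k" using elim by blast
          then show ?thesis using True by (simp add: algebra_simps)
        next
          case False
          have "\<bar>g (y - x) - g (- x)\<bar> \<le> g (y - x) + g (- x)"
            using green_nonneg[of "y - x"] green_nonneg[of "- x"] by linarith
          moreover have "0 \<le> \<delta> / ?X" using delta by simp
          ultimately show ?thesis using False by simp
        qed
        then have "\<bar>g (y - x) - g (- x)\<bar> * \<bar>F y\<bar> \<le> (\<delta> / ?X + (?I y * g (y - x) + ?I y * g (- x))) * (M0 * decay y)"
          using F0[of y] delta by (intro mult_mono) (auto intro!: add_nonneg_nonneg mult_nonneg_nonneg)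
        also have "\<dots> = M0 * (\<delta> / ?X * decay y + (?I y * (g (y - x) * decay y) + g (- x) * (?I y * decay y)))"
          by (simp add: algebra_simps)
        finally show ?thesis by (simp add: left_diff_distrib[symmetric] abs_mult)
      qed
      then show "AE y in count_space UNIV. norm (g (y - x) * F y - g (- x) * F y)
          \<le> M0 * (\<delta> / ?X * decay y + (?I y * (g (y - x) * decay y) + g (- x) * (?I y * decay y)))" by simp
    qed
    also have "\<dots> = M0 * (\<delta> / ?X * S + (lsum (\<lambda>y. ?I y * (g (y - x) * decay y)) + g (- x) * lsum (\<lambda>y. ?I y * decay y)))"
      using s1 s2 decay_summable by (simp add: S_def)
    also have "\<dots> \<le> M0 * (\<delta> / ?X * S + (\<epsilon>1 / ?X + C / ?X * \<epsilon>1))"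
    proof (intro mult_left_mono add_mono order_refl mult_mono)
      show "g (- x) \<le> C / ?X" using C(2)[of "- x"] by simp
      show "lsum (\<lambda>y. ?I y * (g (y - x) * decay y)) \<le> \<epsilon>1 / ?X" by (rule R)
      show "lsum (\<lambda>y. ?I y * decay y) \<le> \<epsilon>1" by (rule R)
    qed (use M0 C delta in auto)
    also have "\<dots> = (M0 * \<delta> * S + M0 * \<epsilon>1 * (1 + C)) / ?X"
      by (simp add: algebra_simps add_divide_distrib)
    also have "\<dots> \<le> \<epsilon> / ?X"
    proof (rule divide_right_mono)
      have "M0 * \<delta> * S \<le> M0 * \<delta> * (1 + S)" using M0 delta by (intro mult_left_mono) auto
      also have "\<dots> = \<epsilon> / 3"
      proof -
        have "a * (e / (3 * a * b)) * b = e / 3" if "a \<noteq> 0" "b \<noteq> 0" for a b e :: real using that by simp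
        from this[of M0 "1 + S" \<epsilon>] show ?thesis using M0 S0 unfolding \<delta>_def by linarith
      qed
      finally have "M0 * \<delta> * S \<le> \<epsilon> / 3" .
      moreover have "M0 * \<epsilon>1 * (1 + C) = \<epsilon> / 3"
      proof -
        have "a * (e / (3 * a * b)) * b = e / 3" if "a \<noteq> 0" "b \<noteq> 0" for a b e :: real using that by simp
        from this[of M0 "1 + C" \<epsilon>] show ?thesis using M0 C unfolding \<epsilon>1_def by linarith
      qed
      ultimately show "M0 * \<delta> * S + M0 * \<epsilon>1 * (1 + C) \<le> \<epsilon>" using \<epsilon> by linarith
    qed simp
    finally show ?case .
  qed
qed

text \<open>
  The Poisson equation \<open>(1 - Q) G F = F\<close>.
\<close>

lemma pot_step:
  assumes F: "\<And>y. \<bar>F y\<bar> \<le> M * decay y"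
  shows "avg q (pot F) x = pot F x - F x"
proof -
  obtain B where B: "\<And>z. \<bar>g z\<bar> \<le> B" using green_bounded by blast
  have B0: "B \<ge> 0" by (rule order_trans[OF abs_ge_zero B])
  interpret c: sigma_finite_measure "count_space (UNIV :: (int^'d) set)"
    by (rule sigma_finite_measure_count_space)
  interpret pc: pair_sigma_finite "measure_pmf q" "count_space (UNIV :: (int^'d) set)" ..
  let ?f = "\<lambda>w y. g ((y - x) - w) * F y"
  have sF: "lsummable (\<lambda>y. ?f w y)" for w
    using pot_summable(2)[where F=F and x="x + w", OF F] by (simp add: algebra_simps)
  have lsn: "\<bar>lsum (\<lambda>y. norm (?f w y))\<bar> \<le> lsum (\<lambda>y. B * (M * decay y))" for w
  proof -
    have "lsum (\<lambda>y. norm (?f w y)) \<le> lsum (\<lambda>y. B * (M * decay y))"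
    proof (rule integral_mono)
      show "lsummable (\<lambda>y. norm (?f w y))" using sF by (rule integrable_norm)
      show "lsummable (\<lambda>y. B * (M * decay y))" using decay_summable by auto
      fix y show "norm (?f w y) \<le> B * (M * decay y)"
        unfolding real_norm_def abs_mult by (intro mult_mono B F B0) auto
    qed
    moreover have "0 \<le> lsum (\<lambda>y. norm (?f w y))" by (rule Bochner_Integration.integral_nonneg) simp
    ultimately show ?thesis by simp
  qed
  have meas: "case_prod ?f \<in> borel_measurable (measure_pmf q \<Otimes>\<^sub>M count_space UNIV)"
  proof -
    have "sets (measure_pmf q \<Otimes>\<^sub>M count_space (UNIV :: (int^'d) set))
      = sets (count_space UNIV \<Otimes>\<^sub>M count_space (UNIV :: (int^'d) set))"
      by (rule sets_pair_measure_cong) auto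
    also have "\<dots> = UNIV"
      by (subst pair_measure_countable) auto
    finally have "sets (measure_pmf q \<Otimes>\<^sub>M count_space (UNIV :: (int^'d) set)) = UNIV" .
    then show ?thesis by (auto simp: measurable_def)
  qed
  have Int: "integrable (measure_pmf q \<Otimes>\<^sub>M count_space UNIV) (case_prod ?f)"
  proof (rule pc.Fubini_integrable[OF meas])
    show "integrable (measure_pmf q) (\<lambda>w. \<integral>y. norm (case_prod ?f (w, y)) \<partial>count_space UNIV)"
      using lsn by (intro integrable_pmf_bounded[where B="lsum (\<lambda>y. B * (M * decay y))"]) simp
    show "AE w in measure_pmf q. lsummable (\<lambda>y. case_prod ?f (w, y))" using sF by simp
  qed
  have "avg q (pot F) x = measure_pmf.expectation q (\<lambda>w. lsum (\<lambda>y. ?f w y))"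
    by (simp add: avg_def pot_def algebra_simps)
  also have "\<dots> = lsum (\<lambda>y. measure_pmf.expectation q (\<lambda>w. ?f w y))"
    by (rule pc.Fubini_integral[OF Int, symmetric])
  also have "\<dots> = lsum (\<lambda>y. g (y - x) * F y - (if y = x then F y else 0))"
    by (rule Bochner_Integration.integral_cong) (auto simp: green_step left_diff_distrib)
  also have "\<dots> = pot F x - F x"
  proof -
    have "lsummable (\<lambda>y. if y = x then F y else 0)"
      by (rule lsummable_bound[where h="\<lambda>y. M * decay y"]) (use decay_summable F order_trans[OF abs_ge_zero F] in auto)
    then show ?thesis
      using pot_summable(2)[where F=F and x=x, OF F] by (simp add: pot_def lsum_single)
  qed
  finally show ?thesis .
qed

text \<open>
  Iterating, \<open>D\<close> is its own average after \<open>n\<close> steps. As \<open>|D|\<close> is at most a multiple of the Green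
  function, this average is bounded by a tail of the Green series.
\<close>

lemma harmonic_decaying_zero:
  assumes D: "\<And>x. \<bar>D x\<bar> \<le> M / bracket x ^ k" and harm: "\<And>x. avg q D x = D x"
  shows "D x = 0"
proof -
  have M0: "M \<ge> 0" using order_trans[OF abs_ge_zero D[of 0]] by (simp add: bracket_def)
  have DM: "\<bar>D x\<bar> \<le> M" for x
  proof -
    have "M / bracket x ^ k \<le> M / 1" using M0 by (intro divide_left_mono one_le_power) auto
    with D[of x] show ?thesis by simp
  qed
  obtain c where c: "c > 0" "\<And>z. c / bracket z ^ k \<le> g z" using green_lower by blast
  obtain C where C: "C > 0" "\<And>N z. (\<Sum>n. hk (n + N) z) \<le> C / root_time N ^ k" using hk_tail_sum by blast
  obtain B where B: "\<And>z. \<bar>g z\<bar> \<le> B" using green_bounded by blast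
  have it: "avg (walk q n) D x = D x" for n x
  proof (induction n arbitrary: x)
    case (Suc n)
    then have "avg (walk q n) D = D" by auto
    then show ?case by (simp add: avg_walk_Suc[OF DM] harm del: walk.simps)
  qed (simp add: avg_def)
  have "\<bar>D x\<bar> \<le> M / c * (C / root_time n ^ k)" for n
  proof -
    have "\<bar>D x\<bar> = \<bar>measure_pmf.expectation (walk q n) (\<lambda>y. D (x + y))\<bar>"
      using it[of n x] by (simp add: avg_def)
    also have "\<dots> \<le> measure_pmf.expectation (walk q n) (\<lambda>y. M / c * g (- x - y))"
      unfolding real_norm_def[symmetric]
    proof (rule integral_norm_le_AE)
      show "integrable (measure_pmf (walk q n)) (\<lambda>y. D (x + y))" by (rule integrable_shift_bounded[OF DM])
      show "integrable (measure_pmf (walk q n)) (\<lambda>y. M / c * g (- x - y))"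
        by (intro Bochner_Integration.integrable_mult_right integrable_pmf_bounded[where B=B]) (use B in simp)
      have "\<bar>D (x + y)\<bar> \<le> M / c * g (- x - y)" for y
      proof -
        have e: "- (x + y) = - x - y" by simp
        have "c / bracket (x + y) ^ k \<le> g (- x - y)"
          using c(2)[of "- (x + y)"] unfolding bracket_uminus unfolding e .
        then have "M / c * (c / bracket (x + y) ^ k) \<le> M / c * g (- x - y)"
          using M0 c by (intro mult_left_mono) auto
        then show ?thesis using D[of "x + y"] c by simp
      qed
      then show "AE y in measure_pmf (walk q n). norm (D (x + y)) \<le> M / c * g (- x - y)" by simp
    qed
    also have "\<dots> = M / c * (\<Sum>m. hk (n + m) (- x))" by (simp add: green_walk)
    also have "\<dots> \<le> M / c * (C / root_time n ^ k)"
      using C(2)[where N=n and z="- x"] M0 c by (intro mult_left_mono) (auto simp: add.commute)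
    finally show ?thesis .
  qed
  moreover have "(\<lambda>n. M / c * (C / root_time n ^ k)) \<longlonglongrightarrow> M / c * 0"
  proof (intro tendsto_mult tendsto_const)
    have "filterlim root_time at_top sequentially"
      unfolding root_time_def
      by (intro filterlim_compose[OF sqrt_at_top] filterlim_compose[OF filterlim_real_sequentially])
         (simp add: filterlim_Suc)
    then have "filterlim (\<lambda>n. root_time n ^ k) at_top sequentially"
      using d_eq by (intro filterlim_pow_at_top) auto
    then show "(\<lambda>n. C / root_time n ^ k) \<longlonglongrightarrow> 0"
      by (intro tendsto_divide_0[OF tendsto_const] filterlim_at_top_imp_at_infinity)
  qed
  ultimately have "\<bar>D x\<bar> \<le> 0"
    by (intro LIMSEQ_le_const[of "\<lambda>n. M / c * (C / root_time n ^ k)"]) auto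
  then show ?thesis by simp
qed

end

section \<open>Asymptotics of solutions of the discrete semilinear equation\<close>

text \<open>
  Shifting the argument by a fixed vector changes the bracket by at most a constant factor.
\<close>

lemma bracket_submult: "bracket x \<le> bracket (a - x) * bracket a"
proof -
  have "bracket x \<le> 1 + (znorm (a - x) + znorm a)"
    using znorm_triangle_diff[of x a] by (simp add: bracket_def)
  also have "\<dots> \<le> bracket (a - x) * bracket a" by (simp add: bracket_def algebra_simps)
  finally show ?thesis .
qed

context lattice_step
begin

lemma bracket_shift: "1 / bracket (a - x) ^ k \<le> bracket a ^ k / bracket x ^ k" "1 / (bracket a ^ k * bracket x ^ k) \<le> 1 / bracket (a - x) ^ k"
proof -
  have "bracket x ^ k \<le> (bracket (a - x) * bracket a) ^ k" by (intro power_mono bracket_submult) simp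
  then show "1 / bracket (a - x) ^ k \<le> bracket a ^ k / bracket x ^ k"
    by (simp add: power_mult_distrib field_simps)
  have "bracket (a - x) ^ k \<le> (bracket a * bracket x) ^ k"
  proof (intro power_mono)
    have "bracket (a - x) \<le> bracket (x - (- (a - x))) * bracket x" by (metis add.commute diff_minus_eq_add bracket_submult bracket_uminus minus_diff_eq)
    also have "x - (- (a - x)) = a" by simp
    finally show "bracket (a - x) \<le> bracket a * bracket x" .
  qed simp
  then show "1 / (bracket a ^ k * bracket x ^ k) \<le> 1 / bracket (a - x) ^ k"
    by (intro divide_left_mono) (auto simp: power_mult_distrib)
qed

lemma avg_g: "avg q (\<lambda>x. g (a - x)) x = g (a - x) - (if x = a then 1 else 0)"
  using green_step[of "a - x"] by (auto simp: avg_def diff_diff_eq)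

text \<open>
  The analytic core, for a function \<open>p\<close> that is one on \<open>K\<close> and satisfies \<open>p = \<psi> (P p)\<close> elsewhere, where
  \<open>u - C u\<^sup>2 \<le> \<psi> u \<le> u\<close>. The bound by a multiple of the Green function is assumed; it singles out the
  solution that vanishes at infinity, as the constant one may solve the same equation.
\<close>

lemma hitting_asymptotic:
  fixes p :: "int^'d \<Rightarrow> real" and \<psi> :: "real \<Rightarrow> real" and C :: real
  assumes K: "finite K" "K \<noteq> {}"
    and p01: "\<And>x. 0 \<le> p x" "\<And>x. p x \<le> 1"
    and pK: "\<And>x. x \<in> K \<Longrightarrow> p x = 1"
    and pout: "\<And>x. x \<notin> K \<Longrightarrow> p x = \<psi> (avg \<theta> p x)"
    and psi: "\<And>u v. 0 \<le> u \<Longrightarrow> u \<le> v \<Longrightarrow> v \<le> 1 \<Longrightarrow> \<psi> u \<le> \<psi> v"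
      "\<And>u. 0 \<le> u \<Longrightarrow> u \<le> 1 \<Longrightarrow> \<psi> u \<le> u"
      "\<And>u. 0 \<le> u \<Longrightarrow> u \<le> 1 \<Longrightarrow> u - C * u\<^sup>2 \<le> \<psi> u"
    and C: "C > 0"
    and pV: "\<And>x. p x \<le> (\<Sum>a\<in>K. g (a - x)) / 2"
  shows "\<exists>cap c. cap > 0 \<and> c > 0 \<and> (\<forall>x. c / bracket x ^ k \<le> p x) \<and>
    (\<forall>\<epsilon>>0. \<forall>\<^sub>F x in at_znorm_infinity. \<bar>p x - g (- x) * cap\<bar> \<le> \<epsilon> / bracket x ^ k)"
proof -
  obtain Cg where Cg: "Cg > 0" "\<And>z. g z \<le> Cg / bracket z ^ k" using green_upper by blast
  obtain cg where cg: "cg > 0" "\<And>z. cg / bracket z ^ k \<le> g z" using green_lower by blast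
  obtain B where B: "B > 0" "\<And>z. \<bar>g z\<bar> \<le> B" using green_bounded by blast
  have pabs: "\<bar>p x\<bar> \<le> 1" for x using p01[of x] by simp
  define V where "V x = (\<Sum>a\<in>K. g (a - x)) / 2" for x
  have V0: "V x \<ge> 0" for x by (simp add: V_def sum_nonneg)
  define M1 where "M1 = 1 + (\<Sum>a\<in>K. Cg * bracket a ^ k) / 2"
  have M1: "M1 > 0" using Cg by (simp add: M1_def add_pos_nonneg sum_nonneg)
  have gle: "g (a - x) \<le> Cg * bracket a ^ k / bracket x ^ k" for a x
  proof -
    have "g (a - x) \<le> Cg * (1 / bracket (a - x) ^ k)" using Cg(2) by simp
    also have "\<dots> \<le> Cg * (bracket a ^ k / bracket x ^ k)" using Cg(1) by (intro mult_left_mono bracket_shift) auto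
    finally show ?thesis by simp
  qed
  have VM: "V x \<le> M1 / bracket x ^ k" for x
  proof -
    have "V x \<le> (\<Sum>a\<in>K. Cg * bracket a ^ k / bracket x ^ k) / 2"
      unfolding V_def by (intro divide_right_mono sum_mono gle) simp
    also have "\<dots> = ((\<Sum>a\<in>K. Cg * bracket a ^ k) / 2) / bracket x ^ k"
      by (simp add: sum_divide_distrib[symmetric])
    also have "\<dots> \<le> M1 / bracket x ^ k" by (intro divide_right_mono) (auto simp: M1_def)
    finally show ?thesis .
  qed
  have Vbd: "\<bar>V x\<bar> \<le> real (card K) * B" for x
  proof -
    have "V x \<le> (\<Sum>a\<in>K. g (a - x))" unfolding V_def by (simp add: sum_nonneg)
    also have "\<dots> \<le> real (card K) * B"
      using B(2) by (intro sum_bounded_above) (auto intro: order_trans[OF abs_ge_self])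
    finally show ?thesis using V0[of x] by simp
  qed
  have avgV: "avg q V x \<le> V x" for x
  proof -
    have I: "integrable (measure_pmf q) (\<lambda>y. g (a - (x + y)))" for a
      by (rule integrable_pmf_bounded[where B=B]) (use B in simp)
    have "avg q V x = (\<Sum>a\<in>K. avg q (\<lambda>x. g (a - x)) x) / 2"
      unfolding avg_def V_def using I by simp
    also have "\<dots> \<le> V x" unfolding V_def avg_g
      by (intro divide_right_mono sum_mono) auto
    finally show ?thesis .
  qed
  define u where "u = avg \<theta> p"
  have u01: "0 \<le> u x" "u x \<le> 1" for x
  proof -
    show "0 \<le> u x" unfolding u_def avg_def by (intro Bochner_Integration.integral_nonneg p01)
    show "u x \<le> 1" using avg_bound[of p 1 \<theta> x] pabs unfolding u_def by (simp add: abs_le_iff)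
  qed
  have aq: "avg q p x = (u x + p x) / 2" for x
    unfolding u_def by (rule avg_lazy[OF pabs])
  have uM: "u x \<le> 2 * M1 / bracket x ^ k" for x
  proof -
    have "avg q p x \<le> avg q V x" by (rule avg_mono[OF pabs Vbd]) (use pV in \<open>simp only: V_def\<close>)
    also have "\<dots> \<le> M1 / bracket x ^ k" by (rule order_trans[OF avgV VM])
    finally have "(u x + p x) / 2 \<le> M1 / bracket x ^ k" unfolding aq .
    moreover have "a \<le> 2 * c" if "(a + b) / 2 \<le> c" "0 \<le> b" for a b c :: real using that by (simp add: field_simps)
    ultimately have "u x \<le> 2 * (M1 / bracket x ^ k)" using p01(1)[of x] by blast
    then show ?thesis by simp
  qed
  \<comment> \<open>The charge of \<open>p\<close> for the lazy walk. Off \<open>K\<close> it equals \<open>(\<psi> u - u) / 2\<close>, which is quadratic in \<open>u\<close>.\<close>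
  define F where "F x = p x - avg q p x" for x
  define M where "M = 2 * C * M1\<^sup>2 + (\<Sum>a\<in>K. bracket a ^ (2 * k))"
  have FM: "\<bar>F x\<bar> \<le> M * decay x" for x
  proof (cases "x \<in> K")
    case True
    have "\<bar>F x\<bar> \<le> 1" using True u01[of x] pK by (simp add: F_def aq)
    also have "1 = bracket x ^ (2 * k) * decay x" by (simp add: decay_def)
    also have "\<dots> \<le> M * decay x"
    proof (rule mult_right_mono)
      have "bracket x ^ (2 * k) \<le> (\<Sum>a\<in>K. bracket a ^ (2 * k))" using True K by (intro member_le_sum) auto
      also have "\<dots> \<le> M" using C by (simp add: M_def)
      finally show "bracket x ^ (2 * k) \<le> M" .
    qed simp
    finally show ?thesis .
  next
    case False
    have "F x = (p x - u x) / 2" unfolding F_def aq by (simp add: field_simps)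
    then have "F x = (\<psi> (u x) - u x) / 2" using pout[OF False] by (simp add: u_def)
    moreover have "\<psi> (u x) \<le> u x" "u x - C * (u x)\<^sup>2 \<le> \<psi> (u x)" using psi u01 by auto
    ultimately have "\<bar>F x\<bar> \<le> C * (u x)\<^sup>2 / 2" by simp
    also have "\<dots> \<le> C * (2 * M1 / bracket x ^ k)\<^sup>2 / 2"
      using C uM u01 by (intro divide_right_mono mult_left_mono power_mono) auto
    also have "\<dots> = 2 * C * M1\<^sup>2 * decay x" by (simp add: decay_eq power_divide power_mult_distrib)
    also have "\<dots> \<le> M * decay x" by (intro mult_right_mono) (auto simp: M_def sum_nonneg)
    finally show ?thesis .
  qed
  obtain M' where M': "M' > 0" "\<And>x. \<bar>pot F x\<bar> \<le> M' / bracket x ^ k" using pot_bound[OF FM] by blast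
  have potbd: "\<bar>pot F x\<bar> \<le> M'" for x
  proof -
    have "M' / bracket x ^ k \<le> M' / 1" using M' by (intro divide_left_mono one_le_power) auto
    with M'(2)[of x] show ?thesis by simp
  qed
  have p_pot: "p x = pot F x" for x
  proof -
    let ?D = "\<lambda>x. p x + (-1) * pot F x"
    have "?D x = 0"
    proof (rule harmonic_decaying_zero[where M="M1 + M'"])
      fix x
      have "p x \<le> M1 / bracket x ^ k" using order_trans[OF pV[of x, folded V_def] VM] .
      then show "\<bar>?D x\<bar> \<le> (M1 + M') / bracket x ^ k"
        using M'(2)[of x] p01[of x] unfolding add_divide_distrib by linarith
      have "avg q ?D x = avg q p x + avg q (\<lambda>x. (-1) * pot F x) x"
        by (rule avg_add[OF pabs, where B'=M']) (use potbd in simp)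
      also have "\<dots> = ?D x" unfolding avg_cmult using pot_step[OF FM, of x] F_def[of x] by linarith
      finally show "avg q ?D x = ?D x" .
    qed
    then show ?thesis by simp
  qed
  have asy: "\<forall>\<^sub>F x in at_znorm_infinity. \<bar>p x - g (- x) * lsum F\<bar> \<le> \<epsilon> / bracket x ^ k" if "\<epsilon> > 0" for \<epsilon>
    unfolding p_pot by (rule pot_asymptotic[OF FM that])
  \<comment> \<open>Lower bound. With \<open>G2 = g\<^sup>2\<close> and \<open>T\<close> its potential, the functions \<open>w n\<close> increase to
    \<open>c g - 2 C c\<^sup>2 T\<close> and stay below \<open>p\<close>: one step of the lazy walk replaces \<open>w n\<close> by
    \<open>w (n + 1)\<close>, and the loss \<open>C (P w)\<^sup>2 \<le> 4 C c\<^sup>2 g\<^sup>2\<close> in the equation for \<open>p\<close> is compensated by the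
    charge of \<open>T\<close>. Starting from \<open>w 0 \<le> 0\<close> avoids any appeal to a maximum principle.\<close>
  obtain a where a: "a \<in> K" using K by blast
  define G2 where "G2 x = (g (a - x))\<^sup>2" for x
  have G2M: "\<bar>G2 x\<bar> \<le> (Cg * bracket a ^ k)\<^sup>2 * decay x" for x
  proof -
    have "G2 x \<le> (Cg * bracket a ^ k / bracket x ^ k)\<^sup>2" unfolding G2_def by (intro power_mono gle) simp
    then show ?thesis by (simp add: G2_def decay_eq power_divide power_mult_distrib)
  qed
  define T where "T = pot G2"
  obtain M3 where M3: "M3 > 0" "\<And>x. \<bar>T x\<bar> \<le> M3 / bracket x ^ k" using pot_bound[OF G2M] unfolding T_def by blast
  have Tbd: "\<bar>T x\<bar> \<le> M3" for x
  proof -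
    have "M3 / bracket x ^ k \<le> M3 / 1" using M3 by (intro divide_left_mono one_le_power) auto
    with M3(2)[of x] show ?thesis by simp
  qed
  have T0: "T x \<ge> 0" for x unfolding T_def pot_def by (intro Bochner_Integration.integral_nonneg) (simp add: G2_def)
  have Tstep: "avg q T x = T x - G2 x" for x unfolding T_def by (rule pot_step[OF G2M])
  define J where "J = bracket a ^ k"
  have J: "J > 0" by (simp add: J_def)
  \<comment> \<open>The first bound keeps \<open>w n \<le> 1\<close> on \<open>K\<close>, the second makes \<open>2 C c\<^sup>2 T\<close> at most half of the lower bound for \<open>c g\<close>.\<close>
  define c where "c = min (1 / B) (cg / (4 * C * M3 * J))"
  have c: "c > 0" "c * B \<le> 1" "c * (4 * C * M3 * J) \<le> cg"
  proof -
    show "c > 0" using B cg C M3 J by (simp add: c_def)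
    have "c \<le> 1 / B" by (simp add: c_def)
    then show "c * B \<le> 1" using B by (simp add: pos_le_divide_eq)
    have "c \<le> cg / (4 * C * M3 * J)" by (simp add: c_def)
    then show "c * (4 * C * M3 * J) \<le> cg" using C M3 J by (subst (asm) pos_le_divide_eq) auto
  qed
  define h where "h n x = (\<Sum>m<n. hk m (a - x))" for n x
  have h_le: "0 \<le> h n x" "h n x \<le> g (a - x)" for n x
    unfolding h_def green_def by (auto intro: sum_nonneg sum_le_suminf[OF hk_summable])
  have hB: "\<bar>h n x\<bar> \<le> B" for n x using h_le[of n x] B(2)[of "a - x"] by linarith
  have hstep: "h (Suc n) x = avg q (h n) x + (if x = a then 1 else 0)" for n x
  proof -
    have I: "integrable (measure_pmf q) (\<lambda>y. hk m (a - (x + y)))" for m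
      by (rule integrable_pmf_bounded[where B=1]) (auto simp: pmf_le_1)
    have "avg q (h n) x = (\<Sum>m<n. hk (Suc m) (a - x))"
      unfolding avg_def h_def pmf_walk_Suc using I by (simp add: diff_diff_eq)
    then show ?thesis
      unfolding h_def by (subst sum.lessThan_Suc_shift) (auto simp: indicator_def)
  qed
  define w where "w n x = c * h n x + (- (2 * C * c\<^sup>2)) * T x" for n x
  have wB: "\<bar>w n x\<bar> \<le> c * B + 2 * C * c\<^sup>2 * M3" for n x
  proof -
    have "\<bar>w n x\<bar> \<le> \<bar>c * h n x\<bar> + \<bar>(- (2 * C * c\<^sup>2)) * T x\<bar>" unfolding w_def by (rule abs_triangle_ineq)
    also have "\<dots> \<le> c * B + 2 * C * c\<^sup>2 * M3"
      unfolding abs_mult using c C by (intro add_mono mult_mono hB Tbd) auto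
    finally show ?thesis .
  qed
  have wh: "w n x \<le> c * h n x" for n x using T0[of x] C by (simp add: w_def)
  have wstep: "w (Suc n) x = avg q (w n) x + c * (if x = a then 1 else 0) - 2 * C * c\<^sup>2 * G2 x" for n x
  proof -
    have b1: "\<bar>c * h n y\<bar> \<le> c * B" for y unfolding abs_mult using c hB[of n y] by (intro mult_mono) auto
    have b2: "\<bar>(- (2 * C * c\<^sup>2)) * T y\<bar> \<le> 2 * C * c\<^sup>2 * M3" for y
      unfolding abs_mult using C Tbd[of y] by (intro mult_mono) auto
    have "avg q (w n) x = c * avg q (h n) x + (- (2 * C * c\<^sup>2)) * avg q T x"
      unfolding w_def[abs_def] by (subst avg_add[OF b1 b2]) (simp only: avg_cmult)
    then show ?thesis by (simp add: w_def hstep Tstep algebra_simps)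
  qed
  have wp: "w n x \<le> p x" for n x
  proof (induction n arbitrary: x)
    case 0
    have "w 0 x \<le> 0" using T0[of x] C by (simp add: w_def h_def)
    with p01(1)[of x] show ?case by linarith
  next
    case (Suc n)
    show ?case
    proof (cases "x \<in> K")
      case True
      have "w (Suc n) x \<le> c * h (Suc n) x" by (rule wh)
      also have "\<dots> \<le> c * B" using c hB[of "Suc n" x] by (intro mult_left_mono) auto
      finally show ?thesis using c(2) pK[OF True] by linarith
    next
      case False
      define v where "v = avg \<theta> (w n) x"
      have vu: "v \<le> u x" unfolding v_def u_def by (rule avg_mono[OF wB pabs Suc])
      have visit_prob: "v - 4 * C * c\<^sup>2 * G2 x \<le> p x"
      proof (cases "v \<le> 0")
        case True
        have "0 \<le> 4 * C * c\<^sup>2 * G2 x" using C by (simp add: G2_def)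
        with True p01(1)[of x] show ?thesis by linarith
      next
        case v: False
        have ga: "\<bar>c * g (a - y)\<bar> \<le> c * B" for y unfolding abs_mult using c B by (intro mult_mono) auto
        have "v \<le> avg \<theta> (\<lambda>y. c * g (a - y)) x" unfolding v_def
        proof (rule avg_mono[OF wB ga])
          fix y
          have "c * h n y \<le> c * g (a - y)" using c h_le(2)[of n y] by (intro mult_left_mono) auto
          with wh[of n y] show "w n y \<le> c * g (a - y)" by linarith
        qed
        also have "\<dots> = c * avg \<theta> (\<lambda>y. g (a - y)) x" by (rule avg_cmult)
        also have "\<dots> \<le> c * (2 * g (a - x))"
        proof (rule mult_left_mono)
          have "avg q (\<lambda>y. g (a - y)) x = (avg \<theta> (\<lambda>y. g (a - y)) x + g (a - x)) / 2"
            by (rule avg_lazy) (rule B)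
          moreover have "avg q (\<lambda>y. g (a - y)) x \<le> g (a - x)" unfolding avg_g by simp
          ultimately have "(avg \<theta> (\<lambda>y. g (a - y)) x + g (a - x)) / 2 \<le> g (a - x)" by (simp only:)
          then have "avg \<theta> (\<lambda>y. g (a - y)) x \<le> g (a - x)" by (simp add: field_simps)
          with green_nonneg[of "a - x"] show "avg \<theta> (\<lambda>y. g (a - y)) x \<le> 2 * g (a - x)" by linarith
        qed (use c in simp)
        finally have "v\<^sup>2 \<le> (c * (2 * g (a - x)))\<^sup>2" using v by (intro power_mono) auto
        also have "\<dots> = 4 * c\<^sup>2 * G2 x" by (simp add: G2_def power_mult_distrib)
        finally have "C * v\<^sup>2 \<le> C * (4 * c\<^sup>2 * G2 x)" using C by (intro mult_left_mono) auto
        then have "v - 4 * C * c\<^sup>2 * G2 x \<le> v - C * v\<^sup>2" by simp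
        also have "\<dots> \<le> \<psi> v" using v vu u01(2)[of x] by (intro psi(3)) auto
        also have "\<dots> \<le> \<psi> (u x)" using v vu u01(2)[of x] by (intro psi(1)) auto
        also have "\<dots> = p x" using pout[OF False] by (simp add: u_def)
        finally show ?thesis .
      qed
      have "avg q (w n) x = (v + w n x) / 2" unfolding v_def by (rule avg_lazy[OF wB])
      moreover have "x \<noteq> a" using False a by auto
      ultimately have "w (Suc n) x = ((v - 4 * C * c\<^sup>2 * G2 x) + w n x) / 2" by (simp add: wstep)
      moreover have "(\<alpha> + \<beta>) / 2 \<le> \<gamma>" if "\<alpha> \<le> \<gamma>" "\<beta> \<le> \<gamma>" for \<alpha> \<beta> \<gamma> :: real
        using that by (simp add: field_simps)
      ultimately show ?thesis using visit_prob Suc[of x] by simp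
    qed
  qed
  define c' where "c' = c * cg / (2 * J)"
  have c': "c' > 0" using c cg J by (simp add: c'_def)
  have lower: "c' / bracket x ^ k \<le> p x" for x
  proof -
    have "(\<lambda>n. w n x) \<longlonglongrightarrow> c * g (a - x) + (- (2 * C * c\<^sup>2)) * T x"
      unfolding w_def h_def green_def
      by (intro tendsto_add tendsto_mult tendsto_const summable_LIMSEQ hk_summable)
    then have "c * g (a - x) + (- (2 * C * c\<^sup>2)) * T x \<le> p x"
      by (rule LIMSEQ_le_const2) (use wp in auto)
    moreover have "c * (cg * (1 / (J * bracket x ^ k))) \<le> c * g (a - x)"
    proof (rule mult_left_mono)
      have "cg * (1 / (J * bracket x ^ k)) \<le> cg * (1 / bracket (a - x) ^ k)"
        using cg bracket_shift(2)[of a x] by (intro mult_left_mono) (auto simp: J_def)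
      also have "\<dots> \<le> g (a - x)" using cg(2)[of "a - x"] by simp
      finally show "cg * (1 / (J * bracket x ^ k)) \<le> g (a - x)" .
    qed (use c in simp)
    moreover have "2 * C * c\<^sup>2 * T x \<le> c * cg / (2 * J) / bracket x ^ k"
    proof -
      have "2 * C * c\<^sup>2 * T x \<le> 2 * C * c\<^sup>2 * (M3 / bracket x ^ k)"
        using C M3(2)[of x] by (intro mult_left_mono) auto
      also have "\<dots> = c * (c * (4 * C * M3 * J)) / (2 * J) / bracket x ^ k"
        using J by (simp add: power2_eq_square)
      also have "\<dots> \<le> c * cg / (2 * J) / bracket x ^ k"
        using c J by (intro divide_right_mono mult_left_mono) auto
      finally show ?thesis .
    qed
    moreover have "c * (cg * (1 / (J * bracket x ^ k))) = c * cg / (2 * J) / bracket x ^ k + c' / bracket x ^ k"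
      using J by (simp add: c'_def field_simps)
    moreover have "\<delta> \<le> \<pi>" if "\<alpha> + (- \<beta>) * \<tau> \<le> \<pi>" "\<gamma> \<le> \<alpha>" "\<beta> * \<tau> \<le> \<epsilon>" "\<gamma> = \<epsilon> + \<delta>"
      for \<alpha> \<beta> \<gamma> \<delta> \<epsilon> \<tau> \<pi> :: real using that by simp
    ultimately show ?thesis by blast
  qed
  have cap: "lsum F > 0"
  proof (rule ccontr)
    assume "\<not> lsum F > 0"
    then have le: "g (- x) * lsum F \<le> 0" for x by (simp add: mult_nonneg_nonpos)
    have "\<exists>x. \<bar>p x - g (- x) * lsum F\<bar> \<le> (c' / 2) / bracket x ^ k"
      using asy[of "c' / 2"] c' at_znorm_infinity_neq_bot eventually_happens by auto
    then obtain x where "\<bar>p x - g (- x) * lsum F\<bar> \<le> (c' / 2) / bracket x ^ k" by blast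
    with le[of x] lower[of x] have "c' / bracket x ^ k \<le> (c' / 2) / bracket x ^ k" by linarith
    then have "c' / bracket x ^ k * bracket x ^ k \<le> (c' / 2) / bracket x ^ k * bracket x ^ k"
      by (rule mult_right_mono) simp
    then have "c' \<le> c' / 2" by simp
    then show False using c' by simp
  qed
  from cap c' lower asy show ?thesis by blast
qed

end

section \<open>The branching property\<close>

text \<open>
  A family indexed by words consists of a root value and one family per child of the root.
\<close>

definition graft :: "'a \<Rightarrow> (nat \<Rightarrow> nat list \<Rightarrow> 'a) \<Rightarrow> nat list \<Rightarrow> 'a" where
  "graft m \<omega> v = (case v of [] \<Rightarrow> m | i # w \<Rightarrow> \<omega> i w)"

definition subfamily :: "nat \<Rightarrow> (nat list \<Rightarrow> 'a) \<Rightarrow> nat list \<Rightarrow> 'a" where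
  "subfamily i \<omega> w = \<omega> (i # w)"

definition iid :: "'a pmf \<Rightarrow> (nat list \<Rightarrow> 'a) measure" where
  "iid p = (\<Pi>\<^sub>M v\<in>UNIV. measure_pmf p)"

definition iid_seq :: "'a pmf \<Rightarrow> (nat \<Rightarrow> nat list \<Rightarrow> 'a) measure" where
  "iid_seq p = (\<Pi>\<^sub>M i\<in>UNIV. iid p)"

lemma graft_simps [simp]: "graft m \<omega> [] = m" "graft m \<omega> (i # w) = \<omega> i w" "subfamily i (graft m \<omega>) = \<omega> i"
  by (simp_all add: graft_def subfamily_def fun_eq_iff)

lemma prob_space_iid: "prob_space (iid p)"
  unfolding iid_def by (rule prob_space_PiM) (rule measure_pmf.prob_space_axioms)

lemma prob_space_iid_seq: "prob_space (iid_seq p)"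
  unfolding iid_seq_def by (rule prob_space_PiM) (rule prob_space_iid)

lemma space_iid [simp]: "space (iid p) = UNIV"
  by (simp add: iid_def space_PiM PiE_UNIV_domain)

lemma space_iid_seq [simp]: "space (iid_seq p) = UNIV"
  by (simp add: iid_seq_def space_PiM PiE_UNIV_domain)

lemma measurable_iid_coordinate [measurable]: "(\<lambda>\<omega>. \<omega> v) \<in> iid p \<rightarrow>\<^sub>M measure_pmf p"
  unfolding iid_def by (rule measurable_component_singleton) simp

lemma measurable_iid_coordinate_count: "(\<lambda>\<omega>. \<omega> v) \<in> iid p \<rightarrow>\<^sub>M count_space UNIV"
  using measurable_iid_coordinate[of v p] by (simp cong: measurable_cong_sets)

lemma measurable_iid_seq_coordinate [measurable]: "(\<lambda>\<omega>. \<omega> i) \<in> iid_seq p \<rightarrow>\<^sub>M iid p"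
  unfolding iid_seq_def by (rule measurable_component_singleton) simp

lemma measurable_into_iid:
  assumes "\<And>v. (\<lambda>x. f x v) \<in> N \<rightarrow>\<^sub>M measure_pmf p"
  shows "f \<in> N \<rightarrow>\<^sub>M iid p"
proof -
  have "(\<lambda>x v. f x v) \<in> N \<rightarrow>\<^sub>M iid p"
    unfolding iid_def by (rule measurable_PiM_single') (use assms in \<open>auto simp: PiE_UNIV_domain\<close>)
  then show ?thesis by simp
qed

lemma measurable_subfamily [measurable]: "subfamily i \<in> iid p \<rightarrow>\<^sub>M iid p"
  by (rule measurable_into_iid) (unfold subfamily_def, rule measurable_iid_coordinate)

lemma measurable_graft: "(\<lambda>(m, \<omega>). graft m \<omega>) \<in> measure_pmf p \<Otimes>\<^sub>M iid_seq p \<rightarrow>\<^sub>M iid p"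
proof (rule measurable_into_iid)
  fix v :: "nat list"
  show "(\<lambda>x. (case x of (m, \<omega>) \<Rightarrow> graft m \<omega>) v) \<in> measure_pmf p \<Otimes>\<^sub>M iid_seq p \<rightarrow>\<^sub>M measure_pmf p"
  proof (cases v)
    case Nil
    then show ?thesis by (simp add: case_prod_beta')
  next
    case (Cons i w)
    have "(\<lambda>x. snd x i w) \<in> measure_pmf p \<Otimes>\<^sub>M iid_seq p \<rightarrow>\<^sub>M measure_pmf p"
      by (rule measurable_compose[OF _ measurable_iid_coordinate],
          rule measurable_compose[OF measurable_snd measurable_iid_seq_coordinate])
    then show ?thesis using Cons by (simp add: case_prod_beta')
  qed
qed

text \<open>
  The branching property: a root value and independent i.i.d. families, grafted together, form an
  i.i.d. family. On a cylinder over finitely many words, the words group by their first letter and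
  both sides are the same finite product.
\<close>

lemma distr_graft: "distr (measure_pmf p \<Otimes>\<^sub>M iid_seq p) (iid p) (\<lambda>(m, \<omega>). graft m \<omega>) = iid p"
proof (rule measure_eqI_PiM_infinite[where I=UNIV and M="\<lambda>_. measure_pmf p", symmetric])
  interpret I: prob_space "iid p" by (rule prob_space_iid)
  interpret IS: prob_space "iid_seq p" by (rule prob_space_iid_seq)
  interpret ip: product_prob_space "\<lambda>_::nat list. measure_pmf p" UNIV ..
  interpret isq: product_prob_space "\<lambda>_::nat. iid p" UNIV by standard
  show "sets (iid p) = sets (\<Pi>\<^sub>M v\<in>UNIV. measure_pmf p)" by (simp add: iid_def)
  show "sets (distr (measure_pmf p \<Otimes>\<^sub>M iid_seq p) (iid p) (\<lambda>(m, \<omega>). graft m \<omega>)) = sets (\<Pi>\<^sub>M v\<in>UNIV. measure_pmf p)"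
    by (simp add: iid_def)
  show "finite_measure (iid p)" by (rule I.finite_measure_axioms)
  fix F :: "nat list \<Rightarrow> 'a set" and J :: "nat list set"
  assume J: "finite J"
  let ?cyl = "\<lambda>J F. prod_emb UNIV (\<lambda>_. measure_pmf p) J (Pi\<^sub>E J F)"
  have cyl: "?cyl J F = {f. \<forall>v\<in>J. f v \<in> F v}" for J :: "nat list set" and F
    by (auto simp: prod_emb_def PiE_UNIV_domain restrict_PiE_iff)
  have ecyl: "emeasure (iid p) (?cyl J F) = (\<Prod>v\<in>J. emeasure (measure_pmf p) (F v))" if "finite J" for J F
    unfolding iid_def by (rule ip.emeasure_PiM_emb) (use that in auto)
  have scyl: "?cyl J F \<in> sets (iid p)" if "finite J" for J F
    unfolding iid_def by (rule sets_PiM_I) (use that in auto)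
  define A where "A = (if [] \<in> J then F [] else UNIV)"
  define Ji where "Ji i = {w. i # w \<in> J}" for i
  define I where "I = {i. Ji i \<noteq> {}}"
  have fJi: "finite (Ji i)" for i
    by (rule finite_subset[of _ "tl ` J"]) (use J in \<open>force simp: Ji_def\<close>)+
  have fI: "finite I"
    by (rule finite_subset[of _ "hd ` J"]) (use J in \<open>force simp: I_def Ji_def\<close>)+
  let ?D = "\<lambda>i. ?cyl (Ji i) (\<lambda>w. F (i # w))"
  let ?E = "prod_emb UNIV (\<lambda>_. iid p) I (Pi\<^sub>E I ?D)"
  have E: "?E = {\<omega>. \<forall>i\<in>I. \<omega> i \<in> ?D i}"
    by (auto simp: prod_emb_def PiE_UNIV_domain restrict_PiE_iff Pi_iff)
  have vim: "(\<lambda>(m, \<omega>). graft m \<omega>) -` ?cyl J F = A \<times> ?E"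
  proof -
    have "(\<forall>v\<in>J. graft m \<omega> v \<in> F v) \<longleftrightarrow> m \<in> A \<and> (\<forall>i\<in>I. \<forall>w\<in>Ji i. \<omega> i w \<in> F (i # w))" for m \<omega>
    proof
      assume *: "\<forall>v\<in>J. graft m \<omega> v \<in> F v"
      then show "m \<in> A \<and> (\<forall>i\<in>I. \<forall>w\<in>Ji i. \<omega> i w \<in> F (i # w))"
        by (auto simp: A_def Ji_def dest: bspec[where x="[]"] bspec[where x="_ # _"])
    next
      assume *: "m \<in> A \<and> (\<forall>i\<in>I. \<forall>w\<in>Ji i. \<omega> i w \<in> F (i # w))"
      show "\<forall>v\<in>J. graft m \<omega> v \<in> F v"
      proof
        fix v assume "v \<in> J"
        then show "graft m \<omega> v \<in> F v" using * by (cases v) (auto simp: A_def I_def Ji_def)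
      qed
    qed
    note iff = this
    show ?thesis
      unfolding E unfolding cyl
      by (rule set_eqI) (auto simp only: vimage_eq split_paired_all case_prod_conv mem_Times_iff fst_conv snd_conv mem_Collect_eq iff)
  qed
  have "emeasure (distr (measure_pmf p \<Otimes>\<^sub>M iid_seq p) (iid p) (\<lambda>(m, \<omega>). graft m \<omega>)) (?cyl J F)
      = emeasure (measure_pmf p \<Otimes>\<^sub>M iid_seq p) (A \<times> ?E)"
    by (subst emeasure_distr[OF measurable_graft scyl[OF J]]) (simp add: vim space_pair_measure)
  also have "\<dots> = emeasure (measure_pmf p) A * emeasure (iid_seq p) ?E"
    by (rule IS.emeasure_pair_measure_Times) (auto simp: iid_seq_def intro!: sets_PiM_I fI scyl fJi)
  also have "emeasure (iid_seq p) ?E = (\<Prod>i\<in>I. emeasure (iid p) (?D i))"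
    unfolding iid_seq_def by (rule isq.emeasure_PiM_emb) (auto intro: fI scyl fJi)
  also have "\<dots> = (\<Prod>i\<in>I. \<Prod>w\<in>Ji i. emeasure (measure_pmf p) (F (i # w)))"
    by (intro prod.cong ecyl fJi refl)
  also have "\<dots> = (\<Prod>(i, w)\<in>Sigma I Ji. emeasure (measure_pmf p) (F (i # w)))"
    by (rule prod.Sigma) (auto intro: fI fJi)
  also have "\<dots> = (\<Prod>v\<in>J - {[]}. emeasure (measure_pmf p) (F v))"
  proof (rule prod.reindex_bij_witness[where i="\<lambda>v. (hd v, tl v)" and j="\<lambda>(i, w). i # w"])
    fix v assume "v \<in> J - {[]}"
    then show "(hd v, tl v) \<in> Sigma I Ji" by (cases v) (auto simp: I_def Ji_def)
  qed (auto simp: I_def Ji_def)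
  also have "emeasure (measure_pmf p) A * \<dots> = (\<Prod>v\<in>J. emeasure (measure_pmf p) (F v))"
  proof (cases "[] \<in> J")
    case True
    then show ?thesis using J by (simp add: A_def prod.remove)
  next
    case False
    then show ?thesis by (simp add: A_def measure_pmf.emeasure_space_1[simplified])
  qed
  finally show "emeasure (iid p) (?cyl J F)
      = emeasure (distr (measure_pmf p \<Otimes>\<^sub>M iid_seq p) (iid p) (\<lambda>(m, \<omega>). graft m \<omega>)) (?cyl J F)"
    using ecyl[OF J] by simp
qed

lemma integral_iid_graft:
  fixes h :: "(nat list \<Rightarrow> 'a) \<Rightarrow> real"
  assumes [measurable]: "h \<in> borel_measurable (iid p)" and B: "\<And>\<omega>. \<bar>h \<omega>\<bar> \<le> B"
  shows "integral\<^sup>L (iid p) h = (\<integral>m. (\<integral>\<omega>. h (graft m \<omega>) \<partial>iid_seq p) \<partial>measure_pmf p)"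
proof -
  interpret IS: prob_space "iid_seq p" by (rule prob_space_iid_seq)
  interpret P: pair_prob_space "measure_pmf p" "iid_seq p" ..
  have hm: "(\<lambda>x. h (case x of (m, \<omega>) \<Rightarrow> graft m \<omega>)) \<in> borel_measurable (measure_pmf p \<Otimes>\<^sub>M iid_seq p)"
    by (rule measurable_compose[OF measurable_graft assms(1)])
  have "integral\<^sup>L (iid p) h = integral\<^sup>L (distr (measure_pmf p \<Otimes>\<^sub>M iid_seq p) (iid p) (\<lambda>(m, \<omega>). graft m \<omega>)) h"
    by (simp only: distr_graft)
  also have "\<dots> = integral\<^sup>L (measure_pmf p \<Otimes>\<^sub>M iid_seq p) (\<lambda>x. h (case x of (m, \<omega>) \<Rightarrow> graft m \<omega>))"
    by (rule integral_distr[OF measurable_graft assms(1)])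
  also have "\<dots> = (\<integral>m. (\<integral>\<omega>. h (graft m \<omega>) \<partial>iid_seq p) \<partial>measure_pmf p)"
    by (subst P.integral_fst'[symmetric]) (auto intro!: P.integrable_const_bound[where B=B] hm B)
  finally show ?thesis .
qed

lemma integral_iid_seq_prod:
  fixes f :: "nat \<Rightarrow> (nat list \<Rightarrow> 'a) \<Rightarrow> real"
  assumes fm: "\<And>i. f i \<in> borel_measurable (iid p)" and B: "\<And>i \<omega>. \<bar>f i \<omega>\<bar> \<le> 1"
  shows "(\<integral>\<omega>. (\<Prod>i<n. f i (\<omega> i)) \<partial>iid_seq p) = (\<Prod>i<n. integral\<^sup>L (iid p) (f i))"
proof -
  interpret I: prob_space "iid p" by (rule prob_space_iid)
  interpret isq: product_prob_space "\<lambda>_::nat. iid p" UNIV by standard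
  let ?P = "\<Pi>\<^sub>M i\<in>{..<n}. iid p"
  have m: "(\<lambda>\<omega>. \<Prod>i<n. f i (\<omega> i)) \<in> borel_measurable ?P"
    by (intro borel_measurable_prod measurable_compose[OF _ fm] measurable_component_singleton) auto
  have "(\<integral>\<omega>. (\<Prod>i<n. f i (\<omega> i)) \<partial>iid_seq p)
     = (\<integral>\<omega>. (\<Prod>i<n. f i (restrict \<omega> {..<n} i)) \<partial>iid_seq p)" by simp
  also have "\<dots> = integral\<^sup>L (distr (iid_seq p) ?P (\<lambda>\<omega>. restrict \<omega> {..<n})) (\<lambda>\<omega>. \<Prod>i<n. f i (\<omega> i))"
    unfolding iid_seq_def
    by (rule integral_distr[symmetric, OF _ m]) (rule measurable_restrict_subset, simp)
  also have "\<dots> = integral\<^sup>L ?P (\<lambda>\<omega>. \<Prod>i<n. f i (\<omega> i))"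
    unfolding iid_seq_def by (subst isq.distr_PiM_restrict_finite) auto
  also have "\<dots> = (\<Prod>i<n. integral\<^sup>L (iid p) (f i))"
    by (rule isq.product_integral_prod) (auto intro!: I.integrable_const_bound[where B=1] fm B)
  finally show ?thesis .
qed

lemma measurable_branching_product:
  fixes f :: "nat \<Rightarrow> (nat list \<Rightarrow> 'a) \<Rightarrow> real"
  assumes fm: "\<And>i. f i \<in> borel_measurable (iid p)"
  shows "(\<lambda>\<omega>. \<Prod>i<\<kappa> (\<omega> []). f i (subfamily i \<omega>)) \<in> borel_measurable (iid p)"
proof -
  have "(\<lambda>\<omega>. \<kappa> (\<omega> [])) \<in> iid p \<rightarrow>\<^sub>M count_space UNIV"
    by (rule measurable_compose[OF measurable_iid_coordinate_count]) simp
  moreover have "(\<lambda>\<omega>. \<Prod>i<n. f i (subfamily i \<omega>)) \<in> borel_measurable (iid p)" for n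
    by (intro borel_measurable_prod measurable_compose[OF measurable_subfamily fm])
  ultimately show ?thesis by (rule measurable_compose_countable[rotated])
qed

text \<open>
  The number of factors may depend on the root. For offspring numbers \<open>\<kappa>\<close> is the identity; for
  displacements on a fixed tree it is a constant.
\<close>

lemma branching_property:
  fixes f :: "nat \<Rightarrow> (nat list \<Rightarrow> 'a) \<Rightarrow> real"
  assumes fm: "\<And>i. f i \<in> borel_measurable (iid p)" and B: "\<And>i \<omega>. \<bar>f i \<omega>\<bar> \<le> 1"
  shows "(\<integral>\<omega>. (\<Prod>i<\<kappa> (\<omega> []). f i (subfamily i \<omega>)) \<partial>iid p)
     = measure_pmf.expectation p (\<lambda>m. \<Prod>i<\<kappa> m. integral\<^sup>L (iid p) (f i))"
  by (subst integral_iid_graft[where B=1])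
     (auto simp: measurable_branching_product fm abs_prod integral_iid_seq_prod B intro!: prod_le_1)

text \<open>
  Here \<open>F y\<close> depends only on the values below the root, so the root value can be averaged separately.
\<close>

lemma integral_root_independent:
  fixes F :: "'a::countable \<Rightarrow> (nat list \<Rightarrow> 'a) \<Rightarrow> real"
  assumes Fm: "\<And>y. F y \<in> borel_measurable (iid p)" and B: "\<And>y \<omega>. \<bar>F y \<omega>\<bar> \<le> 1"
    and indep: "\<And>y m m' \<omega>. F y (graft m \<omega>) = F y (graft m' \<omega>)"
  shows "(\<integral>\<omega>. F (\<omega> []) \<omega> \<partial>iid p) = measure_pmf.expectation p (\<lambda>y. integral\<^sup>L (iid p) (F y))"
proof -
  have m: "(\<lambda>\<omega>. F (\<omega> []) \<omega>) \<in> borel_measurable (iid p)"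
    by (rule measurable_compose_countable[OF Fm measurable_iid_coordinate_count])
  have "integral\<^sup>L (iid p) (F y) = (\<integral>\<omega>. F y (graft y \<omega>) \<partial>iid_seq p)" for y
  proof -
    have "integral\<^sup>L (iid p) (F y) = (\<integral>m. (\<integral>\<omega>. F y (graft m \<omega>) \<partial>iid_seq p) \<partial>measure_pmf p)"
      by (rule integral_iid_graft[OF Fm B])
    also have "\<dots> = (\<integral>m. (\<integral>\<omega>. F y (graft y \<omega>) \<partial>iid_seq p) \<partial>measure_pmf p)"
      by (intro Bochner_Integration.integral_cong refl indep)
    finally show ?thesis by simp
  qed
  then show ?thesis
    by (subst integral_iid_graft[OF m B]) simp
qed

section \<open>The recursion for the avoidance probability\<close>

text \<open>
  The snake avoids \<open>K\<close> up to generation \<open>n\<close>. The displacement \<open>\<eta> [i]\<close> towards the child \<open>i\<close> is the root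
  value of the subfamily of \<open>i\<close>, which \<open>avoids\<close> itself never reads.
\<close>

primrec avoids :: "(int^'d) set \<Rightarrow> nat \<Rightarrow> int^'d \<Rightarrow> (nat list \<Rightarrow> nat) \<Rightarrow> (nat list \<Rightarrow> int^'d) \<Rightarrow> bool" where
  "avoids K 0 x \<xi> \<eta> \<longleftrightarrow> x \<notin> K"
| "avoids K (Suc n) x \<xi> \<eta> \<longleftrightarrow> x \<notin> K \<and>
     (\<forall>i<\<xi> []. avoids K n (x + subfamily i \<eta> []) (subfamily i \<xi>) (subfamily i \<eta>))"

lemma tree_vertices_Cons_iff:
  "i # w \<in> tree_vertices \<xi> \<longleftrightarrow> i < \<xi> [] \<and> w \<in> tree_vertices (subfamily i \<xi>)"
proof
  have "v \<in> tree_vertices \<xi> \<Longrightarrow> \<forall>i w. v = i # w \<longrightarrow> i < \<xi> [] \<and> w \<in> tree_vertices (subfamily i \<xi>)" for v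
  proof (induction rule: tree_vertices.induct)
    case root
    then show ?case by simp
  next
    case (child v j)
    show ?case
    proof (intro allI impI)
      fix i w assume *: "v @ [j] = i # w"
      show "i < \<xi> [] \<and> w \<in> tree_vertices (subfamily i \<xi>)"
      proof (cases v)
        case Nil
        then show ?thesis using * child(2) by (auto intro: tree_vertices.root)
      next
        case (Cons i' v')
        then have "i' = i" "w = v' @ [j]" using * by auto
        moreover have "i < \<xi> [] \<and> v' \<in> tree_vertices (subfamily i \<xi>)" using child(3) Cons \<open>i' = i\<close> by auto
        moreover have "j < subfamily i \<xi> v'" using child(2) Cons \<open>i' = i\<close> by (simp add: subfamily_def)
        ultimately show ?thesis by (auto intro: tree_vertices.child)
      qed
    qed
  qed
  then show "i # w \<in> tree_vertices \<xi> \<Longrightarrow> i < \<xi> [] \<and> w \<in> tree_vertices (subfamily i \<xi>)" by blast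
next
  assume *: "i < \<xi> [] \<and> w \<in> tree_vertices (subfamily i \<xi>)"
  have "w \<in> tree_vertices (subfamily i \<xi>) \<Longrightarrow> i # w \<in> tree_vertices \<xi>"
  proof (induction rule: tree_vertices.induct)
    case root
    show ?case using tree_vertices.child[OF tree_vertices.root, of i \<xi>] * by simp
  next
    case (child v j)
    then show ?case using tree_vertices.child[of "i # v" \<xi> j] by (simp add: subfamily_def)
  qed
  with * show "i # w \<in> tree_vertices \<xi>" by blast
qed

lemma snake_pos_Nil [simp]: "snake_pos x \<eta> [] = x"
  by (simp add: snake_pos_def)

lemma snake_pos_Cons: "snake_pos x \<eta> (i # w) = snake_pos (x + subfamily i \<eta> []) (subfamily i \<eta>) w"
  by (simp add: snake_pos_def subfamily_def sum.lessThan_Suc_shift add.assoc del: sum.lessThan_Suc)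

lemma avoids_iff:
  "avoids K n x \<xi> \<eta> \<longleftrightarrow> (\<forall>v\<in>tree_vertices \<xi>. length v \<le> n \<longrightarrow> snake_pos x \<eta> v \<notin> K)"
proof (induction n arbitrary: x \<xi> \<eta>)
  case 0
  show ?case using tree_vertices.root[of \<xi>] by auto
next
  case (Suc n)
  show ?case (is "?L \<longleftrightarrow> ?R")
  proof
    assume L: ?L
    show ?R
    proof (intro ballI impI)
      fix v assume v: "v \<in> tree_vertices \<xi>" "length v \<le> Suc n"
      show "snake_pos x \<eta> v \<notin> K"
      proof (cases v)
        case Nil
        then show ?thesis using L by simp
      next
        case (Cons i w)
        then show ?thesis using v L Suc by (simp add: tree_vertices_Cons_iff snake_pos_Cons)
      qed
    qed
  next
    assume R: ?R
    have "avoids K n (x + subfamily i \<eta> []) (subfamily i \<xi>) (subfamily i \<eta>)" if "i < \<xi> []" for i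
      unfolding Suc
    proof (intro ballI impI)
      fix w assume "w \<in> tree_vertices (subfamily i \<xi>)" "length w \<le> n"
      then show "snake_pos (x + subfamily i \<eta> []) (subfamily i \<eta>) w \<notin> K"
        using R that by (auto simp: tree_vertices_Cons_iff simp flip: snake_pos_Cons)
    qed
    moreover have "x \<notin> K" using R tree_vertices.root[of \<xi>] by force
    ultimately show ?L by simp
  qed
qed

lemma snake_avoids_iff: "snake_range x (\<xi>, \<eta>) \<inter> K = {} \<longleftrightarrow> (\<forall>n. avoids K n x \<xi> \<eta>)"
  unfolding avoids_iff snake_range_def by auto

lemma snake_space_eq: "snake_space \<mu> \<theta> = iid \<mu> \<Otimes>\<^sub>M iid \<theta>"
  by (simp add: snake_space_def iid_def)

lemma prob_space_snake: "prob_space (snake_space \<mu> \<theta>)"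
proof -
  interpret A: prob_space "iid \<mu>" by (rule prob_space_iid)
  interpret B: prob_space "iid \<theta>" by (rule prob_space_iid)
  interpret pair_prob_space "iid \<mu>" "iid \<theta>" ..
  show ?thesis unfolding snake_space_eq by (rule prob_space_axioms)
qed

lemma space_snake [simp]: "space (snake_space \<mu> \<theta>) = UNIV"
  by (simp add: snake_space_eq space_pair_measure)

lemma measurable_avoids:
  "Measurable.pred (iid \<mu> \<Otimes>\<^sub>M iid \<theta>) (\<lambda>\<omega>. avoids K n x (fst \<omega>) (snd \<omega>))"
proof (induction n arbitrary: x)
  case 0
  show ?case by simp
next
  case (Suc n)
  have sub: "(\<lambda>\<omega>. (subfamily i (fst \<omega>), subfamily i (snd \<omega>))) \<in> iid \<mu> \<Otimes>\<^sub>M iid \<theta> \<rightarrow>\<^sub>M iid \<mu> \<Otimes>\<^sub>M iid \<theta>" for i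
    by measurable
  have fixed: "Measurable.pred (iid \<mu> \<Otimes>\<^sub>M iid \<theta>) (\<lambda>\<omega>. avoids K n y (subfamily i (fst \<omega>)) (subfamily i (snd \<omega>)))" for i y
    using measurable_compose[OF sub Suc] by simp
  have pos: "(\<lambda>\<omega>. x + subfamily i (snd \<omega>) []) \<in> iid \<mu> \<Otimes>\<^sub>M iid \<theta> \<rightarrow>\<^sub>M count_space UNIV" for i
  proof -
    have "(\<lambda>\<omega>. snd \<omega> [i]) \<in> iid \<mu> \<Otimes>\<^sub>M iid \<theta> \<rightarrow>\<^sub>M count_space UNIV"
      by (rule measurable_compose[OF measurable_snd measurable_iid_coordinate_count])
    from measurable_compose[OF this, of "\<lambda>z. x + z" "count_space UNIV"] show ?thesis by (simp add: subfamily_def)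
  qed
  have one: "Measurable.pred (iid \<mu> \<Otimes>\<^sub>M iid \<theta>)
      (\<lambda>\<omega>. avoids K n (x + subfamily i (snd \<omega>) []) (subfamily i (fst \<omega>)) (subfamily i (snd \<omega>)))" for i
    by (rule measurable_compose_countable[OF fixed pos])
  have cnt: "(\<lambda>\<omega>. fst \<omega> []) \<in> iid \<mu> \<Otimes>\<^sub>M iid \<theta> \<rightarrow>\<^sub>M count_space UNIV"
    by (rule measurable_compose[OF measurable_fst measurable_iid_coordinate_count])
  have lt: "Measurable.pred (iid \<mu> \<Otimes>\<^sub>M iid \<theta>) (\<lambda>\<omega>. i < fst \<omega> [])" for i
    using measurable_compose[OF cnt, of "\<lambda>m. i < m" "count_space UNIV"] by simp
  have "Measurable.pred (iid \<mu> \<Otimes>\<^sub>M iid \<theta>) (\<lambda>\<omega>. \<forall>i. i < fst \<omega> [] \<longrightarrow>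
      avoids K n (x + subfamily i (snd \<omega>) []) (subfamily i (fst \<omega>)) (subfamily i (snd \<omega>)))"
    by (intro pred_intros_countable pred_intros_logic lt one)
  then show ?case by simp
qed

definition avoid_prob :: "nat pmf \<Rightarrow> (int^'d) pmf \<Rightarrow> (int^'d) set \<Rightarrow> nat \<Rightarrow> int^'d \<Rightarrow> real" where
  "avoid_prob \<mu> \<theta> K n x = measure (snake_space \<mu> \<theta>) {\<omega>. avoids K n x (fst \<omega>) (snd \<omega>)}"

lemma avoids_graft: "avoids K n x \<xi> (graft m \<omega>) = avoids K n x \<xi> (graft m' \<omega>)"
  by (cases n) auto

context
  fixes \<mu> :: "nat pmf" and \<theta> :: "(int^'d::finite) pmf" and K :: "(int^'d) set"
begin

definition avoid_indicator :: "nat \<Rightarrow> int^'d \<Rightarrow> (nat list \<Rightarrow> nat) \<Rightarrow> (nat list \<Rightarrow> int^'d) \<Rightarrow> real" where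
  "avoid_indicator n x \<xi> \<eta> = of_bool (avoids K n x \<xi> \<eta>)"

text \<open>
  The probability of avoiding \<open>K\<close> given the offspring numbers. Averaging in two stages needs
  the branching property only for one family at a time.
\<close>

definition quenched :: "nat \<Rightarrow> int^'d \<Rightarrow> (nat list \<Rightarrow> nat) \<Rightarrow> real" where
  "quenched n x \<xi> = integral\<^sup>L (iid \<theta>) (avoid_indicator n x \<xi>)"

lemma avoid_indicator_bounds: "\<bar>avoid_indicator n x \<xi> \<eta>\<bar> \<le> 1" "0 \<le> avoid_indicator n x \<xi> \<eta>" "avoid_indicator n x \<xi> \<eta> \<le> 1"
  by (auto simp: avoid_indicator_def)

lemma avoid_indicator_graft: "avoid_indicator n x \<xi> (graft m \<omega>) = avoid_indicator n x \<xi> (graft m' \<omega>)"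
  unfolding avoid_indicator_def by (subst avoids_graft[where m=m and m'=m']) (rule refl)

lemma measurable_ind_pair: "(\<lambda>\<omega>. avoid_indicator n x (fst \<omega>) (snd \<omega>)) \<in> borel_measurable (iid \<mu> \<Otimes>\<^sub>M iid \<theta>)"
  unfolding avoid_indicator_def by (rule measurable_compose[OF measurable_avoids]) simp

lemma measurable_ind: "avoid_indicator n x \<xi> \<in> borel_measurable (iid \<theta>)"
  using measurable_compose[OF measurable_Pair1'[of \<xi> "iid \<mu>" "iid \<theta>"] measurable_ind_pair[of n x]] by simp

lemma quenched_bounds: "0 \<le> quenched n x \<xi>" "quenched n x \<xi> \<le> 1" "\<bar>quenched n x \<xi>\<bar> \<le> 1"
proof -
  interpret B: prob_space "iid \<theta>" by (rule prob_space_iid)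
  show 0: "0 \<le> quenched n x \<xi>" unfolding quenched_def by (intro Bochner_Integration.integral_nonneg avoid_indicator_bounds)
  show 1: "quenched n x \<xi> \<le> 1" unfolding quenched_def
    by (rule B.integral_le_const) (auto intro!: B.integrable_const_bound[where B=1] measurable_ind avoid_indicator_bounds)
  show "\<bar>quenched n x \<xi>\<bar> \<le> 1" using 0 1 by simp
qed

lemma measurable_quenched: "quenched n x \<in> borel_measurable (iid \<mu>)"
proof -
  interpret B: prob_space "iid \<theta>" by (rule prob_space_iid)
  have "(\<lambda>\<xi>. \<integral>\<eta>. avoid_indicator n x \<xi> \<eta> \<partial>iid \<theta>) \<in> borel_measurable (iid \<mu>)"
    by (rule B.borel_measurable_lebesgue_integral) (use measurable_ind_pair in \<open>simp add: case_prod_beta'\<close>)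
  then show ?thesis by (simp add: quenched_def[abs_def])
qed

lemma avoid_prob_quenched: "avoid_prob \<mu> \<theta> K n x = integral\<^sup>L (iid \<mu>) (quenched n x)"
proof -
  interpret A: prob_space "iid \<mu>" by (rule prob_space_iid)
  interpret B: prob_space "iid \<theta>" by (rule prob_space_iid)
  interpret P: pair_prob_space "iid \<mu>" "iid \<theta>" ..
  have "avoid_prob \<mu> \<theta> K n x = integral\<^sup>L (iid \<mu> \<Otimes>\<^sub>M iid \<theta>) (indicator {\<omega>. avoids K n x (fst \<omega>) (snd \<omega>)})"
    unfolding avoid_prob_def snake_space_eq
    by (subst Bochner_Integration.integral_indicator) (auto simp: space_pair_measure)
  also have "\<dots> = integral\<^sup>L (iid \<mu> \<Otimes>\<^sub>M iid \<theta>) (\<lambda>\<omega>. avoid_indicator n x (fst \<omega>) (snd \<omega>))"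
    by (rule Bochner_Integration.integral_cong) (auto simp: avoid_indicator_def)
  also have "\<dots> = integral\<^sup>L (iid \<mu>) (quenched n x)"
    unfolding quenched_def
    by (subst P.integral_fst'[symmetric])
       (auto intro!: P.integrable_const_bound[where B=1] measurable_ind_pair avoid_indicator_bounds)
  finally show ?thesis .
qed

text \<open>
  Given the tree, the subtrees of the root avoid \<open>K\<close> independently, each starting from a fresh
  \<open>\<theta>\<close>-distributed displacement.
\<close>

lemma quenched_Suc:
  "quenched (Suc n) x \<xi> = of_bool (x \<notin> K) *
     (\<Prod>i<\<xi> []. measure_pmf.expectation \<theta> (\<lambda>y. quenched n (x + y) (subfamily i \<xi>)))"
proof -
  let ?f = "\<lambda>i \<zeta>. avoid_indicator n (x + \<zeta> []) (subfamily i \<xi>) \<zeta>"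
  have fm: "?f i \<in> borel_measurable (iid \<theta>)" for i
  proof (rule measurable_compose_countable[where g="\<lambda>\<zeta>. x + \<zeta> []" and f="\<lambda>z \<zeta>. avoid_indicator n z (subfamily i \<xi>) \<zeta>"])
    show "(\<lambda>\<zeta>. x + \<zeta> []) \<in> iid \<theta> \<rightarrow>\<^sub>M count_space UNIV"
      by (rule measurable_compose[OF measurable_iid_coordinate_count]) simp
  qed (rule measurable_ind)
  have "avoid_indicator (Suc n) x \<xi> = (\<lambda>\<eta>. of_bool (x \<notin> K) * (\<Prod>i<\<xi> []. ?f i (subfamily i \<eta>)))"
    by (rule ext) (auto simp: avoid_indicator_def of_bool_def prod_zero_iff)
  then have "quenched (Suc n) x \<xi> = of_bool (x \<notin> K) * (\<integral>\<eta>. (\<Prod>i<\<xi> []. ?f i (subfamily i \<eta>)) \<partial>iid \<theta>)"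
    unfolding quenched_def by (simp only: integral_mult_right_zero)
  also have "(\<integral>\<eta>. (\<Prod>i<\<xi> []. ?f i (subfamily i \<eta>)) \<partial>iid \<theta>) = (\<Prod>i<\<xi> []. integral\<^sup>L (iid \<theta>) (?f i))"
    using branching_property[of ?f \<theta> "\<lambda>_. \<xi> []", OF fm avoid_indicator_bounds(1)] by simp
  also have "(\<Prod>i<\<xi> []. integral\<^sup>L (iid \<theta>) (?f i))
      = (\<Prod>i<\<xi> []. measure_pmf.expectation \<theta> (\<lambda>y. quenched n (x + y) (subfamily i \<xi>)))"
  proof (rule prod.cong[OF refl])
    fix i
    show "integral\<^sup>L (iid \<theta>) (?f i) = measure_pmf.expectation \<theta> (\<lambda>y. quenched n (x + y) (subfamily i \<xi>))"
      unfolding quenched_def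
      by (rule integral_root_independent[where F="\<lambda>y. avoid_indicator n (x + y) (subfamily i \<xi>)"])
         (rule measurable_ind avoid_indicator_bounds avoid_indicator_graft)+
  qed
  finally show ?thesis .
qed

lemma avoid_prob_bounds: "0 \<le> avoid_prob \<mu> \<theta> K n x" "avoid_prob \<mu> \<theta> K n x \<le> 1"
  using prob_space.prob_le_1[OF prob_space_snake] by (auto simp: avoid_prob_def)

lemma avoid_prob_0: "avoid_prob \<mu> \<theta> K 0 x = of_bool (x \<notin> K)"
  using prob_space.prob_space[OF prob_space_snake[of \<mu> \<theta>]] by (auto simp: avoid_prob_def)

text \<open>
  Average \<open>quenched_Suc\<close> over the offspring numbers and use the branching property once more.
\<close>

lemma avoid_prob_Suc:
  "avoid_prob \<mu> \<theta> K (Suc n) x =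
     of_bool (x \<notin> K) * measure_pmf.expectation \<mu> (\<lambda>m. avg \<theta> (avoid_prob \<mu> \<theta> K n) x ^ m)"
proof -
  interpret A: prob_space "iid \<mu>" by (rule prob_space_iid)
  interpret P: pair_prob_space "iid \<mu>" "measure_pmf \<theta>" ..
  let ?f = "\<lambda>\<xi>. measure_pmf.expectation \<theta> (\<lambda>y. quenched n (x + y) \<xi>)"
  have pm: "(\<lambda>(\<xi>, y). quenched n (x + y) \<xi>) \<in> borel_measurable (iid \<mu> \<Otimes>\<^sub>M measure_pmf \<theta>)"
  proof -
    have "(\<lambda>\<omega>. quenched n (x + snd \<omega>) (fst \<omega>)) \<in> borel_measurable (iid \<mu> \<Otimes>\<^sub>M measure_pmf \<theta>)"
    proof (rule measurable_compose_countable[where g=snd and f="\<lambda>y \<omega>. quenched n (x + y) (fst \<omega>)"])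
      show "snd \<in> iid \<mu> \<Otimes>\<^sub>M measure_pmf \<theta> \<rightarrow>\<^sub>M count_space UNIV" by measurable
      show "(\<lambda>\<omega>. quenched n (x + y) (fst \<omega>)) \<in> borel_measurable (iid \<mu> \<Otimes>\<^sub>M measure_pmf \<theta>)" for y
        by (rule measurable_compose[OF measurable_fst measurable_quenched])
    qed
    then show ?thesis by (simp add: case_prod_beta')
  qed
  have fm: "?f \<in> borel_measurable (iid \<mu>)"
    by (rule measure_pmf.borel_measurable_lebesgue_integral[OF pm])
  have fb: "\<bar>?f \<xi>\<bar> \<le> 1" for \<xi>
    using avg_bound[of "\<lambda>y. quenched n y \<xi>" 1 \<theta> x] quenched_bounds(3) by (simp add: avg_def)
  have "avoid_prob \<mu> \<theta> K (Suc n) x = of_bool (x \<notin> K) * (\<integral>\<xi>. (\<Prod>i<\<xi> []. ?f (subfamily i \<xi>)) \<partial>iid \<mu>)"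
    by (simp add: avoid_prob_quenched quenched_Suc[abs_def])
  also have "(\<integral>\<xi>. (\<Prod>i<\<xi> []. ?f (subfamily i \<xi>)) \<partial>iid \<mu>) = measure_pmf.expectation \<mu> (\<lambda>m. integral\<^sup>L (iid \<mu>) ?f ^ m)"
    using branching_property[of "\<lambda>_. ?f" \<mu> "\<lambda>m. m", OF fm fb] by simp
  also have "integral\<^sup>L (iid \<mu>) ?f = avg \<theta> (avoid_prob \<mu> \<theta> K n) x"
  proof -
    have "integral\<^sup>L (iid \<mu>) ?f = measure_pmf.expectation \<theta> (\<lambda>y. integral\<^sup>L (iid \<mu>) (quenched n (x + y)))"
      by (rule P.Fubini_integral[symmetric])
         (auto intro!: P.integrable_const_bound[where B=1] pm quenched_bounds(3))
    then show ?thesis by (simp add: avg_def avoid_prob_quenched)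
  qed
  finally show ?thesis .
qed

lemma avoids_mono: "avoids K n x \<xi> \<eta> \<Longrightarrow> m \<le> n \<Longrightarrow> avoids K m x \<xi> \<eta>"
  by (auto simp: avoids_iff)

lemma sets_avoids: "{\<omega>. avoids K n x (fst \<omega>) (snd \<omega>)} \<in> sets (snake_space \<mu> \<theta>)"
  using measurable_avoids[where \<mu>=\<mu> and \<theta>=\<theta> and K=K and n=n and x=x] by (simp add: snake_space_eq pred_def space_pair_measure)

lemma visit_event_eq: "visit_event \<mu> \<theta> K x = UNIV - (\<Inter>n. {\<omega>. avoids K n x (fst \<omega>) (snd \<omega>)})"
proof -
  have "snake_range x \<omega> \<inter> K = {} \<longleftrightarrow> (\<forall>n. avoids K n x (fst \<omega>) (snd \<omega>))" for \<omega>
    using snake_avoids_iff[of x "fst \<omega>" "snd \<omega>" K] by simp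
  then show ?thesis by (auto simp: visit_event_def)
qed

lemma sets_visit_event [measurable]: "visit_event \<mu> \<theta> K x \<in> sets (snake_space \<mu> \<theta>)"
proof -
  have "(\<Inter>n. {\<omega>. avoids K n x (fst \<omega>) (snd \<omega>)}) \<in> sets (snake_space \<mu> \<theta>)"
    using sets_avoids by (intro sets.countable_INT) blast+
  from sets.compl_sets[OF this] show ?thesis by (simp add: visit_event_eq)
qed

lemma avoid_prob_tendsto:
  "(\<lambda>n. avoid_prob \<mu> \<theta> K n x) \<longlonglongrightarrow> 1 - measure (snake_space \<mu> \<theta>) (visit_event \<mu> \<theta> K x)"
proof -
  interpret S: prob_space "snake_space \<mu> \<theta>" by (rule prob_space_snake)
  let ?A = "\<lambda>n. {\<omega>. avoids K n x (fst \<omega>) (snd \<omega>)}"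
  have "(\<lambda>n. measure (snake_space \<mu> \<theta>) (?A n)) \<longlonglongrightarrow> measure (snake_space \<mu> \<theta>) (\<Inter>n. ?A n)"
    by (rule S.finite_Lim_measure_decseq) (auto simp: decseq_def sets_avoids dest: avoids_mono)
  moreover have "measure (snake_space \<mu> \<theta>) (visit_event \<mu> \<theta> K x) = 1 - measure (snake_space \<mu> \<theta>) (\<Inter>n. ?A n)"
    using S.prob_compl[of "\<Inter>n. ?A n"] sets_avoids by (auto simp: visit_event_eq)
  ultimately show ?thesis by (simp add: avoid_prob_def)
qed

end

section \<open>The offspring generating function\<close>

text \<open>
  Together with Bernoulli's inequality this gives \<open>u - C u\<^sup>2 \<le> 1 - \<Phi>(1 - u) \<le> u\<close>.
\<close>

lemma power_upper_quadratic:
  fixes u :: real assumes "0 \<le> u" "u \<le> 1"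
  shows "(1 - u) ^ m \<le> 1 - real m * u + (real m)\<^sup>2 * u\<^sup>2"
proof (induction m)
  case (Suc m)
  have "(1 - u) ^ Suc m \<le> (1 - u) * (1 - real m * u + (real m)\<^sup>2 * u\<^sup>2)"
    using Suc assms by (simp add: mult_left_mono)
  also have "\<dots> = 1 - real (Suc m) * u + (real m + (real m)\<^sup>2) * u\<^sup>2 - (real m)\<^sup>2 * (u * u\<^sup>2)"
    by (simp add: algebra_simps power2_eq_square)
  also have "\<dots> \<le> 1 - real (Suc m) * u + (real m + (real m)\<^sup>2) * u\<^sup>2"
    using assms by simp
  also have "\<dots> \<le> 1 - real (Suc m) * u + (real (Suc m))\<^sup>2 * u\<^sup>2"
    by (intro add_left_mono mult_right_mono) (auto simp: power2_eq_square algebra_simps)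
  finally show ?case .
qed simp

text \<open>
  The probability that at least one of the children succeeds when each does so independently with
  probability \<open>u\<close>, that is, \<open>1 - \<Phi>(1 - u)\<close> for the generating function \<open>\<Phi>\<close> of \<open>\<mu>\<close>.
\<close>

definition some_child_prob :: "nat pmf \<Rightarrow> real \<Rightarrow> real" where
  "some_child_prob \<mu> u = 1 - measure_pmf.expectation \<mu> (\<lambda>m. (1 - u) ^ m)"

lemma integrable_power_unit:
  fixes s :: real assumes "0 \<le> s" "s \<le> 1"
  shows "integrable (measure_pmf \<mu>) (\<lambda>m. s ^ m)"
  by (rule integrable_pmf_bounded[where B=1]) (use assms in \<open>simp add: power_le_one\<close>)

lemma some_child_prob_mono:
  assumes "0 \<le> u" "u \<le> v" "v \<le> 1" shows "some_child_prob \<mu> u \<le> some_child_prob \<mu> v"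
  unfolding some_child_prob_def
  by (intro diff_left_mono integral_mono integrable_power_unit power_mono) (use assms in auto)

lemma some_child_prob_le:
  assumes "integrable (measure_pmf \<mu>) real" "measure_pmf.expectation \<mu> real = 1" "0 \<le> u" "u \<le> 1"
  shows "some_child_prob \<mu> u \<le> u"
proof -
  have "1 - u = measure_pmf.expectation \<mu> (\<lambda>m. 1 + real m * (- u))"
    using assms by simp
  also have "\<dots> \<le> measure_pmf.expectation \<mu> (\<lambda>m. (1 - u) ^ m)"
  proof (rule integral_mono)
    show "integrable (measure_pmf \<mu>) (\<lambda>m. 1 + real m * (- u))" using assms by simp
    show "integrable (measure_pmf \<mu>) (\<lambda>m. (1 - u) ^ m)" by (rule integrable_power_unit) (use assms in auto)
    show "1 + real m * (- u) \<le> (1 - u) ^ m" for m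
      using Bernoulli_inequality[of "- u" m] assms by simp
  qed
  finally show ?thesis by (simp add: some_child_prob_def)
qed

lemma some_child_prob_ge:
  assumes "integrable (measure_pmf \<mu>) real" "measure_pmf.expectation \<mu> real = 1"
    "integrable (measure_pmf \<mu>) (\<lambda>n. (real n)\<^sup>2)" "0 \<le> u" "u \<le> 1"
  shows "u - (measure_pmf.expectation \<mu> (\<lambda>n. (real n)\<^sup>2) + 1) * u\<^sup>2 \<le> some_child_prob \<mu> u"
proof -
  have "measure_pmf.expectation \<mu> (\<lambda>m. (1 - u) ^ m) \<le> measure_pmf.expectation \<mu> (\<lambda>m. 1 - real m * u + (real m)\<^sup>2 * u\<^sup>2)"
  proof (rule integral_mono)
    show "integrable (measure_pmf \<mu>) (\<lambda>m. 1 - real m * u + (real m)\<^sup>2 * u\<^sup>2)" using assms by simp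
    show "integrable (measure_pmf \<mu>) (\<lambda>m. (1 - u) ^ m)" by (rule integrable_power_unit) (use assms in auto)
    show "(1 - u) ^ m \<le> 1 - real m * u + (real m)\<^sup>2 * u\<^sup>2" for m by (rule power_upper_quadratic) (use assms in auto)
  qed
  also have "\<dots> = 1 - u + measure_pmf.expectation \<mu> (\<lambda>n. (real n)\<^sup>2) * u\<^sup>2"
    using assms by simp
  finally show ?thesis
    unfolding some_child_prob_def distrib_right using zero_le_power2[of u] by linarith
qed

section \<open>Visiting probabilities\<close>

locale snake = lattice_step \<theta> for \<theta> :: "(int^'d::finite) pmf" +
  fixes \<mu> :: "nat pmf"
  assumes offspring_mean: "integrable (measure_pmf \<mu>) real" "measure_pmf.expectation \<mu> real = 1"
    and offspring_var: "integrable (measure_pmf \<mu>) (\<lambda>n. (real n)\<^sup>2)"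
begin

abbreviation "\<SS> \<equiv> snake_space \<mu> \<theta>"

definition visit_prob :: "(int^'d) set \<Rightarrow> int^'d \<Rightarrow> real" where
  "visit_prob K x = measure \<SS> (visit_event \<mu> \<theta> K x)"

lemma visit_prob_bounds: "0 \<le> visit_prob K x" "visit_prob K x \<le> 1"
  using prob_space.prob_le_1[OF prob_space_snake] by (auto simp: visit_prob_def)

lemma avoid_tendsto: "(\<lambda>n. avoid_prob \<mu> \<theta> K n x) \<longlonglongrightarrow> 1 - visit_prob K x"
  unfolding visit_prob_def by (rule avoid_prob_tendsto)

lemma avoid_abs: "\<bar>avoid_prob \<mu> \<theta> K n x\<bar> \<le> 1"
  using avoid_prob_bounds[of \<mu> \<theta> K n x] by simp

lemma avg_one_minus:
  assumes "\<And>x. \<bar>u x\<bar> \<le> B" shows "avg \<theta> (\<lambda>x. 1 - u x) x = 1 - avg \<theta> u x"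
proof -
  have "avg \<theta> (\<lambda>x. 1 + (-1) * u x) x = avg \<theta> (\<lambda>x. 1) x + avg \<theta> (\<lambda>x. (-1) * u x) x"
    by (rule avg_add[where B=1 and B'=B]) (use assms in auto)
  then show ?thesis unfolding avg_cmult by (simp add: avg_def)
qed

lemma visit_prob_in: "x \<in> K \<Longrightarrow> visit_prob K x = 1"
proof -
  assume x: "x \<in> K"
  have "(\<lambda>n. avoid_prob \<mu> \<theta> K (Suc n) x) \<longlonglongrightarrow> 1 - visit_prob K x"
    using LIMSEQ_Suc[OF avoid_tendsto] .
  moreover have "(\<lambda>n. avoid_prob \<mu> \<theta> K (Suc n) x) = (\<lambda>n. 0)"
    using x by (simp add: avoid_prob_Suc)
  ultimately have "1 - visit_prob K x = 0" using LIMSEQ_unique[OF _ tendsto_const] by metis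
  then show ?thesis by simp
qed

lemma visit_prob_out:
  assumes x: "x \<notin> K" shows "visit_prob K x = some_child_prob \<mu> (avg \<theta> (visit_prob K) x)"
proof -
  let ?s = "\<lambda>n. avg \<theta> (avoid_prob \<mu> \<theta> K n) x" and ?t = "avg \<theta> (\<lambda>x. 1 - visit_prob K x) x"
  have s: "?s \<longlonglongrightarrow> ?t"
    unfolding avg_def
    by (rule integral_dominated_convergence[where w="\<lambda>_. 1"]) (auto intro: avoid_tendsto simp: avoid_abs)
  have sb: "\<bar>?s n\<bar> \<le> 1" for n by (rule avg_bound) (rule avoid_abs)
  have "(\<lambda>n. measure_pmf.expectation \<mu> (\<lambda>m. ?s n ^ m)) \<longlonglongrightarrow> measure_pmf.expectation \<mu> (\<lambda>m. ?t ^ m)"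
  proof (rule integral_dominated_convergence[where w="\<lambda>_. 1"])
    show "AE m in measure_pmf \<mu>. (\<lambda>n. ?s n ^ m) \<longlonglongrightarrow> ?t ^ m"
      by (intro AE_I2 tendsto_power s)
    show "AE m in measure_pmf \<mu>. norm (?s n ^ m) \<le> 1" for n
      by (intro AE_I2) (simp add: power_abs power_le_one sb)
  qed auto
  then have "(\<lambda>n. avoid_prob \<mu> \<theta> K (Suc n) x) \<longlonglongrightarrow> measure_pmf.expectation \<mu> (\<lambda>m. ?t ^ m)"
    using x by (simp add: avoid_prob_Suc)
  then have "1 - visit_prob K x = measure_pmf.expectation \<mu> (\<lambda>m. ?t ^ m)"
    using LIMSEQ_unique[OF LIMSEQ_Suc[OF avoid_tendsto]] by blast
  also have "?t = 1 - avg \<theta> (visit_prob K) x" by (rule avg_one_minus[where B=1]) (use visit_prob_bounds in simp)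
  finally show ?thesis by (simp add: some_child_prob_def)
qed

text \<open>
  The function \<open>V\<close> solves \<open>V = P V + 1\<^sub>K\<close>. By induction it dominates the probability of a visit
  within \<open>n\<close> generations. The induction is needed because the equation for the visiting probability does
  not by itself force decay at infinity.
\<close>

lemma visit_prob_le_green:
  assumes K: "finite K" shows "visit_prob K x \<le> (\<Sum>a\<in>K. g (a - x)) / 2"
proof -
  define V where "V x = (\<Sum>a\<in>K. g (a - x)) / 2" for x
  obtain B where B: "\<And>z. \<bar>g z\<bar> \<le> B" using green_bounded by blast
  have V0: "0 \<le> V x" for x by (simp add: V_def sum_nonneg)
  have Vb: "\<bar>V x\<bar> \<le> real (card K) * B" for x
  proof -
    have "V x \<le> (\<Sum>a\<in>K. g (a - x))" unfolding V_def by (simp add: sum_nonneg)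
    also have "\<dots> \<le> real (card K) * B"
      using B by (intro sum_bounded_above) (auto intro: order_trans[OF abs_ge_self])
    finally show ?thesis using V0[of x] by simp
  qed
  have Veq: "V x = avg \<theta> V x + of_bool (x \<in> K)" for x
  proof -
    have I: "integrable (measure_pmf q) (\<lambda>y. g (a - (x + y)))" for a
      by (rule integrable_pmf_bounded[where B=B]) (use B in simp)
    have "avg q V x = (\<Sum>a\<in>K. avg q (\<lambda>x. g (a - x)) x) / 2"
      unfolding avg_def V_def using I by simp
    also have "\<dots> = V x - of_bool (x \<in> K) / 2"
      unfolding avg_g V_def using K by (simp add: sum_subtractf diff_divide_distrib)
    finally have "(avg \<theta> V x + V x) / 2 = V x - of_bool (x \<in> K) / 2"
      unfolding avg_lazy[OF Vb] .
    then show ?thesis by (simp add: field_simps)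
  qed
  have avgV0: "0 \<le> avg \<theta> V x" for x unfolding avg_def by (intro Bochner_Integration.integral_nonneg V0)
  have step: "1 - avoid_prob \<mu> \<theta> K n x \<le> V x" for n x
  proof (induction n arbitrary: x)
    case 0
    show ?case using Veq[of x] avgV0[of x] V0[of x] by (auto simp: avoid_prob_0)
  next
    case (Suc n)
    show ?case
    proof (cases "x \<in> K")
      case True
      then show ?thesis using Veq[of x] avgV0[of x] by (simp add: avoid_prob_Suc)
    next
      case False
      let ?u = "avg \<theta> (\<lambda>x. 1 - avoid_prob \<mu> \<theta> K n x) x"
      have pb: "\<bar>1 - avoid_prob \<mu> \<theta> K n x\<bar> \<le> 1" "0 \<le> 1 - avoid_prob \<mu> \<theta> K n x" for x
        using avoid_prob_bounds[of \<mu> \<theta> K n x] by auto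
      have u: "0 \<le> ?u" "?u \<le> 1"
        using avg_bound[of "\<lambda>x. 1 - avoid_prob \<mu> \<theta> K n x" 1 \<theta> x] pb
        by (auto simp: avg_def abs_le_iff intro!: Bochner_Integration.integral_nonneg)
      have "avg \<theta> (avoid_prob \<mu> \<theta> K n) x = 1 - ?u"
        using avg_one_minus[of "avoid_prob \<mu> \<theta> K n" 1 x] avoid_abs by simp
      then have "1 - avoid_prob \<mu> \<theta> K (Suc n) x = some_child_prob \<mu> ?u"
        using False by (simp add: avoid_prob_Suc some_child_prob_def)
      also have "\<dots> \<le> ?u" by (rule some_child_prob_le[OF offspring_mean u])
      also have "\<dots> \<le> avg \<theta> V x" by (rule avg_mono[OF pb(1) Vb Suc])
      also have "\<dots> = V x" using Veq[of x] False by simp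
      finally show ?thesis .
    qed
  qed
  have "(\<lambda>n. 1 - avoid_prob \<mu> \<theta> K n x) \<longlonglongrightarrow> 1 - (1 - visit_prob K x)"
    by (intro tendsto_diff tendsto_const avoid_tendsto)
  then have "1 - (1 - visit_prob K x) \<le> V x"
    by (rule LIMSEQ_le_const2) (use step in auto)
  then show ?thesis by (simp add: V_def)
qed

lemma visit_prob_asymptotic:
  assumes K: "finite K" "K \<noteq> {}"
  shows "\<exists>cap c. cap > 0 \<and> c > 0 \<and> (\<forall>x. c / bracket x ^ k \<le> visit_prob K x) \<and>
    (\<forall>\<epsilon>>0. \<forall>\<^sub>F x in at_znorm_infinity. \<bar>visit_prob K x - g (- x) * cap\<bar> \<le> \<epsilon> / bracket x ^ k)"
proof (rule hitting_asymptotic[where K=K and \<psi>="some_child_prob \<mu>" and C="measure_pmf.expectation \<mu> (\<lambda>n. (real n)\<^sup>2) + 1"])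
  show "measure_pmf.expectation \<mu> (\<lambda>n. (real n)\<^sup>2) + 1 > 0"
    by (rule add_nonneg_pos) auto
  show "finite K" "K \<noteq> {}" by (fact K)+
  show "visit_prob K x \<le> (\<Sum>a\<in>K. g (a - x)) / 2" for x by (rule visit_prob_le_green[OF K(1)])
qed (auto intro: visit_prob_bounds visit_prob_in visit_prob_out some_child_prob_mono
       some_child_prob_le[OF offspring_mean] some_child_prob_ge[OF offspring_mean offspring_var])

lemma visit_prob_pos: "finite K \<Longrightarrow> K \<noteq> {} \<Longrightarrow> visit_prob K x > 0"
proof -
  assume "finite K" "K \<noteq> {}"
  then obtain c where "c > 0" "\<And>x. c / bracket x ^ k \<le> visit_prob K x" using visit_prob_asymptotic by blast
  moreover have "c / bracket x ^ k > 0" using \<open>c > 0\<close> by simp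
  ultimately show ?thesis using less_le_trans by blast
qed

text \<open>
  Both probabilities are multiples of the same \<open>g(-x)\<close> up to an error that is small compared with the lower bound
  for the denominator; the limit is the ratio of the capacities.
\<close>

lemma visit_prob_ratio_converges:
  assumes A: "finite A" and K: "finite K" "K \<noteq> {}"
  shows "\<exists>l. ((\<lambda>x. visit_prob A x / visit_prob K x) \<longlongrightarrow> l) at_znorm_infinity"
proof (cases "A = {}")
  case True
  then have "visit_prob A x = 0" for x by (simp add: visit_prob_def visit_event_def)
  then show ?thesis by (intro exI[of _ 0]) simp
next
  case False
  obtain a where a: "a > 0" "\<And>\<epsilon>. \<epsilon> > 0 \<Longrightarrow> \<forall>\<^sub>F x in at_znorm_infinity. \<bar>visit_prob A x - g (- x) * a\<bar> \<le> \<epsilon> / bracket x ^ k"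
    using visit_prob_asymptotic[OF A False] by blast
  obtain b c where b: "b > 0" "\<And>\<epsilon>. \<epsilon> > 0 \<Longrightarrow> \<forall>\<^sub>F x in at_znorm_infinity. \<bar>visit_prob K x - g (- x) * b\<bar> \<le> \<epsilon> / bracket x ^ k"
    and c: "c > 0" "\<And>x. c / bracket x ^ k \<le> visit_prob K x"
    using visit_prob_asymptotic[OF K] by blast
  have "((\<lambda>x. visit_prob A x / visit_prob K x) \<longlongrightarrow> a / b) at_znorm_infinity"
  proof (rule tendstoI)
    fix \<epsilon> :: real assume e: "\<epsilon> > 0"
    define \<delta> where "\<delta> = \<epsilon> * c * b / (2 * (a + b))"
    have d: "\<delta> > 0" using e a b c by (simp add: \<delta>_def)
    show "\<forall>\<^sub>F x in at_znorm_infinity. dist (visit_prob A x / visit_prob K x) (a / b) < \<epsilon>"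
      using a(2)[OF d] b(2)[OF d]
    proof eventually_elim
      case (elim x)
      have pK: "visit_prob K x > 0" by (rule visit_prob_pos[OF K])
      have "visit_prob A x * b - a * visit_prob K x = b * (visit_prob A x - g (- x) * a) - a * (visit_prob K x - g (- x) * b)"
        by (simp add: algebra_simps)
      also have "\<bar>\<dots>\<bar> \<le> b * (\<delta> / bracket x ^ k) + a * (\<delta> / bracket x ^ k)"
      proof (rule order_trans[OF abs_triangle_ineq4 add_mono])
        show "\<bar>b * (visit_prob A x - g (- x) * a)\<bar> \<le> b * (\<delta> / bracket x ^ k)"
          unfolding abs_mult using elim(1) b(1) by (simp only: abs_of_pos mult_left_mono less_imp_le)
        show "\<bar>a * (visit_prob K x - g (- x) * b)\<bar> \<le> a * (\<delta> / bracket x ^ k)"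
          unfolding abs_mult using elim(2) a(1) by (simp only: abs_of_pos mult_left_mono less_imp_le)
      qed
      also have "\<dots> = (a + b) * \<delta> / bracket x ^ k" by (simp add: algebra_simps add_divide_distrib)
      also have "(a + b) * \<delta> = \<epsilon> / 2 * b * c"
      proof -
        have "s * (y / (2 * s)) = y / 2" if "s \<noteq> 0" for s y :: real using that by simp
        from this[of "a + b" "\<epsilon> * c * b"] show ?thesis using a b by (simp add: \<delta>_def mult_ac)
      qed
      also have "\<epsilon> / 2 * b * c / bracket x ^ k = \<epsilon> / 2 * b * (c / bracket x ^ k)" by simp
      also have "\<dots> \<le> \<epsilon> / 2 * b * visit_prob K x" using e b c(2)[of x] by (intro mult_left_mono) auto
      also have "\<dots> < \<epsilon> * (b * visit_prob K x)" using e b pK by simp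
      finally have *: "\<bar>visit_prob A x * b - a * visit_prob K x\<bar> < \<epsilon> * (b * visit_prob K x)" .
      have "visit_prob A x / visit_prob K x - a / b = (visit_prob A x * b - a * visit_prob K x) / (b * visit_prob K x)"
        using b pK by (simp add: field_simps)
      then have "dist (visit_prob A x / visit_prob K x) (a / b) = \<bar>visit_prob A x * b - a * visit_prob K x\<bar> / (b * visit_prob K x)"
        using b pK by (simp add: dist_real_def abs_mult)
      also have "\<dots> < \<epsilon>" using * b pK by (simp add: divide_less_eq)
      finally show ?case .
    qed
  qed
  then show ?thesis by blast
qed

text \<open>
  The event that the snake visits \<open>K\<close>, misses \<open>A\<close> and covers \<open>B\<close>; for \<open>A = K - B\<close> it says that the
  snake visits \<open>K\<close> and its trace on \<open>K\<close> is \<open>B\<close>.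
\<close>

definition pattern :: "(int^'d) set \<Rightarrow> (int^'d) set \<Rightarrow> (int^'d) set \<Rightarrow> int^'d \<Rightarrow> ((nat list \<Rightarrow> nat) \<times> (nat list \<Rightarrow> int^'d)) set" where
  "pattern K A B x = {\<omega>. snake_range x \<omega> \<inter> A = {} \<and> B \<subseteq> snake_range x \<omega> \<and> snake_range x \<omega> \<inter> K \<noteq> {}}"

lemma visit_event_UNIV: "visit_event \<mu> \<theta> K x = {\<omega>. snake_range x \<omega> \<inter> K \<noteq> {}}"
  by (simp add: visit_event_def)

lemma sets_pattern:
  assumes "finite B" shows "pattern K A B x \<in> sets \<SS>"
proof -
  have "pattern K A B x = (visit_event \<mu> \<theta> K x - visit_event \<mu> \<theta> A x) \<inter> (\<Inter>b\<in>B. visit_event \<mu> \<theta> {b} x) \<inter> space \<SS>"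
    by (auto simp: pattern_def visit_event_UNIV)
  also have "\<dots> \<in> sets \<SS>"
  proof (cases "B = {}")
    case False
    then show ?thesis using assms by (intro sets.Int sets.Diff sets_visit_event sets.finite_INT sets.top) auto
  qed (auto intro!: sets.Diff sets_visit_event)
  finally show ?thesis .
qed

text \<open>
  Induction on \<open>B\<close> replaces inclusion--exclusion: covering \<open>b\<close> as well means covering \<open>B\<close> but not
  covering \<open>B\<close> while missing \<open>b\<close>.
\<close>

lemma pattern_ratio_converges:
  assumes K: "finite K" "K \<noteq> {}" and B: "finite B" "B \<subseteq> K" and A: "A \<subseteq> K"
  shows "\<exists>l. ((\<lambda>x. measure \<SS> (pattern K A B x) / visit_prob K x) \<longlongrightarrow> l) at_znorm_infinity"
  using B A
proof (induction B arbitrary: A rule: finite_induct)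
  interpret S: prob_space "snake_space \<mu> \<theta>" by (rule prob_space_snake)
  case empty
  then have A: "A \<subseteq> K" by simp
  obtain l where l: "((\<lambda>x. visit_prob A x / visit_prob K x) \<longlongrightarrow> l) at_znorm_infinity"
    using visit_prob_ratio_converges[OF finite_subset[OF A K(1)] K] by blast
  have "measure \<SS> (pattern K A {} x) / visit_prob K x = 1 - visit_prob A x / visit_prob K x" for x
  proof -
    have "pattern K A {} x = visit_event \<mu> \<theta> K x - visit_event \<mu> \<theta> A x"
      by (auto simp: pattern_def visit_event_UNIV)
    moreover have "visit_event \<mu> \<theta> A x \<subseteq> visit_event \<mu> \<theta> K x" using A by (auto simp: visit_event_UNIV)
    ultimately have "measure \<SS> (pattern K A {} x) = visit_prob K x - visit_prob A x"
      unfolding visit_prob_def by (simp add: S.finite_measure_Diff sets_visit_event)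
    then show ?thesis using visit_prob_pos[OF K, of x] by (simp add: diff_divide_distrib)
  qed
  then show ?case using tendsto_diff[OF tendsto_const[of 1] l] by auto
next
  interpret S: prob_space "snake_space \<mu> \<theta>" by (rule prob_space_snake)
  case (insert b B)
  obtain l1 where l1: "((\<lambda>x. measure \<SS> (pattern K A B x) / visit_prob K x) \<longlongrightarrow> l1) at_znorm_infinity"
    using insert.IH[of A] insert.prems by auto
  obtain l2 where l2: "((\<lambda>x. measure \<SS> (pattern K (insert b A) B x) / visit_prob K x) \<longlongrightarrow> l2) at_znorm_infinity"
    using insert.IH[of "insert b A"] insert.prems by auto
  have "measure \<SS> (pattern K A (insert b B) x) / visit_prob K x
     = measure \<SS> (pattern K A B x) / visit_prob K x - measure \<SS> (pattern K (insert b A) B x) / visit_prob K x" for x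
  proof -
    have "pattern K A (insert b B) x = pattern K A B x - pattern K (insert b A) B x"
      by (auto simp: pattern_def)
    moreover have "pattern K (insert b A) B x \<subseteq> pattern K A B x" by (auto simp: pattern_def)
    ultimately show ?thesis
      using insert.hyps(1) by (simp add: S.finite_measure_Diff sets_pattern diff_divide_distrib)
  qed
  then show ?case using tendsto_diff[OF l1 l2] by auto
qed

section \<open>The conditional law of the intersection\<close>

lemma trace_vimage:
  assumes "B \<subseteq> K"
  shows "visit_event \<mu> \<theta> K x \<inter> {\<omega>. K \<inter> snake_range x \<omega> = B} = pattern K (K - B) B x"
  using assms by (auto simp: pattern_def visit_event_UNIV)

lemma sets_trace:
  assumes "finite K" "B \<subseteq> K"
  shows "{\<omega>. K \<inter> snake_range x \<omega> = B} \<in> sets \<SS>"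
proof (cases "B = {}")
  case True
  have "{\<omega>. K \<inter> snake_range x \<omega> = B} = space \<SS> - visit_event \<mu> \<theta> K x"
    using True by (auto simp: visit_event_UNIV)
  then show ?thesis by (simp add: sets.Diff sets_visit_event del: space_snake)
next
  case False
  have "{\<omega>. K \<inter> snake_range x \<omega> = B} = pattern K (K - B) B x"
    using assms False by (auto simp: pattern_def)
  then show ?thesis using sets_pattern[of B] finite_subset[OF assms(2,1)] by simp
qed

lemma measurable_trace:
  assumes "finite K"
  shows "(\<lambda>\<omega>. K \<inter> snake_range x \<omega>) \<in> uniform_measure \<SS> A \<rightarrow>\<^sub>M count_space (Pow K)"
  using assms sets_trace[OF assms]
  by (subst measurable_count_space_eq2) (auto simp: vimage_def)

lemma prob_space_cond_law:
  assumes "finite K" "K \<noteq> {}"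
  shows "prob_space (cond_intersection_law \<mu> \<theta> K x)"
proof -
  interpret S: prob_space "snake_space \<mu> \<theta>" by (rule prob_space_snake)
  have "emeasure \<SS> (visit_event \<mu> \<theta> K x) \<noteq> 0"
    using visit_prob_pos[OF assms, of x] by (simp add: S.emeasure_eq_measure visit_prob_def)
  then have "prob_space (uniform_measure \<SS> (visit_event \<mu> \<theta> K x))"
    by (intro prob_space_uniform_measure) auto
  then show ?thesis
    unfolding cond_intersection_law_def by (rule prob_space.prob_space_distr) (rule measurable_trace[OF assms(1)])
qed

lemma measure_cond_law:
  assumes K: "finite K" "K \<noteq> {}" and B: "B \<subseteq> K"
  shows "measure (cond_intersection_law \<mu> \<theta> K x) {B} = measure \<SS> (pattern K (K - B) B x) / visit_prob K x"
proof -
  interpret S: prob_space "snake_space \<mu> \<theta>" by (rule prob_space_snake)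
  have "measure (cond_intersection_law \<mu> \<theta> K x) {B}
     = measure (uniform_measure \<SS> (visit_event \<mu> \<theta> K x)) {\<omega>. K \<inter> snake_range x \<omega> = B}"
    unfolding cond_intersection_law_def
    by (subst measure_distr[OF measurable_trace[OF K(1)]]) (use B in \<open>auto simp: vimage_def\<close>)
  also have "\<dots> = measure \<SS> (visit_event \<mu> \<theta> K x \<inter> {\<omega>. K \<inter> snake_range x \<omega> = B}) / visit_prob K x"
    unfolding visit_prob_def
  proof (rule measure_uniform_measure)
    show "emeasure \<SS> (visit_event \<mu> \<theta> K x) \<noteq> 0"
      using visit_prob_pos[OF K, of x] by (simp add: S.emeasure_eq_measure visit_prob_def)
  qed (auto simp: sets_trace[OF K(1) B])
  finally show ?thesis by (simp only: trace_vimage[OF B])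
qed

end

lemma integral_finite_space:
  fixes f :: "'a \<Rightarrow> real"
  assumes "finite_measure N" "space N = F" "finite F" "sets N = Pow F"
  shows "integral\<^sup>L N f = (\<Sum>B\<in>F. f B * measure N {B})"
proof -
  interpret finite_measure N by fact
  have "integral\<^sup>L N f = integral\<^sup>L N (\<lambda>y. \<Sum>B\<in>F. f B * indicator {B} y)"
    using assms by (intro Bochner_Integration.integral_cong)
      (auto simp: indicator_def if_distrib[of "\<lambda>x. _ * x"] cong: if_cong)
  also have "\<dots> = (\<Sum>B\<in>F. integral\<^sup>L N (\<lambda>y. f B * indicator {B} y))"
    using assms by (intro Bochner_Integration.integral_sum Bochner_Integration.integrable_mult_right integrable_real_indicator)
      (auto simp: less_top[symmetric])
  also have "\<dots> = (\<Sum>B\<in>F. f B * measure N {B})"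
    using assms by (intro sum.cong) auto
  finally show ?thesis .
qed

lemma borel_prob_discrete:
  assumes "prob_space N" "space N = F" "sets N = Pow F"
  shows "borel_prob (discrete_topology F) N"
proof -
  have "{U. U \<subseteq> F} = Pow F" by auto
  then have "sigma_sets F {U. openin (discrete_topology F) U} = Pow F"
    using sigma_algebra.sigma_sets_eq[OF sigma_algebra_Pow[of F]] by simp
  with assms show ?thesis by (simp add: borel_prob_def)
qed

theorem theorem1p2:
  fixes \<mu> :: "nat pmf" and \<theta> :: "(int^'d) pmf" and K :: "(int^'d) set"
  assumes dim: "CARD('d) \<ge> 5"
    and offspring_mean: "integrable (measure_pmf \<mu>) real" "measure_pmf.expectation \<mu> real = 1"
    and offspring_var: "integrable (measure_pmf \<mu>) (\<lambda>n. (real n)^2)" "measure_pmf.variance \<mu> real > 0"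
    and step_mean: "integrable (measure_pmf \<theta>) real_vec" "measure_pmf.expectation \<theta> real_vec = 0"
    and step_supp: "\<And>H. add_subgroup H \<Longrightarrow> H \<noteq> UNIV \<Longrightarrow> \<not> set_pmf \<theta> \<subseteq> H"
    and step_tail: "\<exists>C::real. C > 0 \<and>
      (\<forall>r::real. r \<ge> 1 \<longrightarrow> measure_pmf.prob \<theta> {z. znorm z > r} < C * r powr - real CARD('d))"
    and K: "K \<noteq> {}" "finite K"
  shows "\<exists>L. converges_in_distribution (discrete_topology (Pow K))
                (cond_intersection_law \<mu> \<theta> K) L at_znorm_infinity"
proof -
  interpret snake \<theta> \<mu>
    by unfold_locales (fact dim step_mean step_supp step_tail offspring_mean offspring_var)+
  let ?N = "cond_intersection_law \<mu> \<theta> K"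
  have N: "prob_space (?N x)" "space (?N x) = Pow K" "sets (?N x) = Pow (Pow K)" for x
    using prob_space_cond_law[OF K(2,1)] by (auto simp: cond_intersection_law_def)
  have "\<exists>l. ((\<lambda>x. measure (?N x) {B}) \<longlongrightarrow> l) at_znorm_infinity" if "B \<subseteq> K" for B
    unfolding measure_cond_law[OF K(2,1) that]
    by (rule pattern_ratio_converges) (use K that finite_subset in auto)
  then obtain l where l: "\<And>B. B \<subseteq> K \<Longrightarrow> ((\<lambda>x. measure (?N x) {B}) \<longlongrightarrow> l B) at_znorm_infinity"
    by metis
  have l0: "l B \<ge> 0" if "B \<subseteq> K" for B
    by (rule tendsto_lowerbound[OF l[OF that] _ at_znorm_infinity_neq_bot]) simp
  have fin: "finite (Pow K)" using K by simp
  have int: "integral\<^sup>L (?N x) f = (\<Sum>B\<in>Pow K. f B * measure (?N x) {B})" for f :: "(int^'d) set \<Rightarrow> real" and x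
    by (rule integral_finite_space[OF prob_space.finite_measure[OF N(1)] N(2) fin N(3)])
  have lim: "((\<lambda>x. integral\<^sup>L (?N x) f) \<longlongrightarrow> (\<Sum>B\<in>Pow K. f B * l B)) at_znorm_infinity" for f
    unfolding int by (intro tendsto_sum tendsto_mult tendsto_const l) simp
  have "integral\<^sup>L (?N x) (\<lambda>_. 1 :: real) = 1" for x
    using prob_space.prob_space[OF N(1)] by simp
  with lim[of "\<lambda>_. 1"] have "((\<lambda>x. 1) \<longlongrightarrow> (\<Sum>B\<in>Pow K. l B)) (at_znorm_infinity :: (int^'d) filter)" by simp
  then have sum1: "(\<Sum>B\<in>Pow K. l B) = 1"
    using tendsto_unique[OF at_znorm_infinity_neq_bot _ tendsto_const] by metis
  have sum1': "(\<Sum>B\<in>Pow K. ennreal (l B)) = 1"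
    using sum1 l0 by (subst sum_ennreal) auto
  \<comment> \<open>The limits of the point probabilities sum to one because \<open>Pow K\<close> is finite, so they define the limit law.\<close>
  define L where "L = point_measure (Pow K) (\<lambda>B. ennreal (l B))"
  have L: "prob_space L" "space L = Pow K" "sets L = Pow (Pow K)"
    unfolding L_def by (auto intro!: prob_space_point_measure fin l0 simp: space_point_measure sets_point_measure sum1')
  have mL: "measure L {B} = l B" if "B \<subseteq> K" for B
    unfolding L_def measure_def using that l0[OF that] fin by (subst emeasure_point_measure_finite) auto
  have intL: "integral\<^sup>L L f = (\<Sum>B\<in>Pow K. f B * l B)" for f
  proof -
    have "integral\<^sup>L L f = (\<Sum>B\<in>Pow K. f B * measure L {B})"
      by (rule integral_finite_space[OF prob_space.finite_measure[OF L(1)] L(2) fin L(3)])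
    also have "\<dots> = (\<Sum>B\<in>Pow K. f B * l B)" by (intro sum.cong) (auto simp: mL)
    finally show ?thesis .
  qed
  have "converges_in_distribution (discrete_topology (Pow K)) ?N L at_znorm_infinity"
    unfolding converges_in_distribution_def
  proof (intro conjI allI impI)
    show "borel_prob (discrete_topology (Pow K)) L" by (rule borel_prob_discrete[OF L])
    show "\<forall>\<^sub>F x in at_znorm_infinity. borel_prob (discrete_topology (Pow K)) (?N x)"
      by (intro always_eventually allI borel_prob_discrete N)
    show "((\<lambda>x. \<integral>y. f y \<partial>?N x) \<longlongrightarrow> (\<integral>y. f y \<partial>L)) at_znorm_infinity" for f :: "(int^'d) set \<Rightarrow> real"
      unfolding intL by (rule lim)
  qed
  then show ?thesis by blast
qed

end
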